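(* Let $n$ and $\Delta$ be positive integers such that $\Delta\ge \frac{3(n-1)}{4}$, and let $G$ be an $n$-vertex $\Delta$-critical graph (so $\Delta=\Delta(G)$). If $G$ has a full-deficiency pair, then $G$ is overfull. Consequently, $G$ is obtained from an $(n-1)$-vertex $\Delta$-regular Class 1 multigraph by a vertex-splitting.
   Context: All graphs $G$ are finite and simple unless called multigraphs. $\chi'(G)$ denotes the chromatic index (least number of colors in a proper edge coloring); a (multi)graph is Class 1 if $\chi'=\Delta$ (its maximum degree). $G$ is $\Delta$-critical if $\chi'(G)=\Delta(G)+1$ and $\chi'(H)<\Delta(G)+1$ for every proper subgraph $H$. $G$ is overfull if $|E(G)|>\Delta(G)\lfloor |V(G)|/2\rfloor$. A full-deficiency pair of $G$ is a pair $(u,v)$ of adjacent vertices with $d_G(u)+d_G(v)=\Delta(G)+2$. Vertex-splitting: for a vertex $v$ with $d(v)=t\ge 2$ and neighbors (with multiplicity) $u_1,\dots,u_t$, replace $v$ by two new adjacent vertices $v_1,v_2$, joining $v_1$ to $u_1,\dots,u_s$ and $v_2$ to $u_{s+1},\dots,u_t$ for some $s\in[1,t-1]$, and keeping all other edges. *)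

theory Defs
  imports Complex_Main
begin

text \<open>Simple graphs and multigraphs share one type: edges carry labels, and \<open>ends\<close> maps
  each edge to the set of its two end vertices. Parallel edges are distinct labels with
  equal end sets. The value of \<open>ends\<close> on labels outside \<open>edges\<close> is irrelevant.\<close>

record ('v, 'e) graph =
  verts :: "'v set"
  edges :: "'e set"
  ends :: "'e \<Rightarrow> 'v set"

locale multigraph =
  fixes G :: "('v, 'e) graph"
  assumes finite_verts: "finite (verts G)"
    and finite_edges: "finite (edges G)"
    and ends_subset: "e \<in> edges G \<Longrightarrow> ends G e \<subseteq> verts G"
    and card_ends: "e \<in> edges G \<Longrightarrow> card (ends G e) = 2"

locale simple_graph = multigraph +
  assumes ends_inj: "inj_on (ends G) (edges G)"

definition adjacent :: "('v, 'e) graph \<Rightarrow> 'v \<Rightarrow> 'v \<Rightarrow> bool" where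
  "adjacent G u v \<longleftrightarrow> (\<exists>e \<in> edges G. ends G e = {u, v})"

definition incident_edges :: "('v, 'e) graph \<Rightarrow> 'v \<Rightarrow> 'e set" where
  "incident_edges G v = {e \<in> edges G. v \<in> ends G e}"

definition degree :: "('v, 'e) graph \<Rightarrow> 'v \<Rightarrow> nat" where
  "degree G v = card (incident_edges G v)"

text \<open>Only meaningful for graphs with at least one vertex.\<close>

definition max_degree :: "('v, 'e) graph \<Rightarrow> nat" where
  "max_degree G = Max (degree G ` verts G)"

definition regular :: "nat \<Rightarrow> ('v, 'e) graph \<Rightarrow> bool" where
  "regular k G \<longleftrightarrow> (\<forall>v \<in> verts G. degree G v = k)"

definition proper_edge_coloring :: "('v, 'e) graph \<Rightarrow> nat \<Rightarrow> ('e \<Rightarrow> nat) \<Rightarrow> bool" where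
  "proper_edge_coloring G k c \<longleftrightarrow>
     (\<forall>e \<in> edges G. c e < k) \<and>
     (\<forall>e \<in> edges G. \<forall>f \<in> edges G. e \<noteq> f \<and> ends G e \<inter> ends G f \<noteq> {} \<longrightarrow> c e \<noteq> c f)"

definition chromatic_index :: "('v, 'e) graph \<Rightarrow> nat" where
  "chromatic_index G = (LEAST k. \<exists>c. proper_edge_coloring G k c)"

definition class1 :: "('v, 'e) graph \<Rightarrow> bool" where
  "class1 G \<longleftrightarrow> chromatic_index G = max_degree G"

definition subgraph :: "('v, 'e) graph \<Rightarrow> ('v, 'e) graph \<Rightarrow> bool" where
  "subgraph H G \<longleftrightarrow>
     multigraph H \<and> verts H \<subseteq> verts G \<and> edges H \<subseteq> edges G \<and>
     (\<forall>e \<in> edges H. ends H e = ends G e)"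

definition proper_subgraph :: "('v, 'e) graph \<Rightarrow> ('v, 'e) graph \<Rightarrow> bool" where
  "proper_subgraph H G \<longleftrightarrow>
     subgraph H G \<and> (verts H \<noteq> verts G \<or> edges H \<noteq> edges G)"

definition critical :: "nat \<Rightarrow> ('v, 'e) graph \<Rightarrow> bool" where
  "critical \<Delta> G \<longleftrightarrow>
     max_degree G = \<Delta> \<and> chromatic_index G = \<Delta> + 1 \<and>
     (\<forall>H. proper_subgraph H G \<longrightarrow> chromatic_index H < \<Delta> + 1)"

definition overfull :: "('v, 'e) graph \<Rightarrow> bool" where
  "overfull G \<longleftrightarrow> card (edges G) > max_degree G * (card (verts G) div 2)"

definition full_deficiency_pair :: "('v, 'e) graph \<Rightarrow> 'v \<Rightarrow> 'v \<Rightarrow> bool" where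
  "full_deficiency_pair G u v \<longleftrightarrow>
     u \<in> verts G \<and> v \<in> verts G \<and> adjacent G u v \<and>
     degree G u + degree G v = max_degree G + 2"

text \<open>\<open>G\<close> arises from \<open>H\<close> by splitting \<open>v\<close> into \<open>v1\<close> and \<open>v2\<close>. The neighbours of \<open>v\<close> counted
  with multiplicity are the edges at \<open>v\<close>; the sets \<open>A\<close> and \<open>B\<close> of those handed to \<open>v1\<close> and
  to \<open>v2\<close> are both nonempty, which forces \<open>v\<close> to have degree at least 2. Old edges keep their
  labels, and \<open>f\<close> is the new edge between \<open>v1\<close> and \<open>v2\<close>. As \<open>v\<close> is deleted, its name may be
  reused for \<open>v1\<close> or \<open>v2\<close>.\<close>

definition vertex_splitting :: "('v, 'e) graph \<Rightarrow> ('v, 'e) graph \<Rightarrow> bool" where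
  "vertex_splitting H G \<longleftrightarrow>
     (\<exists>v v1 v2 f A B.
        v \<in> verts H \<and> v1 \<noteq> v2 \<and> v1 \<notin> verts H - {v} \<and> v2 \<notin> verts H - {v} \<and>
        f \<notin> edges H \<and>
        A \<union> B = incident_edges H v \<and> A \<inter> B = {} \<and> A \<noteq> {} \<and> B \<noteq> {} \<and>
        verts G = (verts H - {v}) \<union> {v1, v2} \<and>
        edges G = insert f (edges H) \<and>
        ends G f = {v1, v2} \<and>
        (\<forall>e \<in> A. ends G e = insert v1 (ends H e - {v})) \<and>
        (\<forall>e \<in> B. ends G e = insert v2 (ends H e - {v})) \<and>
        (\<forall>e \<in> edges H - incident_edges H v. ends G e = ends H e))"

end

theory Submission
  imports Defs
begin

text \<open>Let \<open>ab\<close> be the full-deficiency pair. In a \<open>\<Delta>\<close>-colouring of \<open>G - ab\<close> every colour is missing at exactly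
  one of \<open>a\<close> and \<open>b\<close>. Once all other vertices are known to have degree \<open>\<Delta>\<close>, every colour class misses exactly
  one vertex, so \<open>n\<close> is odd and \<open>G\<close> is overfull, and identifying \<open>a\<close> with \<open>b\<close> turns the colour classes into
  perfect matchings.

  If \<open>a\<close> and \<open>b\<close> have degree at least 3, Kempe changes along paths \<open>a b u x\<close> and \<open>a b u y x\<close> exclude
  deficient vertices near \<open>{a, b}\<close>, and connectivity excludes the others.

  Otherwise \<open>a\<close> has degree 2. Let \<open>b\<close>, \<open>c\<close> be its neighbours; in every colouring of \<open>G - a\<close> both miss the
  same single colour. Suppose that \<open>s1\<close>, \<open>s2\<close> are deficient. As \<open>\<Delta> \<ge> 3(n - 1)/4\<close>, there is a common
  neighbour \<open>u\<close> of \<open>b\<close>, \<open>c\<close>, \<open>s1\<close>, \<open>s2\<close>; uncolouring \<open>bu\<close> or \<open>cu\<close> and moving the colours of \<open>us1\<close> and \<open>us2\<close>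
  produces a Kempe chain with three ends. A vertex of low degree has no neighbour in common with \<open>b\<close>, so one
  of its neighbours plays the role of \<open>s1\<close> or \<open>s2\<close>, the edge between them being left uncoloured. Hence at most one
  vertex is deficient, and the parity of the colour classes excludes that one as well.\<close>

text \<open>The cases differ in the number of colours missing at \<open>b\<close> in a colouring of
  \<open>G - ab\<close>, which is \<open>deg a - 1\<close>. If there are two of them, one can be
  kept on an edge of the path while a Kempe change with the other adjusts the far end. With degree 2
  there is no such spare, and the contradictions come from playing the two neighbours of
  \<open>a\<close>, which miss the same colour, against each other.

  The constant 3/4 is what makes four neighbourhoods of size about \<Delta> meet.

  The obstacle is the vertex of low degree with an uncoloured edge: the statement about
  \<open>b\<close> and \<open>c\<close> then holds only for colourings in which this edge can be
  coloured again, and a Kempe chain through the vertex may destroy that. Two facts overcome it. Such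
  a vertex has degree less than \<open>\<Delta> / 3\<close>, so many colours are missing there; and
  a kite coloured only with these colours can be treated as if the vertex did not exist.\<close>

subsection \<open>Kempe changes for families of matchings\<close>

text \<open>A colouring of the edge set \<open>F\<close> (a set of doubletons) is stored as one involution per colour:
  \<open>m i\<close> exchanges the ends of every edge of colour \<open>i\<close>, and \<open>m i v = v\<close> says that \<open>i\<close> is missing at \<open>v\<close>.
  Edges of the ambient graph that are not in \<open>F\<close> count as uncoloured.\<close>

definition mcol :: "nat set \<Rightarrow> 'v set set \<Rightarrow> (nat \<Rightarrow> 'v \<Rightarrow> 'v) \<Rightarrow> bool" where
  "mcol K F m \<longleftrightarrow>
     (\<forall>i\<in>K. \<forall>v. m i (m i v) = v) \<and>
     (\<forall>i\<in>K. \<forall>v. m i v \<noteq> v \<longrightarrow> {v, m i v} \<in> F) \<and>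
     (\<forall>v w. v \<noteq> w \<longrightarrow> {v, w} \<in> F \<longrightarrow> (\<exists>i\<in>K. m i v = w)) \<and>
     (\<forall>i\<in>K. \<forall>j\<in>K. \<forall>v. m i v = m j v \<longrightarrow> m i v \<noteq> v \<longrightarrow> i = j)"

lemma mcol_invol: "mcol K F m \<Longrightarrow> i \<in> K \<Longrightarrow> m i (m i v) = v"
  and mcol_edge: "mcol K F m \<Longrightarrow> i \<in> K \<Longrightarrow> m i v \<noteq> v \<Longrightarrow> {v, m i v} \<in> F"
  and mcol_inj: "mcol K F m \<Longrightarrow> i \<in> K \<Longrightarrow> j \<in> K \<Longrightarrow> m i v = m j v \<Longrightarrow> m i v \<noteq> v \<Longrightarrow> i = j"
  unfolding mcol_def by blast+

lemma mcol_ex: "mcol K F m \<Longrightarrow> {v, w} \<in> F \<Longrightarrow> v \<noteq> w \<Longrightarrow> \<exists>i\<in>K. m i v = w"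
  unfolding mcol_def by blast

lemma mcol_sym: "mcol K F m \<Longrightarrow> i \<in> K \<Longrightarrow> m i v = w \<Longrightarrow> m i w = v"
  using mcol_invol by metis

section \<open>Kempe chains and Kempe changes\<close>

definition kclosed :: "(nat \<Rightarrow> 'v \<Rightarrow> 'v) \<Rightarrow> nat \<Rightarrow> nat \<Rightarrow> 'v set \<Rightarrow> bool" where
  "kclosed m p q X \<longleftrightarrow> (\<forall>v\<in>X. m p v \<in> X \<and> m q v \<in> X)"

text \<open>As \<open>m p\<close> and \<open>m q\<close> are involutions for colours of
  \<open>K\<close>, reachability is symmetric (\<open>kempe_sym\<close>), and this set is the
  component of \<open>x\<close> in the union of the two colour classes.\<close>

definition kempe :: "(nat \<Rightarrow> 'v \<Rightarrow> 'v) \<Rightarrow> nat \<Rightarrow> nat \<Rightarrow> 'v \<Rightarrow> 'v set" where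
  "kempe m p q x = {y. (x, y) \<in> {(v, w). w = m p v \<or> w = m q v}\<^sup>*}"

text \<open>For every \<open>kclosed\<close> set \<open>X\<close> this is again a colouring; unions
  of chains are allowed, so that several ends can be treated in one change.\<close>

definition kswap :: "(nat \<Rightarrow> 'v \<Rightarrow> 'v) \<Rightarrow> nat \<Rightarrow> nat \<Rightarrow> 'v set \<Rightarrow> nat \<Rightarrow> 'v \<Rightarrow> 'v" where
  "kswap m p q X = (\<lambda>i v. if v \<in> X then m (if i = p then q else if i = q then p else i) v else m i v)"

lemma kempe_self [simp, intro]: "x \<in> kempe m p q x"
  by (simp add: kempe_def)

lemma kclosed_kempe [simp, intro]: "kclosed m p q (kempe m p q x)"
  unfolding kclosed_def kempe_def by (auto intro: rtrancl_into_rtrancl)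

lemma kempe_step: "y \<in> kempe m p q x \<Longrightarrow> m p y \<in> kempe m p q x" "y \<in> kempe m p q x \<Longrightarrow> m q y \<in> kempe m p q x"
  using kclosed_kempe[of m p q x] unfolding kclosed_def by auto

lemma kempe_minimal:
  assumes "kclosed m p q X" "x \<in> X" shows "kempe m p q x \<subseteq> X"
proof
  fix y assume "y \<in> kempe m p q x"
  then have "(x, y) \<in> {(v, w). w = m p v \<or> w = m q v}\<^sup>*" by (simp add: kempe_def)
  then show "y \<in> X" by induction (use assms in \<open>auto simp: kclosed_def\<close>)
qed

lemma kclosed_UN: "(\<And>x. x \<in> I \<Longrightarrow> kclosed m p q (Z x)) \<Longrightarrow> kclosed m p q (\<Union>x\<in>I. Z x)"
  unfolding kclosed_def by blast

lemma kclosed_notin: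
  assumes "mcol K F m" "p \<in> K" "q \<in> K" "kclosed m p q X" "v \<notin> X"
  shows "m p v \<notin> X" "m q v \<notin> X"
  using assms mcol_invol unfolding kclosed_def by metis+

text \<open>The complement of a closed set is closed, because the two maps are involutions. If
  \<open>x\<close> were outside the chain of \<open>y\<close>, the chain of \<open>x\<close> would
  therefore stay outside as well.\<close>

lemma kempe_sym:
  assumes "mcol K F m" "p \<in> K" "q \<in> K" "y \<in> kempe m p q x"
  shows "kempe m p q y = kempe m p q x"
proof
  show "kempe m p q y \<subseteq> kempe m p q x" using assms(4) by (intro kempe_minimal) auto
  have "kclosed m p q (- kempe m p q y)"
    unfolding kclosed_def
    using kclosed_notin[OF assms(1-3) kclosed_kempe[of m p q y]] by blast
  then have "x \<in> kempe m p q y" using kempe_minimal[of m p q "- kempe m p q y" x] assms(4) by auto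
  then show "kempe m p q x \<subseteq> kempe m p q y" by (intro kempe_minimal) auto
qed

lemma kempe_commute: "kempe m p q x = kempe m q p x"
  unfolding kempe_def by (rule arg_cong[where f="\<lambda>r. {y. (x, y) \<in> r\<^sup>*}"]) auto

lemma mcol_kswap:
  assumes m: "mcol K F m" and pq: "p \<in> K" "q \<in> K" and X: "kclosed m p q X"
  shows "mcol K F (kswap m p q X)"
proof -
  define r where "r = (\<lambda>i. if i = p then q else if i = q then p else i)"
  have rK: "r i \<in> K" if "i \<in> K" for i using that pq by (auto simp: r_def)
  have rr: "r (r i) = i" for i by (auto simp: r_def)
  have k: "kswap m p q X i v = (if v \<in> X then m (r i) v else m i v)" for i v
    by (simp add: kswap_def r_def)
  have inX: "m (r i) v \<in> X \<longleftrightarrow> v \<in> X" if "i = p \<or> i = q" for i v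
    using that X kclosed_notin[OF m pq X] unfolding kclosed_def r_def by auto
  have same: "r i = i" if "\<not> (i = p \<or> i = q)" for i using that by (auto simp: r_def)
  have i1: "kswap m p q X i (kswap m p q X i v) = v" if "i \<in> K" for i v
  proof (cases "i = p \<or> i = q")
    case True
    then show ?thesis using inX[OF True] inX[of "r i" v] rr rK[OF that] that mcol_invol[OF m]
      unfolding k by (auto simp: r_def split: if_splits)
  next
    case False
    then show ?thesis using same[OF False] mcol_invol[OF m that] by (simp add: k)
  qed
  have i2: "{v, kswap m p q X i v} \<in> F" if "i \<in> K" "kswap m p q X i v \<noteq> v" for i v
    using that mcol_edge[OF m] rK unfolding k by (auto split: if_splits)
  have i3: "\<exists>i\<in>K. kswap m p q X i v = w" if vw: "v \<noteq> w" "{v, w} \<in> F" for v w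
  proof -
    obtain i where i: "i \<in> K" "m i v = w" using mcol_ex[OF m vw(2,1)] by blast
    show ?thesis
    proof (cases "v \<in> X")
      case True then show ?thesis using i rr rK by (intro bexI[of _ "r i"]) (auto simp: k)
    next
      case False then show ?thesis using i by (intro bexI[of _ i]) (auto simp: k)
    qed
  qed
  have i4: "i = j" if "i \<in> K" "j \<in> K" "kswap m p q X i v = kswap m p q X j v" "kswap m p q X i v \<noteq> v" for i j v
  proof (cases "v \<in> X")
    case True
    then have "r i = r j" using that mcol_inj[OF m rK rK, of i j v] by (auto simp: k)
    then show ?thesis using rr by metis
  next
    case False then show ?thesis using that mcol_inj[OF m] by (auto simp: k)
  qed
  show ?thesis unfolding mcol_def using i1 i2 i3 i4 by blast
qed

section \<open>Uncolouring, colouring and moving a single edge\<close>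

definition uncolour :: "(nat \<Rightarrow> 'v \<Rightarrow> 'v) \<Rightarrow> nat \<Rightarrow> 'v \<Rightarrow> 'v \<Rightarrow> nat \<Rightarrow> 'v \<Rightarrow> 'v" where
  "uncolour m i v w = m(i := (m i)(v := v, w := w))"

definition colour_edge :: "(nat \<Rightarrow> 'v \<Rightarrow> 'v) \<Rightarrow> nat \<Rightarrow> 'v \<Rightarrow> 'v \<Rightarrow> nat \<Rightarrow> 'v \<Rightarrow> 'v" where
  "colour_edge m i v w = m(i := (m i)(v := w, w := v))"

lemma mcol_uncolour:
  assumes m: "mcol K F m" and i: "i \<in> K" "m i v = w" "v \<noteq> w"
  shows "mcol K (F - {{v, w}}) (uncolour m i v w)"
proof -
  have s: "m i w = v" using mcol_sym[OF m i(1,2)] .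
  have val: "uncolour m i v w j x = (if j = i \<and> (x = v \<or> x = w) then x else m j x)" for j x
    by (auto simp: uncolour_def)
  have inv: "m i x = v \<Longrightarrow> x = w" "m i x = w \<Longrightarrow> x = v" for x
    using mcol_invol[OF m i(1)] i s by metis+
  have 1: "uncolour m i v w j (uncolour m i v w j x) = x" if "j \<in> K" for j x
  proof (cases "j = i \<and> (x = v \<or> x = w)")
    case False
    then have "uncolour m i v w j x = m j x" by (auto simp: val)
    moreover have "uncolour m i v w j (m j x) = m j (m j x)"
      using False inv[of x] by (simp only: val) (metis)
    ultimately show ?thesis using mcol_invol[OF m that, of x] by simp
  qed (auto simp: val)
  have 2: "{x, uncolour m i v w j x} \<in> F - {{v, w}}" if "j \<in> K" "uncolour m i v w j x \<noteq> x" for j x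
  proof -
    have x: "m j x \<noteq> x" "\<not> (j = i \<and> (x = v \<or> x = w))" using that by (auto simp: val split: if_splits)
    have "{x, m j x} \<noteq> {v, w}"
    proof
      assume "{x, m j x} = {v, w}"
      then have "x = v \<and> m j x = w \<or> x = w \<and> m j x = v" by (auto simp: doubleton_eq_iff)
      then have "j = i" using mcol_inj[OF m that(1) i(1), of x] i s x by auto
      then show False using x \<open>{x, m j x} = {v, w}\<close> by auto
    qed
    then show ?thesis using mcol_edge[OF m that(1) x(1)] x(2) by (auto simp: val)
  qed
  have 3: "\<exists>j\<in>K. uncolour m i v w j x = y" if xy: "x \<noteq> y" "{x, y} \<in> F - {{v, w}}" for x y
  proof -
    obtain j where j: "j \<in> K" "m j x = y" using mcol_ex[OF m, of x y] xy by auto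
    have "\<not> (j = i \<and> (x = v \<or> x = w))" using j i s that by auto
    then show ?thesis using j by (auto simp: val intro!: bexI[of _ j])
  qed
  have 4: "j = k" if "j \<in> K" "k \<in> K" "uncolour m i v w j x = uncolour m i v w k x" "uncolour m i v w j x \<noteq> x" for j k x
    using that mcol_inj[OF m that(1,2), of x] by (auto simp: val split: if_splits)
  show ?thesis unfolding mcol_def using 1 2 3 4 by blast
qed

lemma mcol_colour_edge:
  assumes m: "mcol K F m" and i: "i \<in> K" "m i v = v" "m i w = w" "v \<noteq> w" "{v, w} \<notin> F"
  shows "mcol K (insert {v, w} F) (colour_edge m i v w)"
proof -
  have val: "colour_edge m i v w j x = (if j = i \<and> x = v then w else if j = i \<and> x = w then v else m j x)" for j x
    using i by (auto simp: colour_edge_def)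
  have inv: "m i x = v \<Longrightarrow> x = v" "m i x = w \<Longrightarrow> x = w" for x
    using mcol_invol[OF m i(1)] i by metis+
  have no: "m j v \<noteq> w" "m j w \<noteq> v" if "j \<in> K" for j
    using mcol_edge[OF m that, of v] mcol_edge[OF m that, of w] i by (auto simp: insert_commute)
  have 1: "colour_edge m i v w j (colour_edge m i v w j x) = x" if "j \<in> K" for j x
  proof (cases "j = i \<and> (x = v \<or> x = w)")
    case False
    then have "colour_edge m i v w j x = m j x" by (auto simp: val)
    moreover have "colour_edge m i v w j (m j x) = m j (m j x)"
      using False inv[of x] by (simp only: val) (metis)
    ultimately show ?thesis using mcol_invol[OF m that, of x] by simp
  qed (use i in \<open>auto simp: val\<close>)
  have 2: "{x, colour_edge m i v w j x} \<in> insert {v, w} F" if "j \<in> K" "colour_edge m i v w j x \<noteq> x" for j x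
    using that mcol_edge[OF m that(1), of x] by (auto simp: val split: if_splits)
  have 3: "\<exists>j\<in>K. colour_edge m i v w j x = y" if xy: "x \<noteq> y" "{x, y} \<in> insert {v, w} F" for x y
  proof (cases "{x, y} = {v, w}")
    case True
    then have "x = v \<and> y = w \<or> x = w \<and> y = v" by (auto simp: doubleton_eq_iff)
    then show ?thesis using i by (auto simp: val intro!: bexI[of _ i])
  next
    case False
    then obtain j where j: "j \<in> K" "m j x = y" using mcol_ex[OF m, of x y] xy by auto
    have "\<not> (j = i \<and> (x = v \<or> x = w))" using j i that by auto
    then show ?thesis using j by (auto simp: val intro!: bexI[of _ j])
  qed
  have 4: "j = k" if "j \<in> K" "k \<in> K" "colour_edge m i v w j x = colour_edge m i v w k x" "colour_edge m i v w j x \<noteq> x" for j k x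
    using that mcol_inj[OF m that(1,2), of x] no by (auto simp: val split: if_splits)
  show ?thesis unfolding mcol_def using 1 2 3 4 by blast
qed

lemma mcol_colour_edge':
  assumes "mcol K (F - {{v, w}}) m" "{v, w} \<in> F" "i \<in> K" "m i v = v" "m i w = w" "v \<noteq> w"
  shows "mcol K F (colour_edge m i v w)"
  using mcol_colour_edge[of K "F - {{v, w}}" m i v w] assms by (auto simp: insert_absorb)

definition recolour :: "(nat \<Rightarrow> 'v \<Rightarrow> 'v) \<Rightarrow> nat \<Rightarrow> nat \<Rightarrow> 'v \<Rightarrow> 'v \<Rightarrow> nat \<Rightarrow> 'v \<Rightarrow> 'v" where
  "recolour m i j v w = colour_edge (uncolour m i v w) j v w"

lemma mcol_recolour:
  assumes m: "mcol K F m" and "i \<in> K" "j \<in> K" "m i v = w" "v \<noteq> w" "m j v = v" "m j w = w"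
  shows "mcol K F (recolour m i j v w)"
proof -
  have "{v, w} \<in> F" using mcol_edge[OF m \<open>i \<in> K\<close>, of v] assms by auto
  then show ?thesis unfolding recolour_def
    using mcol_uncolour[OF m assms(2,4,5)] assms by (intro mcol_colour_edge') (auto simp: uncolour_def)
qed

lemma recolour_simps:
  assumes "i \<noteq> j" "v \<noteq> w"
  shows "recolour m i j v w k x = (if k = j \<and> x = v then w else if k = j \<and> x = w then v
     else if k = i \<and> (x = v \<or> x = w) then x else m k x)"
  using assms by (auto simp: recolour_def colour_edge_def uncolour_def)

lemma uncolour_simps: "uncolour m i v w j x = (if j = i \<and> (x = v \<or> x = w) then x else m j x)"
  by (auto simp: uncolour_def)

lemma colour_edge_simps: "v \<noteq> w \<Longrightarrow> colour_edge m i v w j x =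
   (if j = i \<and> x = v then w else if j = i \<and> x = w then v else m j x)"
  by (auto simp: colour_edge_def)

section \<open>Ends of Kempe chains\<close>

definition kend :: "(nat \<Rightarrow> 'v \<Rightarrow> 'v) \<Rightarrow> nat \<Rightarrow> nat \<Rightarrow> 'v \<Rightarrow> bool" where
  "kend m p q x \<longleftrightarrow> m p x = x \<or> m q x = x"

lemma finite_kempe:
  assumes m: "mcol K F m" and pq: "p \<in> K" "q \<in> K" and F: "finite F" "\<And>e. e \<in> F \<Longrightarrow> finite e"
  shows "finite (kempe m p q x)"
proof -
  have "kclosed m p q (insert x (\<Union>F))"
    unfolding kclosed_def using mcol_edge[OF m pq(1)] mcol_edge[OF m pq(2)]
    by (metis UnionI insertCI insertE insert_iff)
  then have "kempe m p q x \<subseteq> insert x (\<Union>F)" by (intro kempe_minimal) auto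
  then show ?thesis using F by (meson finite_Union finite_insert finite_subset)
qed

text \<open>On the orbit of \<open>x\<close> the composition of \<open>P\<close> and \<open>Q\<close> acts as a rotation and \<open>P\<close>, \<open>Q\<close> act as reflections
  of a polygon, which together have two fixed points; this is why a Kempe chain has at most two ends.\<close>

lemma dihedral_fixpoints:
  fixes P Q :: "'v \<Rightarrow> 'v"
  assumes P: "\<And>v. P (P v) = v" and Q: "\<And>v. Q (Q v) = v"
    and x: "P x = x" and O: "finite O'" "x \<in> O'" "\<And>v. v \<in> O' \<Longrightarrow> P v \<in> O' \<and> Q v \<in> O'"
    and min: "\<And>X. x \<in> X \<Longrightarrow> (\<And>v. v \<in> X \<Longrightarrow> P v \<in> X \<and> Q v \<in> X) \<Longrightarrow> O' \<subseteq> X"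
    and y: "y \<in> O'" "y \<noteq> x" "P y = y \<or> Q y = y" and z: "z \<in> O'" "z \<noteq> x" "P z = z \<or> Q z = z"
  shows "y = z"
proof -
  define T where "T = (\<lambda>v. Q (P v))"
  have injT: "inj T" unfolding T_def by (rule injI) (metis P Q)
  have injTk: "inj (T ^^ k)" for k using injT by (rule inj_fn)
  have TO: "(T ^^ k) x \<in> O'" for k by (induction k) (use O in \<open>auto simp: T_def\<close>)
  have "\<exists>N>0. (T ^^ N) x = x"
  proof -
    have "finite (range (\<lambda>k. (T ^^ k) x))" using TO O(1) by (meson finite_subset image_subsetI)
    then have "\<not> inj (\<lambda>k. (T ^^ k) x)" using finite_imageD infinite_UNIV_nat by blast
    then obtain i j where ij: "i < j" "(T ^^ i) x = (T ^^ j) x"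
      unfolding inj_on_def by (metis linorder_neqE_nat)
    have "(T ^^ j) x = (T ^^ i) ((T ^^ (j - i)) x)" using ij(1) by (metis funpow_add le_add_diff_inverse less_imp_le o_apply)
    then have "(T ^^ (j - i)) x = x" using ij injTk[of i] by (metis injD)
    then show ?thesis using ij(1) by (intro exI[of _ "j - i"]) auto
  qed
  \<comment> \<open>\<open>N\<close> is the length of the orbit of \<open>x\<close> under the
    rotation \<open>T\<close>.\<close>
  then obtain N where N: "N > 0" "(T ^^ N) x = x" and Nmin: "\<And>k. k > 0 \<Longrightarrow> k < N \<Longrightarrow> (T ^^ k) x \<noteq> x"
    using exists_least_iff[of "\<lambda>N. N > 0 \<and> (T ^^ N) x = x"] by blast
  have modN: "N dvd e" if "(T ^^ e) x = x" for e
  proof -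
    have "(T ^^ (e mod N)) x = x" using funpow_mod_eq[OF N(2), of e] that by simp
    moreover have "e mod N < N" using N(1) by simp
    ultimately have "e mod N = 0" using Nmin[of "e mod N"] by auto
    then show ?thesis by auto
  qed
  \<comment> \<open>The dihedral relation \<open>T^k P T^k = P\<close>.\<close>
  have refl: "(T ^^ k) (P ((T ^^ k) v)) = P v" for k v
  proof (induction k arbitrary: v)
    case (Suc k)
    have "(T ^^ Suc k) (P ((T ^^ Suc k) v)) = T ((T ^^ k) (P ((T ^^ k) (T v))))"
      by (simp add: funpow_swap1)
    also have "\<dots> = T (P (T v))" using Suc[of "T v"] by simp
    also have "\<dots> = P v" by (simp add: T_def P Q)
    finally show ?case .
  qed simp
  have TkN: "(T ^^ (k * N)) x = x" for k by (induction k) (auto simp: funpow_add N(2))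
  \<comment> \<open>\<open>P\<close> fixes \<open>x\<close>, so it maps \<open>T^k x\<close> to
    \<open>T^(-k) x\<close>; the exponent \<open>k * N - k\<close> is \<open>-k\<close> modulo
    \<open>N\<close>, written as a natural number.\<close>
  have PT: "P ((T ^^ k) x) = (T ^^ (k * N - k)) x" for k
  proof -
    have "(T ^^ k) ((T ^^ (k * N - k)) x) = x"
      using TkN[of k] N(1) by (metis funpow_add le_add_diff_inverse mult.right_neutral mult_le_mono2 o_apply Suc_leI One_nat_def)
    then show ?thesis using refl[of k x] x injTk[of k] by (metis injD)
  qed
  have QT: "Q v = T (P v)" for v by (simp add: T_def P)
  have "O' \<subseteq> range (\<lambda>k. (T ^^ k) x)"
  proof (rule min)
    show "x \<in> range (\<lambda>k. (T ^^ k) x)" by (rule range_eqI[of _ _ 0]) simp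
    fix v assume "v \<in> range (\<lambda>k. (T ^^ k) x)"
    then obtain k where v: "v = (T ^^ k) x" by blast
    show "P v \<in> range (\<lambda>k. (T ^^ k) x) \<and> Q v \<in> range (\<lambda>k. (T ^^ k) x)"
      unfolding QT v PT by (metis comp_apply funpow.simps(2) rangeI)
  qed
  \<comment> \<open>For \<open>0 < j < N\<close>, a fixed point of \<open>P\<close> gives
    \<open>T^(2j) x = x\<close> and a fixed point of \<open>Q\<close> gives
    \<open>T^(2j-1) x = x\<close>. So \<open>2j\<close> is \<open>N\<close> or \<open>N + 1\<close>,
    and the parity of \<open>N\<close> decides which.\<close>
  then have main: "\<exists>j. w = (T ^^ j) x \<and> (2 * j = N \<or> 2 * j = Suc N)"
    if w: "w \<in> O'" "w \<noteq> x" "P w = w \<or> Q w = w" for w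
  proof -
    obtain k where k: "w = (T ^^ k) x" using w \<open>O' \<subseteq> _\<close> by blast
    define j where "j = k mod N"
    have j: "w = (T ^^ j) x" "j < N" using k funpow_mod_eq[OF N(2), of k] N(1) by (auto simp: j_def)
    then have j0: "j > 0" using w(2) by (cases j) auto
    show ?thesis
    proof (cases "P w = w")
      case True
      then have "(T ^^ j) ((T ^^ j) x) = x" using refl[of j x] x j by simp
      then have "N dvd 2 * j" using modN[of "2 * j"] by (simp add: mult_2 funpow_add)
      then obtain e where e: "2 * j = N * e" by (rule dvdE)
      have "2 * j < N * 2" "2 * j > 0" using j0 j(2) by auto
      then have "e < 2" "e > 0" unfolding e using N(1) by auto
      then have "e = 1" by simp
      then show ?thesis using j e by auto
    next
      case False
      then have "T (P w) = w" using w(3) QT by metis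
      then have "(T ^^ j) w = T ((T ^^ j) (P w))" by (metis funpow_swap1)
      then have "(T ^^ j) w = T x" using refl[of j x] x j by simp
      then have "(T ^^ (2 * j)) x = T x" using j by (simp add: mult_2 funpow_add)
      then have "T ((T ^^ (2 * j - 1)) x) = T x"
        using j0 by (metis Suc_diff_1 comp_apply funpow.simps(2) nat_0_less_mult_iff zero_less_numeral)
      then have "(T ^^ (2 * j - 1)) x = x" using injT by (metis injD)
      then have "N dvd 2 * j - 1" by (rule modN)
      then obtain e where e: "2 * j - 1 = N * e" by (rule dvdE)
      have "2 * j - 1 < N * 2" "2 * j - 1 > 0" using j0 j(2) by auto
      then have "e < 2" "e > 0" unfolding e using N(1) by auto
      then have "e = 1" by simp
      then show ?thesis using j e j0 by auto
    qed
  qed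
  obtain j k where jk: "y = (T ^^ j) x" "2 * j = N \<or> 2 * j = Suc N" "z = (T ^^ k) x" "2 * k = N \<or> 2 * k = Suc N"
    using main[OF y] main[OF z] by blast
  have "j = k" using jk(2,4) by presburger
  then show ?thesis using jk by simp
qed

lemma kempe_two_ends:
  assumes m: "mcol K F m" and pq: "p \<in> K" "q \<in> K" and F: "finite F" "\<And>e. e \<in> F \<Longrightarrow> finite e"
    and x: "kend m p q x" and y: "y \<in> kempe m p q x" "y \<noteq> x" "kend m p q y"
    and z: "z \<in> kempe m p q x" "z \<noteq> x" "kend m p q z"
  shows "y = z"
proof -
  have *: "y = z" if pq: "p \<in> K" "q \<in> K" and x: "m p x = x" and y: "y \<in> kempe m p q x" "y \<noteq> x" "kend m p q y"
    and z: "z \<in> kempe m p q x" "z \<noteq> x" "kend m p q z" for p q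
  proof (rule dihedral_fixpoints[of "m p" "m q" x "kempe m p q x" y z])
    show "kempe m p q x \<subseteq> X" if "x \<in> X" "\<And>v. v \<in> X \<Longrightarrow> m p v \<in> X \<and> m q v \<in> X" for X
      using that by (intro kempe_minimal) (auto simp: kclosed_def)
  qed (use mcol_invol[OF m] that finite_kempe[OF m pq F] kempe_step in \<open>auto simp: kend_def\<close>)
  show ?thesis
  proof (cases "m p x = x")
    case True then show ?thesis using *[OF pq] y z by blast
  next
    case False
    then have "m q x = x" using x by (simp add: kend_def)
    then show ?thesis using *[OF pq(2,1)] y z kempe_commute[of m p q x] by (auto simp: kend_def)
  qed
qed

subsection \<open>Twin vertices\<close>

definition fin_graph :: "'v set set \<Rightarrow> bool" where
  "fin_graph F \<longleftrightarrow> finite F \<and> (\<forall>e\<in>F. finite e)"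

lemma fin_graph_Diff: "fin_graph F \<Longrightarrow> fin_graph (F - D)"
  by (auto simp: fin_graph_def)

lemma three_ends:
  assumes "mcol K F m" "fin_graph F" "p \<in> K" "q \<in> K"
    and "x \<in> kempe m p q w" "y \<in> kempe m p q w" "z \<in> kempe m p q w" "x \<noteq> y" "x \<noteq> z" "y \<noteq> z"
    and "kend m p q x" "kend m p q y" "kend m p q z"
  shows False
proof -
  have "kempe m p q x = kempe m p q w" using kempe_sym[OF assms(1,3,4,5)] .
  then show False
    using kempe_two_ends[OF assms(1,3,4), of x y z] assms by (auto simp: fin_graph_def)
qed

definition misses1 :: "nat set \<Rightarrow> (nat \<Rightarrow> 'v \<Rightarrow> 'v) \<Rightarrow> 'v \<Rightarrow> nat \<Rightarrow> bool" where
  "misses1 K m v i \<longleftrightarrow> i \<in> K \<and> (\<forall>j\<in>K. m j v = v \<longleftrightarrow> j = i)"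

text \<open>This holds for the neighbours of a vertex \<open>a\<close> of degree 2 once
  \<open>a\<close> is deleted (\<open>twin_Ea\<close>). The notion does not mention
  \<open>a\<close>, so it also applies to fewer edges and fewer colours, as in
  \<open>leaf_cfg_contradiction\<close>.\<close>

definition twin :: "nat set \<Rightarrow> 'v set set \<Rightarrow> 'v \<Rightarrow> 'v \<Rightarrow> bool" where
  "twin K F b c \<longleftrightarrow> fin_graph F \<and> b \<noteq> c \<and>
     (\<forall>m. mcol K F m \<longrightarrow> (\<exists>i. misses1 K m b i \<and> misses1 K m c i))"

lemma twin_sym: "twin K F b c \<Longrightarrow> twin K F c b"
  unfolding twin_def by metis

lemma twin_fin_graph: "twin K F b c \<Longrightarrow> fin_graph F"
  by (simp add: twin_def)

text \<open>Putting \<open>p\<close> on \<open>bu\<close> leaves \<open>q\<close> missing at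
  \<open>b\<close>, hence also at \<open>c\<close>. In the applications \<open>q\<close> is present
  at \<open>c\<close>: once \<open>bu\<close> is uncoloured, no colouring may let \<open>b\<close>
  and \<open>u\<close> miss a common colour.\<close>

lemma twin_ext:
  assumes T: "twin K F b c" and m: "mcol K (F - {{b, u}}) m"
    and bu: "{b, u} \<in> F" "u \<noteq> b" "u \<noteq> c"
    and p: "p \<in> K" "m p u = u" "m p b = b" and q: "q \<in> K" "q \<noteq> p" "m q b = b"
  shows "m q c = c"
proof -
  have "mcol K F (colour_edge m p b u)" using m bu p by (intro mcol_colour_edge') auto
  then obtain i where i: "misses1 K (colour_edge m p b u) b i" "misses1 K (colour_edge m p b u) c i"
    using T unfolding twin_def by blast
  have "colour_edge m p b u q b = b" using q bu by (simp add: colour_edge_simps)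
  then have "q = i" using i(1) q(1) by (simp add: misses1_def)
  then have "colour_edge m p b u q c = c" using i(2) q(1) by (simp add: misses1_def)
  then show ?thesis using bu q by (simp add: colour_edge_simps)
qed

text \<open>The vertices \<open>b\<close> and \<open>c\<close> already use up the two ends of their
  common chain.\<close>

lemma kempe_avoid_linked:
  assumes m: "mcol K F m" "fin_graph F" and ij: "i \<in> K" "j \<in> K" "m i b = b" "m i c = c"
    and l: "c \<in> kempe m i j b" "b \<noteq> c" and x: "x \<noteq> b" "x \<noteq> c" "kend m i j x"
  shows "b \<notin> kempe m i j x" "c \<notin> kempe m i j x"
proof -
  have *: False if "b \<in> kempe m i j x"
  proof -
    have eq: "kempe m i j b = kempe m i j x" using kempe_sym[OF m(1) ij(1,2) that] .
    show False
      by (rule three_ends[OF m ij(1,2), of x b b c])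
        (use eq l x ij in \<open>auto simp: kend_def\<close>)
  qed
  then show "b \<notin> kempe m i j x" by blast
  show "c \<notin> kempe m i j x"
  proof
    assume "c \<in> kempe m i j x"
    then have "kempe m i j c = kempe m i j x" using kempe_sym[OF m(1) ij(1,2)] by blast
    moreover have "kempe m i j c = kempe m i j b" using kempe_sym[OF m(1) ij(1,2) l(1)] .
    ultimately have "b \<in> kempe m i j x" by (metis kempe_self)
    then show False using * by blast
  qed
qed

lemma twin_link:
  assumes T: "twin K F b c" and m: "mcol K F m" and mb: "misses1 K m b i" and mc: "misses1 K m c i"
    and j: "j \<in> K" "j \<noteq> i"
  shows "c \<in> kempe m i j b"
proof (rule ccontr)
  assume n: "c \<notin> kempe m i j b"
  let ?m = "kswap m i j (kempe m i j b)"
  have iK: "i \<in> K" "m i b = b" "m i c = c" using mb mc by (auto simp: misses1_def)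
  have "mcol K F ?m" using mcol_kswap[OF m iK(1) j(1)] by simp
  then obtain k where k: "misses1 K ?m b k" "misses1 K ?m c k" using T unfolding twin_def by blast
  have "?m j b = b" using iK j by (auto simp: kswap_def)
  moreover have "?m i c = c" using n iK by (simp add: kswap_def)
  ultimately show False using k j iK(1) by (auto simp: misses1_def)
qed

text \<open>By \<open>twin_link\<close> the twins are joined by an \<open>i\<close>/\<open>j\<close>
  chain: a change on the chain of \<open>b\<close> alone would leave them with different missing
  colours.\<close>

lemma twin_avoid:
  assumes T: "twin K F b c" and m: "mcol K F m" and mb: "misses1 K m b i" and mc: "misses1 K m c i"
    and j: "j \<in> K" "j \<noteq> i" and x: "x \<noteq> b" "x \<noteq> c" "kend m i j x"
  shows "b \<notin> kempe m i j x" "c \<notin> kempe m i j x"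
proof -
  have iK: "i \<in> K" "m i b = b" "m i c = c" using mb mc by (auto simp: misses1_def)
  have bc: "b \<noteq> c" "fin_graph F" using T by (auto simp: twin_def)
  show "b \<notin> kempe m i j x" "c \<notin> kempe m i j x"
    using kempe_avoid_linked[OF m bc(2) iK(1) j(1) iK(2,3) twin_link[OF assms(1-6)] bc(1) x] by auto
qed

section \<open>Kites: a common neighbour of the twins and two deficient vertices\<close>

text \<open>Uncolour \<open>bu\<close>; then \<open>u\<close> and \<open>b\<close> must never come
  to miss a common colour. If the \<alpha>/\<tau> chain of \<open>u\<close> avoided
  \<open>s1\<close>, then \<open>u s1\<close> could move to \<tau> and free \<beta> at
  \<open>u\<close>. So that chain ends at \<open>s1\<close> and avoids \<open>s2\<close>; after a
  change at \<open>s2\<close> the edge \<open>u s2\<close> moves to \<alpha>, and the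
  \<sigma>/\<beta> chain of \<open>u\<close> has to reach \<open>b\<close>.\<close>

lemma twin_kite_step:
  assumes T: "twin K F b c" and m: "mcol K F m" and mb: "misses1 K m b \<beta>" and mc: "misses1 K m c \<beta>"
    and K: "\<alpha> \<in> K" "\<sigma> \<in> K" "\<tau> \<in> K"
    and e: "m \<alpha> b = u" "m \<beta> u = s1" "m \<sigma> u = s2" "m \<tau> s1 = s1" "m \<tau> s2 = s2"
    and d: "distinct [b, c, u, s1, s2]"
  shows "b \<in> kempe (uncolour m \<sigma> u s2) \<sigma> \<beta> u"
proof (rule ccontr)
  assume nbrs: "b \<notin> kempe (uncolour m \<sigma> u s2) \<sigma> \<beta> u"
  have bK: "\<beta> \<in> K" "m \<beta> b = b" "m \<beta> c = c" using mb mc by (auto simp: misses1_def)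
  have e': "m \<alpha> u = b" "m \<beta> s1 = u" "m \<sigma> s2 = u"
    using mcol_sym[OF m] K bK e by blast+
  have fg: "fin_graph (F - {{b, u}})" using T fin_graph_Diff by (auto simp: twin_def)
  have bu: "{b, u} \<in> F" using mcol_edge[OF m K(1), of b] e d by auto
  have col: "\<alpha> \<noteq> \<beta>" "\<alpha> \<noteq> \<sigma>" "\<beta> \<noteq> \<sigma>" "\<tau> \<noteq> \<beta>" "\<tau> \<noteq> \<sigma>" using e e' d bK by auto
  have cc: "m \<alpha> c \<noteq> c" "m \<tau> c \<noteq> c" using mc K col by (auto simp: misses1_def)
  define m0 where "m0 = uncolour m \<alpha> b u"
  have m0: "mcol K (F - {{b, u}}) m0" unfolding m0_def using mcol_uncolour[OF m K(1) e(1)] d by auto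
  have v0: "m0 i v = (if i = \<alpha> \<and> (v = b \<or> v = u) then v else m i v)" for i v
    by (simp add: m0_def uncolour_simps)
  define X where "X = kempe m0 \<alpha> \<tau> u"
  have uX: "u \<in> X" by (simp add: X_def)
  have s1X: "s1 \<in> X"
  proof (rule ccontr)
    assume n: "s1 \<notin> X"
    define m1 where "m1 = kswap m0 \<alpha> \<tau> X"
    have m1: "mcol K (F - {{b, u}}) m1" unfolding m1_def X_def using m0 K by (intro mcol_kswap) auto
    \<comment> \<open>The change may pass through \<open>b\<close>, so the second colour missing at
      \<open>b\<close> is \<tau> or \<alpha>. Both are present at \<open>c\<close>, which suffices
      for a contradiction with \<open>twin_ext\<close>.\<close>
    have v1: "m1 \<tau> u = u" "m1 \<tau> s1 = s1" "m1 \<beta> v = m \<beta> v"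
        "m1 (if b \<in> X then \<tau> else \<alpha>) b = b" "m1 \<alpha> c \<noteq> c" "m1 \<tau> c \<noteq> c" for v
      unfolding m1_def using n uX d e e' col cc by (auto simp: kswap_def v0)
    define m2 where "m2 = recolour m1 \<beta> \<tau> u s1"
    have m2: "mcol K (F - {{b, u}}) m2" unfolding m2_def
      using m1 bK K v1 e d by (intro mcol_recolour) auto
    have v2: "m2 \<beta> u = u" "m2 \<beta> b = b" "m2 (if b \<in> X then \<tau> else \<alpha>) b = b" "m2 \<alpha> c \<noteq> c" "m2 \<tau> c \<noteq> c"
      unfolding m2_def using v1 d col bK by (auto simp: recolour_simps)
    have "m2 (if b \<in> X then \<tau> else \<alpha>) c = c"
      using twin_ext[OF T m2 bu _ _ bK(1) v2(1,2) _ _ v2(3)] K col d by auto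
    then show False using v2 by (auto split: if_splits)
  qed
  have \<alpha>\<tau>: "\<alpha> \<noteq> \<tau>"
  proof
    assume "\<alpha> = \<tau>"
    then have "kclosed m0 \<alpha> \<tau> {u}" by (auto simp: kclosed_def v0)
    then have "X \<subseteq> {u}" unfolding X_def by (rule kempe_minimal) simp
    then show False using s1X d by auto
  qed
  define Y where "Y = kempe m0 \<alpha> \<tau> s2"
  have s2Y: "s2 \<in> Y" by (simp add: Y_def)
  have uY: "u \<notin> Y"
  proof
    assume "u \<in> Y"
    then have "X = Y" unfolding X_def Y_def using kempe_sym[OF m0 K(1,3)] by blast
    then show False
      using three_ends[OF m0 fg K(1,3), of u u s1 s2] uX s1X s2Y d e \<alpha>\<tau>
      by (auto simp: X_def[symmetric] kend_def v0)
  qed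
  define m1 where "m1 = kswap m0 \<alpha> \<tau> Y"
  have m1: "mcol K (F - {{b, u}}) m1" unfolding m1_def Y_def using m0 K by (intro mcol_kswap) auto
  have v1: "m1 \<alpha> s2 = s2" "m1 \<alpha> u = u" "m1 \<beta> v = m \<beta> v" "m1 \<sigma> v = m \<sigma> v"
        "m1 (if b \<in> Y then \<tau> else \<alpha>) b = b" "m1 \<alpha> c \<noteq> c" "m1 \<tau> c \<noteq> c" for v
    unfolding m1_def using s2Y uY d e e' col cc \<alpha>\<tau> by (auto simp: kswap_def v0)
  define m2 where "m2 = recolour m1 \<sigma> \<alpha> u s2"
  have m2: "mcol K (F - {{b, u}}) m2" unfolding m2_def
    using m1 K v1 e d by (intro mcol_recolour) auto
  have v2: "m2 \<sigma> = uncolour m \<sigma> u s2 \<sigma>" "m2 \<beta> = uncolour m \<sigma> u s2 \<beta>" "m2 \<sigma> u = u" "m2 \<beta> b = b"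
      "m2 (if b \<in> Y then \<tau> else \<alpha>) b = b" "m2 \<alpha> c \<noteq> c" "m2 \<tau> c \<noteq> c"
    unfolding m2_def using v1 d col bK by (auto simp: recolour_simps uncolour_simps)
  define Z where "Z = kempe m2 \<sigma> \<beta> u"
  \<comment> \<open>So far the class of \<beta> is unchanged and the class of \<sigma> has lost only
    \<open>u s2\<close>.\<close>
  have "Z = kempe (uncolour m \<sigma> u s2) \<sigma> \<beta> u" unfolding Z_def kempe_def v2(1,2) ..
  then have bZ: "b \<notin> Z" "u \<in> Z" using nbrs by (auto simp: Z_def)
  define m3 where "m3 = kswap m2 \<sigma> \<beta> Z"
  have m3: "mcol K (F - {{b, u}}) m3" unfolding m3_def Z_def using m2 K bK by (intro mcol_kswap) auto
  have v3: "m3 \<beta> u = u" "m3 \<beta> b = b" "m3 (if b \<in> Y then \<tau> else \<alpha>) b = b" "m3 \<alpha> c \<noteq> c" "m3 \<tau> c \<noteq> c"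
    unfolding m3_def using bZ v2(3-) col by (auto simp: kswap_def)
  have "m3 (if b \<in> Y then \<tau> else \<alpha>) c = c"
    using twin_ext[OF T m3 bu _ _ bK(1) v3(1,2) _ _ v3(3)] K col d by auto
  then show False using v3 by (auto split: if_splits)
qed

text \<open>The chain in \<open>twin_kite_step\<close> is the same when \<open>b\<close> and
  \<open>c\<close> change roles. After uncolouring \<open>u s2\<close> it would have the three ends
  \<open>u\<close>, \<open>b\<close> and \<open>c\<close>.\<close>

lemma twin_kite_same:
  assumes T: "twin K F b c" and m: "mcol K F m" and mb: "misses1 K m b \<beta>" and mc: "misses1 K m c \<beta>"
    and \<tau>: "\<tau> \<in> K" "m \<tau> s1 = s1" "m \<tau> s2 = s2" and e: "m \<beta> u = s1"
    and F: "{b, u} \<in> F" "{c, u} \<in> F" "{u, s2} \<in> F" and d: "distinct [b, c, u, s1, s2]"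
  shows False
proof -
  obtain \<alpha> where \<alpha>: "\<alpha> \<in> K" "m \<alpha> b = u" using mcol_ex[OF m F(1)] d by auto
  obtain \<gamma> where \<gamma>: "\<gamma> \<in> K" "m \<gamma> c = u" using mcol_ex[OF m F(2)] d by auto
  obtain \<sigma> where \<sigma>: "\<sigma> \<in> K" "m \<sigma> u = s2" using mcol_ex[OF m F(3)] d by auto
  have bK: "\<beta> \<in> K" "m \<beta> b = b" "m \<beta> c = c" using mb mc by (auto simp: misses1_def)
  let ?m = "uncolour m \<sigma> u s2"
  have b: "b \<in> kempe ?m \<sigma> \<beta> u"
    using twin_kite_step[OF T m mb mc \<alpha>(1) \<sigma>(1) \<tau>(1) \<alpha>(2) e \<sigma>(2) \<tau>(2,3) d] .
  have c: "c \<in> kempe ?m \<sigma> \<beta> u"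
    using twin_kite_step[OF twin_sym[OF T] m mc mb \<gamma>(1) \<sigma>(1) \<tau>(1) \<gamma>(2) e \<sigma>(2) \<tau>(2,3)] d by auto
  have "mcol K (F - {{u, s2}}) ?m" using mcol_uncolour[OF m \<sigma>] d by auto
  then show False
    by (rule three_ends[of K _ ?m \<sigma> \<beta> u u b c])
      (use T fin_graph_Diff b c d \<sigma> bK e in \<open>auto simp: kend_def uncolour_simps twin_def\<close>)
qed

text \<open>As \<alpha> is missing at \<open>s2\<close>, the edge \<open>u s2\<close> can take it
  over from \<open>bu\<close>. Three chains of \<open>u\<close> are considered in succession. Each
  must meet certain vertices, as otherwise \<open>u\<close> and \<open>b\<close> could be made to
  miss a common colour, and the last one gets the three ends \<open>u\<close>, \<open>b\<close> and
  \<open>s2\<close>.\<close>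

lemma twin_kite_distinct:
  assumes T: "twin K F b c" and m: "mcol K F m" and mb: "misses1 K m b \<beta>" and mc: "misses1 K m c \<beta>"
    and K: "\<alpha> \<in> K" "\<tau> \<in> K" and e: "m \<alpha> b = u" "m \<beta> u = s1" "m \<tau> s1 = s1" "m \<alpha> s2 = s2" "\<tau> \<noteq> \<alpha>"
    and F: "{u, s2} \<in> F" and d: "distinct [b, c, u, s1, s2]"
  shows False
proof -
  obtain \<sigma> where \<sigma>: "\<sigma> \<in> K" "m \<sigma> u = s2" using mcol_ex[OF m F] d by auto
  have bK: "\<beta> \<in> K" "m \<beta> b = b" "m \<beta> c = c" using mb mc by (auto simp: misses1_def)
  have e': "m \<alpha> u = b" "m \<beta> s1 = u" "m \<sigma> s2 = u"
    using mcol_sym[OF m] K bK e \<sigma> by blast+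
  have fg: "fin_graph (F - {{b, u}})" using T fin_graph_Diff by (auto simp: twin_def)
  have bu: "{b, u} \<in> F" using mcol_edge[OF m K(1), of b] e d by auto
  have col: "\<alpha> \<noteq> \<beta>" "\<alpha> \<noteq> \<sigma>" "\<beta> \<noteq> \<sigma>" "\<tau> \<noteq> \<beta>" using e e' \<sigma> d bK by auto
  have cc: "m j c \<noteq> c" if "j \<in> K" "j \<noteq> \<beta>" for j using mc that by (auto simp: misses1_def)
  define m0 where "m0 = uncolour m \<alpha> b u"
  have m0: "mcol K (F - {{b, u}}) m0" unfolding m0_def using mcol_uncolour[OF m K(1) e(1)] d by auto
  have v0: "m0 i v = (if i = \<alpha> \<and> (v = b \<or> v = u) then v else m i v)" for i v
    by (simp add: m0_def uncolour_simps)
  define m1 where "m1 = recolour m0 \<sigma> \<alpha> u s2"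
  have m1: "mcol K (F - {{b, u}}) m1" unfolding m1_def
    using m0 K \<sigma> e d col by (intro mcol_recolour) (auto simp: v0)
  have v1: "m1 i v = (if i = \<alpha> \<and> v = u then s2 else if i = \<alpha> \<and> v = s2 then u
      else if i = \<sigma> \<and> (v = u \<or> v = s2) then v else if i = \<alpha> \<and> v = b then v else m i v)" for i v
    unfolding m1_def using col d by (auto simp: recolour_simps v0)
  define Z where "Z = kempe m1 \<sigma> \<beta> u"
  have uZ: "u \<in> Z" by (simp add: Z_def)
  have cn: "m1 \<alpha> c \<noteq> c" "m1 \<sigma> c \<noteq> c" "j \<in> K \<Longrightarrow> j \<noteq> \<beta> \<Longrightarrow> m1 j c \<noteq> c" for j
    using v1 cc K \<sigma> col d by auto
  have b1: "m1 \<alpha> b = b" "m1 \<beta> b = b" using v1 bK d col by auto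
  have bZ: "b \<in> Z"
  proof (rule ccontr)
    assume n: "b \<notin> Z"
    let ?m = "kswap m1 \<sigma> \<beta> Z"
    have p: "mcol K (F - {{b, u}}) ?m" unfolding Z_def using m1 \<sigma> bK by (intro mcol_kswap) auto
    have v: "?m \<beta> u = u" "?m \<beta> b = b" "?m \<alpha> b = b" "?m \<alpha> c \<noteq> c"
      using n uZ b1 cn col d v1 by (auto simp: kswap_def)
    show False using twin_ext[OF T p bu _ _ bK(1) v(1,2) K(1) _ v(3)] v(4) col d by auto
  qed
  have notZ: "w \<notin> Z" if "kend m1 \<sigma> \<beta> w" "w \<noteq> u" "w \<noteq> b" for w
  proof
    assume "w \<in> Z"
    moreover have "kend m1 \<sigma> \<beta> u" "kend m1 \<sigma> \<beta> b" using b1 v1[of \<sigma> u] col by (auto simp: kend_def)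
    ultimately show False
      using three_ends[OF m1 fg \<sigma>(1) bK(1), of u u b w] uZ bZ that d
      unfolding Z_def[symmetric] by auto
  qed
  have s2Z: "s2 \<notin> Z" and cZ: "c \<notin> Z" using notZ d bK v1 col by (auto simp: kend_def)
  have s1Z: "s1 \<in> Z"
    using kempe_step(2)[OF uZ[unfolded Z_def]] v1 e col by (auto simp: Z_def)
  have \<tau>\<sigma>: "\<tau> \<noteq> \<sigma>"
  proof
    assume "\<tau> = \<sigma>"
    then have "kend m1 \<sigma> \<beta> s1" using e d v1 by (auto simp: kend_def)
    then show False using notZ s1Z d by auto
  qed
  define m2 where "m2 = kswap m1 \<sigma> \<beta> Z"
  have m2: "mcol K (F - {{b, u}}) m2" unfolding m2_def Z_def using m1 \<sigma> bK by (intro mcol_kswap) auto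
  have v2: "m2 \<beta> u = u" "m2 \<sigma> b = b" "m2 \<alpha> b = b" "m2 \<sigma> u = s1" "m2 \<alpha> u = s2" "m2 \<sigma> s2 = s2"
     "m2 \<tau> s1 = s1" "m2 \<beta> c = c" "j \<in> K \<Longrightarrow> j \<noteq> \<beta> \<Longrightarrow> m2 j c \<noteq> c" for j
    unfolding m2_def using uZ bZ s2Z cZ s1Z col \<tau>\<sigma> d e bK b1 v1 cn by (auto simp: kswap_def)
  define Y where "Y = kempe m2 \<beta> \<tau> u"
  have uY: "u \<in> Y" by (simp add: Y_def)
  \<comment> \<open>Now \<open>u s1\<close> has the colour \<sigma>, which \<open>b\<close> misses.
    If the \<beta>/\<tau> chain of \<open>u\<close> avoided \<open>s1\<close>, this edge could move
    to \<tau>, and both \<open>u\<close> and \<open>b\<close> would miss \<sigma>.\<close>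
  have s1Y: "s1 \<in> Y"
  proof (rule ccontr)
    assume n: "s1 \<notin> Y"
    let ?m = "kswap m2 \<beta> \<tau> Y"
    have p: "mcol K (F - {{b, u}}) ?m" unfolding Y_def using m2 K bK by (intro mcol_kswap) auto
    have v: "?m \<tau> u = u" "?m \<tau> s1 = s1" "?m \<sigma> u = s1" "?m \<sigma> b = b" "?m \<alpha> b = b" "?m \<alpha> c \<noteq> c"
      using n uY v2 col e(5) \<tau>\<sigma> K by (auto simp: kswap_def)
    let ?n = "recolour ?m \<sigma> \<tau> u s1"
    have p': "mcol K (F - {{b, u}}) ?n" using p K \<sigma> v d by (intro mcol_recolour) auto
    have w: "?n \<sigma> u = u" "?n \<sigma> b = b" "?n \<alpha> b = b" "?n \<alpha> c \<noteq> c"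
      using v \<tau>\<sigma> d e(5) by (auto simp: recolour_simps)
    show False using twin_ext[OF T p' bu _ _ \<sigma>(1) w(1,2) K(1) _ w(3)] w(4) col d by auto
  qed
  have cY: "c \<notin> Y"
    using three_ends[OF m2 fg bK(1) K(2), of u u s1 c] uY s1Y d v2
    unfolding Y_def[symmetric] by (auto simp: kend_def)
  define m3 where "m3 = kswap m2 \<beta> \<tau> Y"
  have m3: "mcol K (F - {{b, u}}) m3" unfolding m3_def Y_def using m2 K bK by (intro mcol_kswap) auto
  have v3: "m3 \<tau> u = u" "m3 \<sigma> b = b" "m3 \<alpha> b = b" "m3 \<alpha> u = s2" "m3 \<sigma> s2 = s2"
     "j \<in> K \<Longrightarrow> j \<noteq> \<beta> \<Longrightarrow> m3 j c \<noteq> c" for j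
    unfolding m3_def using uY cY col \<tau>\<sigma> e(5) v2 by (auto simp: kswap_def)
  \<comment> \<open>At this point \<open>u\<close> misses \<tau>, both \<open>b\<close> and
    \<open>s2\<close> miss \<sigma>, and \<open>u s2\<close> has the colour \<alpha>, which
    \<open>b\<close> misses as well.\<close>
  define W where "W = kempe m3 \<tau> \<sigma> u"
  have uW: "u \<in> W" by (simp add: W_def)
  define m4 where "m4 = kswap m3 \<tau> \<sigma> W"
  have m4: "mcol K (F - {{b, u}}) m4" unfolding m4_def W_def using m3 K \<sigma> by (intro mcol_kswap) auto
  have v4: "m4 \<sigma> u = u" "m4 \<alpha> b = b" "m4 \<alpha> u = s2" "m4 (if b \<in> W then \<tau> else \<sigma>) b = b"
     "s2 \<notin> W \<Longrightarrow> m4 \<sigma> s2 = s2" "m4 \<alpha> c \<noteq> c" "m4 \<tau> c \<noteq> c" "m4 \<sigma> c \<noteq> c"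
    unfolding m4_def using uW col \<tau>\<sigma> e(5) v3 K \<sigma> by (auto simp: kswap_def)
  have bW: "b \<in> W"
  proof (rule ccontr)
    assume "b \<notin> W"
    then have "m4 \<sigma> b = b" using v4 by simp
    then show False using twin_ext[OF T m4 bu _ _ \<sigma>(1) v4(1) _ K(1) _ v4(2)] v4 col d by auto
  qed
  have s2W: "s2 \<in> W"
  proof (rule ccontr)
    assume n: "s2 \<notin> W"
    let ?n = "recolour m4 \<alpha> \<sigma> u s2"
    have p': "mcol K (F - {{b, u}}) ?n" using m4 K \<sigma> v4 n d by (intro mcol_recolour) auto
    have w: "?n \<alpha> u = u" "?n \<alpha> b = b" "?n (if b \<in> W then \<tau> else \<sigma>) b = b"
        "?n \<tau> c \<noteq> c" "?n \<sigma> c \<noteq> c"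
      using v4 col e(5) \<tau>\<sigma> d by (auto simp: recolour_simps)
    have "?n (if b \<in> W then \<tau> else \<sigma>) c = c"
      using twin_ext[OF T p' bu _ _ K(1) w(1,2) _ _ w(3)] K \<sigma> col e(5) d by auto
    then show False using w by (auto split: if_splits)
  qed
  show False
    using three_ends[OF m3 fg K(2) \<sigma>(1), of u u b s2] uW bW s2W d v3
    unfolding W_def[symmetric] by (auto simp: kend_def)
qed

text \<open>Chains of ends other than \<open>b\<close> and \<open>c\<close> avoid the chain joining
  \<open>b\<close> to \<open>c\<close>, so these changes are invisible to the twins. They are made
  for a set of ends at once because two successive changes on the same chain would cancel.\<close>

lemma twin_swap:
  assumes T: "twin K F b c" and m: "mcol K F m" and mb: "misses1 K m b \<beta>" and mc: "misses1 K m c \<beta>"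
    and j: "j \<in> K" "j \<noteq> \<beta>" and S: "\<forall>x\<in>S. x \<noteq> b \<and> x \<noteq> c \<and> kend m \<beta> j x"
  defines "X \<equiv> \<Union>x\<in>S. kempe m \<beta> j x"
  defines "m' \<equiv> kswap m \<beta> j X"
  shows "mcol K F m'" "misses1 K m' b \<beta>" "misses1 K m' c \<beta>" "\<And>i. m' i b = m i b" "\<And>i. m' i c = m i c"
    "b \<notin> X" "c \<notin> X" "S \<subseteq> X" "kclosed m \<beta> j X"
proof -
  have \<beta>: "\<beta> \<in> K" using mb by (simp add: misses1_def)
  show X: "b \<notin> X" "c \<notin> X" using twin_avoid[OF T m mb mc j] S unfolding X_def by blast+
  show cl: "kclosed m \<beta> j X" unfolding X_def by (intro kclosed_UN) auto
  show "S \<subseteq> X" unfolding X_def by auto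
  show "mcol K F m'" unfolding m'_def using mcol_kswap[OF m \<beta> j(1) cl] .
  show v: "\<And>i. m' i b = m i b" "\<And>i. m' i c = m i c" using X by (auto simp: m'_def kswap_def)
  show "misses1 K m' b \<beta>" "misses1 K m' c \<beta>"
    using mb mc v by (auto simp: misses1_def)
qed

text \<open>Let \<kappa> be the colour of \<open>u s1\<close>. A \<beta>/\<kappa> change at
  \<open>s1\<close> and \<open>s2\<close> makes \<kappa> missing at both and gives \<beta> to
  \<open>u s1\<close>, which is the setting of \<open>twin_kite_same\<close>.\<close>

lemma twin_kite_both:
  assumes T: "twin K F b c" and m: "mcol K F m" and mb: "misses1 K m b \<beta>" and mc: "misses1 K m c \<beta>"
    and s: "m \<beta> s1 = s1" "m \<beta> s2 = s2"
    and F: "{b, u} \<in> F" "{c, u} \<in> F" "{u, s1} \<in> F" "{u, s2} \<in> F" and d: "distinct [b, c, u, s1, s2]"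
  shows False
proof -
  obtain \<kappa> where \<kappa>: "\<kappa> \<in> K" "m \<kappa> u = s1" using mcol_ex[OF m F(3)] d by auto
  have \<kappa>': "m \<kappa> s1 = u" using mcol_sym[OF m \<kappa>] .
  have \<kappa>\<beta>: "\<kappa> \<noteq> \<beta>" using s \<kappa>' d by auto
  have S: "\<forall>x\<in>{s1, s2}. x \<noteq> b \<and> x \<noteq> c \<and> kend m \<beta> \<kappa> x"
      using s d by (auto simp: kend_def)
  let ?X = "\<Union>x\<in>{s1, s2}. kempe m \<beta> \<kappa> x"
  let ?m = "kswap m \<beta> \<kappa> ?X"
  note sw = twin_swap[OF T m mb mc \<kappa>(1) \<kappa>\<beta> S]
  have in': "s1 \<in> ?X" "s2 \<in> ?X" "u \<in> ?X"
    using sw(8) kempe_step(2)[of s1 m \<beta> \<kappa> s1] \<kappa>' by auto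
  have v: "?m \<kappa> s1 = s1" "?m \<kappa> s2 = s2" "?m \<beta> u = s1"
    using in' s \<kappa> \<kappa>\<beta> by (simp_all add: kswap_def del: UN_insert UN_iff)
  show False using twin_kite_same[OF T sw(1-3) \<kappa>(1) v F(1,2,4) d] .
qed

text \<open>The same change at \<open>s1\<close> leaves \<alpha> alone and leads to
  \<open>twin_kite_distinct\<close>.\<close>

lemma twin_kite_bu:
  assumes T: "twin K F b c" and m: "mcol K F m" and mb: "misses1 K m b \<beta>" and mc: "misses1 K m c \<beta>"
    and s: "m \<beta> s1 = s1" "m \<alpha> s2 = s2" "m \<alpha> b = u" "\<alpha> \<in> K"
    and F: "{u, s1} \<in> F" "{u, s2} \<in> F" and d: "distinct [b, c, u, s1, s2]"
  shows False
proof -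
  obtain \<kappa> where \<kappa>: "\<kappa> \<in> K" "m \<kappa> u = s1" using mcol_ex[OF m F(1)] d by auto
  have \<kappa>': "m \<kappa> s1 = u" using mcol_sym[OF m \<kappa>] .
  have \<alpha>': "m \<alpha> u = b" using mcol_sym[OF m s(4,3)] .
  have ne: "\<kappa> \<noteq> \<beta>" "\<kappa> \<noteq> \<alpha>" "\<alpha> \<noteq> \<beta>" using s \<kappa> \<kappa>' \<alpha>' d mb by (auto simp: misses1_def)
  have S: "\<forall>x\<in>{s1}. x \<noteq> b \<and> x \<noteq> c \<and> kend m \<beta> \<kappa> x"
      using s d by (auto simp: kend_def)
  let ?X = "\<Union>x\<in>{s1}. kempe m \<beta> \<kappa> x"
  let ?m = "kswap m \<beta> \<kappa> ?X"
  note sw = twin_swap[OF T m mb mc \<kappa>(1) ne(1) S]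
  have in': "s1 \<in> ?X" "u \<in> ?X"
    using sw(8) kempe_step(2)[of s1 m \<beta> \<kappa> s1] \<kappa>' by auto
  have v: "?m \<kappa> s1 = s1" "?m \<alpha> s2 = s2" "?m \<beta> u = s1" "?m \<alpha> b = u"
    using in' s \<kappa> ne sw(4) by (simp_all add: kswap_def del: UN_insert UN_iff)
  show False using twin_kite_distinct[OF T sw(1-3) s(4) \<kappa>(1) v(4,3,1,2) ne(2) F(2) d] .
qed

text \<open>The target is \<beta> missing at \<open>s1\<close>, and \<beta> or the colour \<alpha>
  of \<open>bu\<close> missing at \<open>s2\<close>. If \<open>t\<close> is neither \<alpha> nor
  \<beta>, the colour missing at \<open>s2\<close> is first turned into \<alpha>, where the later
  \<beta>/\<open>t\<close> change at \<open>s1\<close> cannot affect it.\<close>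

lemma twin_kite_aux:
  assumes T: "twin K F b c" and m: "mcol K F m" and mb: "misses1 K m b \<beta>" and mc: "misses1 K m c \<beta>"
    and s: "m \<beta> s2 = s2" "t \<in> K" "m t s1 = s1"
    and F: "{b, u} \<in> F" "{c, u} \<in> F" "{u, s1} \<in> F" "{u, s2} \<in> F" and d: "distinct [b, c, u, s1, s2]"
  shows False
proof (cases "t = \<beta>")
  case True
  then show False using twin_kite_both[OF T m mb mc _ s(1) F d] s by simp
next
  case t\<beta>: False
  obtain \<alpha> where \<alpha>: "\<alpha> \<in> K" "m \<alpha> b = u" using mcol_ex[OF m F(1)] d by auto
  have \<alpha>\<beta>: "\<alpha> \<noteq> \<beta>" using \<alpha> mb d by (auto simp: misses1_def)
  have \<beta>: "\<beta> \<in> K" using mb by (simp add: misses1_def)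
  show False
  proof (cases "t = \<alpha>")
    case True
    have S: "\<forall>x\<in>{s1}. x \<noteq> b \<and> x \<noteq> c \<and> kend m \<beta> \<alpha> x"
      using s d True by (auto simp: kend_def)
    let ?X = "\<Union>x\<in>{s1}. kempe m \<beta> \<alpha> x"
    let ?m = "kswap m \<beta> \<alpha> ?X"
    note sw = twin_swap[OF T m mb mc \<alpha>(1) \<alpha>\<beta> S]
    have s1: "?m \<beta> s1 = s1" using sw(8) True s by (simp add: kswap_def del: UN_insert UN_iff)
    show False
    proof (cases "s2 \<in> ?X")
      case True
      then have "?m \<alpha> s2 = s2" using s \<alpha>\<beta> by (simp add: kswap_def del: UN_insert UN_iff)
      then show False using twin_kite_bu[OF T sw(1-3) s1 _ _ \<alpha>(1) F(3,4) d] sw(4) \<alpha> by simp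
    next
      case False
      then have "?m \<beta> s2 = s2" using s \<alpha>\<beta> by (simp add: kswap_def del: UN_insert UN_iff)
      then show False using twin_kite_both[OF T sw(1-3) s1 _ F d] by simp
    qed
  next
    case t\<alpha>: False
    have S: "\<forall>x\<in>{s2}. x \<noteq> b \<and> x \<noteq> c \<and> kend m \<beta> \<alpha> x"
      using s d by (auto simp: kend_def)
    let ?X = "\<Union>x\<in>{s2}. kempe m \<beta> \<alpha> x"
    let ?m = "kswap m \<beta> \<alpha> ?X"
    note sw = twin_swap[OF T m mb mc \<alpha>(1) \<alpha>\<beta> S]
    have v: "?m \<alpha> s2 = s2" "?m t s1 = s1" "?m \<alpha> b = u"
      using sw(4,8) s t\<alpha> t\<beta> \<alpha>\<beta> \<alpha> by (simp_all add: kswap_def del: UN_insert UN_iff)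
    have S': "\<forall>x\<in>{s1}. x \<noteq> b \<and> x \<noteq> c \<and> kend ?m \<beta> t x"
      using v d by (auto simp: kend_def)
    let ?Y = "\<Union>x\<in>{s1}. kempe ?m \<beta> t x"
    let ?n = "kswap ?m \<beta> t ?Y"
    note sw' = twin_swap[OF T sw(1-3) s(2) t\<beta> S']
    have "?n \<beta> s1 = s1" using sw'(8) v(2) unfolding kswap_def[of ?m] by (simp del: UN_insert UN_iff)
    moreover have "?n \<alpha> s2 = s2" using v(1) t\<alpha> \<alpha>\<beta> unfolding kswap_def[of ?m] by (simp del: UN_insert UN_iff)
    moreover have "?n \<alpha> b = u" using sw'(4) v(3) by simp
    ultimately show False using twin_kite_bu[OF T sw'(1-3) _ _ _ \<alpha>(1) F(3,4) d] by blast
  qed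
qed

lemma twin_kite:
  assumes T: "twin K F b c" and m: "mcol K F m"
    and s: "t1 \<in> K" "m t1 s1 = s1" "t2 \<in> K" "m t2 s2 = s2"
    and F: "{b, u} \<in> F" "{c, u} \<in> F" "{u, s1} \<in> F" "{u, s2} \<in> F" and d: "distinct [b, c, u, s1, s2]"
  shows False
proof -
  obtain \<beta> where mb: "misses1 K m b \<beta>" and mc: "misses1 K m c \<beta>" using T m unfolding twin_def by blast
  have \<beta>: "\<beta> \<in> K" using mb by (simp add: misses1_def)
  show False
  proof (cases "t2 = \<beta>")
    case True
    then show False using twin_kite_aux[OF T m mb mc _ s(1,2) F d] s by simp
  next
    case t2: False
    have S: "\<forall>x\<in>{s2}. x \<noteq> b \<and> x \<noteq> c \<and> kend m \<beta> t2 x"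
      using s d by (auto simp: kend_def)
    let ?X = "\<Union>x\<in>{s2}. kempe m \<beta> t2 x"
    let ?m = "kswap m \<beta> t2 ?X"
    note sw = twin_swap[OF T m mb mc s(3) t2 S]
    have v: "?m \<beta> s2 = s2" using sw(8) s by (simp add: kswap_def del: UN_insert UN_iff)
    have "\<exists>t\<in>K. ?m t s1 = s1"
    proof (cases "s1 \<in> ?X")
      case True
      then show ?thesis using s \<beta>
        by (intro bexI[of _ "if t1 = \<beta> then t2 else if t1 = t2 then \<beta> else t1"])
          (auto simp: kswap_def simp del: UN_insert UN_iff)
    next
      case False
      then show ?thesis using s by (intro bexI[of _ t1]) (auto simp: kswap_def simp del: UN_insert UN_iff)
    qed
    then show False using twin_kite_aux[OF T sw(1-3) v _ _ F d] by blast
  qed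
qed

section \<open>Neighbours of the twins next to a vertex that misses two colours\<close>

text \<open>The edge \<open>ux\<close> takes over \<alpha> from \<open>bu\<close>, which leaves
  \<beta> missing at both \<open>b\<close> and \<open>u\<close>.\<close>

lemma twin_short:
  assumes T: "twin K F b c" and m: "mcol K F m" and mb: "misses1 K m b \<beta>" and mc: "misses1 K m c \<beta>"
    and e: "\<alpha> \<in> K" "m \<alpha> b = u" "m \<beta> u = x" "m \<alpha> x = x" and d: "distinct [b, c, u, x]"
  shows False
proof -
  have bK: "\<beta> \<in> K" "m \<beta> b = b" "m \<beta> c = c" using mb mc by (auto simp: misses1_def)
  have col: "\<alpha> \<noteq> \<beta>" using e bK d by auto
  have bu: "{b, u} \<in> F" using mcol_edge[OF m e(1), of b] e d by auto
  let ?m = "uncolour m \<alpha> b u"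
  have m0: "mcol K (F - {{b, u}}) ?m" using mcol_uncolour[OF m e(1,2)] d by auto
  let ?n = "recolour ?m \<beta> \<alpha> u x"
  have n: "mcol K (F - {{b, u}}) ?n" using m0 e d bK by (intro mcol_recolour) (auto simp: uncolour_simps)
  have v: "?n \<beta> u = u" "?n \<beta> b = b" "?n \<alpha> b = b" "?n \<alpha> c = m \<alpha> c"
    using col d bK by (auto simp: recolour_simps uncolour_simps)
  have "m \<alpha> c = c" using twin_ext[OF T n bu _ _ bK(1) v(1,2) e(1) _ v(3)] v(4) col d by auto
  then show False using mc e(1) col by (auto simp: misses1_def)
qed

text \<open>The target is \<open>twin_short\<close>: the colour \<alpha> of \<open>bu\<close>
  missing at \<open>x\<close>, and \<beta> on \<open>ux\<close>. One missing colour of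
  \<open>x\<close> is turned into \<alpha>; the other is turned into \<beta>, so that a Kempe change
  at \<open>x\<close> can give \<beta> to \<open>ux\<close>.\<close>

lemma twin_two_missing:
  assumes T: "twin K F b c" and m: "mcol K F m"
    and \<delta>: "\<delta>1 \<in> K" "\<delta>2 \<in> K" "\<delta>1 \<noteq> \<delta>2" "m \<delta>1 x = x" "m \<delta>2 x = x"
    and F: "{b, u} \<in> F" "{u, x} \<in> F" and d: "distinct [b, c, u, x]"
  shows False
proof -
  have sw: "\<exists>m'. mcol K F m' \<and> misses1 K m' b \<beta> \<and> misses1 K m' c \<beta> \<and> (\<forall>i. m' i b = m i b)
      \<and> m' \<beta> x = m j x \<and> m' j x = m \<beta> x \<and> (\<forall>i. i \<noteq> \<beta> \<longrightarrow> i \<noteq> j \<longrightarrow> m' i = m i) \<and> m' \<beta> (m j x) = x"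
    if "mcol K F m" "misses1 K m b \<beta>" "misses1 K m c \<beta>" "j \<in> K" "j \<noteq> \<beta>" "kend m \<beta> j x" for m \<beta> j
  proof -
    have S: "\<forall>y\<in>{x}. y \<noteq> b \<and> y \<noteq> c \<and> kend m \<beta> j y"
      using \<open>kend m \<beta> j x\<close> d by auto
    let ?X = "\<Union>x\<in>{x}. kempe m \<beta> j x"
    note sw = twin_swap[OF T that(1-5) S]
    have "x \<in> ?X" "m j x \<in> ?X" using kempe_step(2)[of x m \<beta> j x] by auto
    then have "kswap m \<beta> j ?X \<beta> x = m j x" "kswap m \<beta> j ?X j x = m \<beta> x" "kswap m \<beta> j ?X \<beta> (m j x) = x"
      using \<open>j \<noteq> \<beta>\<close> mcol_invol[OF that(1,4)] by (simp_all add: kswap_def del: UN_insert UN_iff)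
    moreover have "kswap m \<beta> j ?X i = m i" if "i \<noteq> \<beta>" "i \<noteq> j" for i using that by (auto simp: kswap_def)
    ultimately show ?thesis using sw(1-5) by blast
  qed
  have A: False if m: "mcol K F m" and b: "misses1 K m b \<beta>" "misses1 K m c \<beta>" and \<alpha>: "\<alpha> \<in> K" "m \<alpha> b = u" "m \<alpha> x = x"
    and \<delta>: "\<delta> \<in> K" "\<delta> \<noteq> \<alpha>" "m \<delta> x = x" for m \<alpha> \<beta> \<delta>
  proof -
    have \<alpha>\<beta>: "\<alpha> \<noteq> \<beta>" using \<alpha> b d by (auto simp: misses1_def)
    have \<beta>: "\<beta> \<in> K" using b by (simp add: misses1_def)
    have B: False if m: "mcol K F m" and b: "misses1 K m b \<beta>" "misses1 K m c \<beta>" and \<alpha>: "m \<alpha> b = u" "m \<alpha> x = x"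
      and \<beta>x: "m \<beta> x = x" for m
    proof -
      obtain \<gamma> where \<gamma>: "\<gamma> \<in> K" "m \<gamma> u = x" using mcol_ex[OF m F(2)] d by auto
      have \<gamma>': "m \<gamma> x = u" using mcol_sym[OF m \<gamma>] .
      have ne: "\<gamma> \<noteq> \<alpha>" "\<gamma> \<noteq> \<beta>" using \<gamma>' \<alpha> \<beta>x d by auto
      obtain m' where m': "mcol K F m'" "misses1 K m' b \<beta>" "misses1 K m' c \<beta>" "\<And>i. m' i b = m i b"
         "\<And>i. i \<noteq> \<beta> \<Longrightarrow> i \<noteq> \<gamma> \<Longrightarrow> m' i = m i" "m' \<beta> (m \<gamma> x) = x"
        using sw[OF m b \<gamma>(1) ne(2)] \<beta>x by (auto simp: kend_def)
      show False using twin_short[OF T m'(1-3) \<open>\<alpha> \<in> K\<close> _ _ _ d] m'(4-6) \<alpha> ne \<gamma>' \<alpha>\<beta> by auto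
    qed
    show False
    proof (cases "\<delta> = \<beta>")
      case True then show False using B[OF m b] \<alpha> \<delta> by auto
    next
      case False
      show False
      proof (cases "m \<beta> u = x")
        case True then show False using twin_short[OF T m b \<alpha>(1,2) _ \<alpha>(3) d] by blast
      next
        case n: False
        obtain m' where m': "mcol K F m'" "misses1 K m' b \<beta>" "misses1 K m' c \<beta>" "\<And>i. m' i b = m i b"
         "\<And>i. i \<noteq> \<beta> \<Longrightarrow> i \<noteq> \<delta> \<Longrightarrow> m' i = m i" "m' \<beta> x = m \<delta> x"
          using sw[OF m b \<delta>(1) False] \<delta> by (auto simp: kend_def)
        show False using B[OF m'(1-3)] m'(4-6) \<alpha> \<delta> \<alpha>\<beta> by auto
      qed
    qed
  qed
  obtain \<beta> where b: "misses1 K m b \<beta>" "misses1 K m c \<beta>" using T m unfolding twin_def by blast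
  obtain \<alpha> where \<alpha>: "\<alpha> \<in> K" "m \<alpha> b = u" using mcol_ex[OF m F(1)] d by auto
  have \<alpha>\<beta>: "\<alpha> \<noteq> \<beta>" using \<alpha> b d by (auto simp: misses1_def)
  have B: False if m: "mcol K F m" and b: "misses1 K m b \<beta>" "misses1 K m c \<beta>" and \<alpha>: "m \<alpha> b = u"
      and \<delta>: "\<delta> \<in> K" "\<delta> \<noteq> \<beta>" "m \<delta> x = x" "m \<beta> x = x" for m \<delta>
  proof (cases "\<delta> = \<alpha>")
    case True
    have "\<beta> \<in> K" using b by (simp add: misses1_def)
    then show False using A[OF m b \<open>\<alpha> \<in> K\<close> \<alpha>] \<delta> True by auto
  next
    case False
    obtain m' where m': "mcol K F m'" "misses1 K m' b \<beta>" "misses1 K m' c \<beta>" "\<And>i. m' i b = m i b"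
         "\<And>i. i \<noteq> \<beta> \<Longrightarrow> i \<noteq> \<alpha> \<Longrightarrow> m' i = m i" "m' \<alpha> x = m \<beta> x"
      using sw[OF m b \<open>\<alpha> \<in> K\<close> \<alpha>\<beta>] \<delta> by (auto simp: kend_def)
    show False using A[OF m'(1-3) \<open>\<alpha> \<in> K\<close> _ _ \<delta>(1) False] m'(4-6) \<alpha> \<delta> False by auto
  qed
  show False
  proof (cases "\<delta>1 = \<beta> \<or> \<delta>2 = \<beta>")
    case True then show False using B[OF m b \<alpha>(2)] \<delta> by metis
  next
    case False
    obtain m' where m': "mcol K F m'" "misses1 K m' b \<beta>" "misses1 K m' c \<beta>" "\<And>i. m' i b = m i b"
         "\<And>i. i \<noteq> \<beta> \<Longrightarrow> i \<noteq> \<delta>1 \<Longrightarrow> m' i = m i" "m' \<beta> x = m \<delta>1 x"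
      using sw[OF m b \<delta>(1)] False \<delta> by (auto simp: kend_def)
    show False using B[OF m'(1-3) _ \<delta>(2)] m'(4-6) \<alpha> \<delta> False by auto
  qed
qed

subsection \<open>Leaves hanging from low-degree vertices\<close>

lemma mcol_degree:
  assumes m: "mcol K F m"
  shows "card {i\<in>K. m i v \<noteq> v} = card {w. w \<noteq> v \<and> {v, w} \<in> F}"
proof (rule bij_betw_same_card)
  show "bij_betw (\<lambda>i. m i v) {i\<in>K. m i v \<noteq> v} {w. w \<noteq> v \<and> {v, w} \<in> F}"
    unfolding bij_betw_def
  proof
    show "inj_on (\<lambda>i. m i v) {i\<in>K. m i v \<noteq> v}"
      using mcol_inj[OF m] by (auto intro!: inj_onI)
    show "(\<lambda>i. m i v) ` {i\<in>K. m i v \<noteq> v} = {w. w \<noteq> v \<and> {v, w} \<in> F}"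
    proof
      show "(\<lambda>i. m i v) ` {i\<in>K. m i v \<noteq> v} \<subseteq> {w. w \<noteq> v \<and> {v, w} \<in> F}"
        using mcol_edge[OF m] by auto
      show "{w. w \<noteq> v \<and> {v, w} \<in> F} \<subseteq> (\<lambda>i. m i v) ` {i\<in>K. m i v \<noteq> v}"
      proof
        fix w assume "w \<in> {w. w \<noteq> v \<and> {v, w} \<in> F}"
        then have w: "w \<noteq> v" "{v, w} \<in> F" by auto
        then obtain i where "i \<in> K" "m i v = w" using mcol_ex[OF m w(2)] by auto
        then show "w \<in> (\<lambda>i. m i v) ` {i\<in>K. m i v \<noteq> v}" using w by auto
      qed
    qed
  qed
qed

text \<open>The number of colours missing at \<open>v\<close> depends only on \<open>K\<close> and
  \<open>F\<close>.\<close>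

lemma mcol_missing_transfer:
  assumes "mcol K F m" "mcol K F m'" "finite K" "t \<in> K" "m t v = v"
  shows "\<exists>t\<in>K. m' t v = v"
proof (rule ccontr)
  assume "\<not> ?thesis"
  then have "{i\<in>K. m' i v \<noteq> v} = K" by blast
  then have "card {i\<in>K. m i v \<noteq> v} = card K"
    using mcol_degree[OF assms(1), of v] mcol_degree[OF assms(2), of v] by simp
  then have "{i\<in>K. m i v \<noteq> v} = K" using assms(3) by (intro card_subset_eq) auto
  then show False using assms(4,5) by blast
qed

definition common :: "nat set \<Rightarrow> 'v set \<Rightarrow> (nat \<Rightarrow> 'v \<Rightarrow> 'v) \<Rightarrow> nat set" where
  "common K S m = {q\<in>K. \<forall>v\<in>S. m q v = v}"

text \<open>\<open>S\<close> holds vertices of low degree whose edges to \<open>s1\<close> or \<open>s2\<close> have been deleted from \<open>F\<close>. Such an edge can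
  be given back any colour that is missing at its end in \<open>{s1, s2}\<close> and at all of \<open>S\<close>; this is what the last
  condition expresses. The bound 8 provides a common missing colour that avoids seven given ones.\<close>

definition leaf_cfg :: "nat set \<Rightarrow> 'v set set \<Rightarrow> 'v set \<Rightarrow> 'v \<Rightarrow> 'v \<Rightarrow> 'v \<Rightarrow> 'v \<Rightarrow> 'v \<Rightarrow> bool" where
  "leaf_cfg K F S b c u s1 s2 \<longleftrightarrow> fin_graph F \<and> finite K \<and> distinct [b, c, u, s1, s2] \<and> b \<notin> S \<and> c \<notin> S \<and>
     {b, u} \<in> F \<and> {c, u} \<in> F \<and> {u, s1} \<in> F \<and> {u, s2} \<in> F \<and>
     (\<forall>m. mcol K F m \<longrightarrow> 8 \<le> card (common K S m)) \<and>
     (\<forall>m t1 t2. mcol K F m \<longrightarrow> t1 \<in> common K S m \<longrightarrow> t2 \<in> common K S m \<longrightarrow>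
        m t1 s1 = s1 \<longrightarrow> m t2 s2 = s2 \<longrightarrow> (\<exists>i. misses1 K m b i \<and> misses1 K m c i))"

lemma leaf_cfg_misses1:
  assumes "leaf_cfg K F S b c u s1 s2" "mcol K F m" "t1 \<in> common K S m" "t2 \<in> common K S m" "m t1 s1 = s1" "m t2 s2 = s2"
  shows "\<exists>i. misses1 K m b i \<and> misses1 K m c i"
  using assms unfolding leaf_cfg_def by blast

lemma leaf_cfg_sym_s: "leaf_cfg K F S b c u s1 s2 \<Longrightarrow> leaf_cfg K F S b c u s2 s1"
  unfolding leaf_cfg_def by (auto; metis)

lemma leaf_cfg_sym_b: "leaf_cfg K F S b c u s1 s2 \<Longrightarrow> leaf_cfg K F S c b u s1 s2"
  unfolding leaf_cfg_def by (auto; metis)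

text \<open>The colours \<open>t1\<close> and \<open>t2\<close> witness that the deleted edges could
  be coloured again. They are part of the state because the twin property in \<open>leaf_cfg\<close>
  is available only in their presence.\<close>

definition leaf_st :: "nat set \<Rightarrow> 'v set set \<Rightarrow> 'v set \<Rightarrow> 'v \<Rightarrow> 'v \<Rightarrow> 'v \<Rightarrow> 'v \<Rightarrow> (nat \<Rightarrow> 'v \<Rightarrow> 'v) \<Rightarrow> nat \<Rightarrow> nat \<Rightarrow> nat \<Rightarrow> bool" where
  "leaf_st K F S b c s1 s2 m \<beta> t1 t2 \<longleftrightarrow> mcol K F m \<and> misses1 K m b \<beta> \<and> misses1 K m c \<beta> \<and>
     t1 \<in> common K S m \<and> t2 \<in> common K S m \<and> m t1 s1 = s1 \<and> m t2 s2 = s2"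

lemma leaf_st_sym_s: "leaf_st K F S b c s1 s2 m \<beta> t1 t2 \<Longrightarrow> leaf_st K F S b c s2 s1 m \<beta> t2 t1"
  unfolding leaf_st_def by auto

section \<open>Kempe changes that keep the witnesses\<close>

lemma common_kswap_in:
  assumes "p \<in> common K S m" "q \<in> common K S m"
  shows "common K S (kswap m p q X) = common K S m"
  using assms unfolding common_def kswap_def by auto

definition trcol :: "nat \<Rightarrow> nat \<Rightarrow> nat \<Rightarrow> nat" where
  "trcol p q i = (if i = p then q else if i = q then p else i)"

lemma kswap_trcol: "kswap m p q X i v = (if v \<in> X then m (trcol p q i) v else m i v)"
  by (simp add: kswap_def trcol_def)

lemma trcol_trcol [simp]: "trcol p q (trcol p q i) = i"
  by (auto simp: trcol_def)

lemma kswap_commute: "kswap m p q X = kswap m q p X"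
  by (auto simp: kswap_def fun_eq_iff)

lemma kclosed_commute: "kclosed m p q X \<longleftrightarrow> kclosed m q p X"
  by (auto simp: kclosed_def)

text \<open>A missing colour of \<open>s1\<close> or \<open>s2\<close> survives under its new name.
  It also stays missing on \<open>S\<close>: either it is neither \<open>p\<close> nor
  \<open>q\<close>, or both of these are missing on \<open>S\<close> and the change has no effect
  there.\<close>

lemma leaf_st_leaves_kswap:
  assumes R: "leaf_st K F S b c s1 s2 m \<beta> t1 t2"
    and cl: "kclosed m p q X" "p \<in> K" "q \<in> K"
    and cond: "t1 \<notin> {p, q} \<and> t2 \<notin> {p, q} \<or> p \<in> common K S m \<and> q \<in> common K S m"
  defines "m' \<equiv> kswap m p q X"
  defines "t1' \<equiv> (if s1 \<in> X then trcol p q t1 else t1)" and "t2' \<equiv> (if s2 \<in> X then trcol p q t2 else t2)"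
  shows "mcol K F m'" "t1' \<in> common K S m'" "t2' \<in> common K S m'" "m' t1' s1 = s1" "m' t2' s2 = s2"
proof -
  have r: "mcol K F m" "t1 \<in> common K S m" "t2 \<in> common K S m" "m t1 s1 = s1" "m t2 s2 = s2"
    using R by (auto simp: leaf_st_def)
  show "mcol K F m'" unfolding m'_def using mcol_kswap[OF r(1) cl(2,3,1)] .
  show "m' t1' s1 = s1" "m' t2' s2 = s2" using r by (auto simp: m'_def t1'_def t2'_def kswap_trcol)
  have "trcol p q t \<in> common K S m' \<and> t \<in> common K S m'"
    if "t \<in> common K S m" "t \<notin> {p, q} \<or> p \<in> common K S m \<and> q \<in> common K S m" for t
    using that(2)
  proof
    assume "t \<notin> {p, q}"
    then show ?thesis using that(1) unfolding m'_def common_def kswap_def trcol_def by auto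
  next
    assume "p \<in> common K S m \<and> q \<in> common K S m"
    then show ?thesis using common_kswap_in[of p K S m q X] that(1) unfolding m'_def trcol_def by auto
  qed
  then show "t1' \<in> common K S m'" "t2' \<in> common K S m'"
    using r cond by (auto simp: t1'_def t2'_def)
qed

text \<open>The argument of \<open>twin_link\<close>; \<open>cond\<close> guarantees that the
  changed colouring still has witnesses, so that \<open>leaf_cfg\<close> applies to it.\<close>

lemma leaf_st_avoid:
  assumes C: "leaf_cfg K F S b c u s1 s2" and R: "leaf_st K F S b c s1 s2 m \<beta> t1 t2"
    and j: "j \<in> K" "j \<noteq> \<beta>"
    and cond: "t1 \<notin> {\<beta>, j} \<and> t2 \<notin> {\<beta>, j} \<or> \<beta> \<in> common K S m \<and> j \<in> common K S m"
    and x: "x \<noteq> b" "x \<noteq> c" "kend m \<beta> j x"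
  shows "b \<notin> kempe m \<beta> j x" "c \<notin> kempe m \<beta> j x"
proof -
  have r: "mcol K F m" "misses1 K m b \<beta>" "misses1 K m c \<beta>" using R by (auto simp: leaf_st_def)
  have iK: "\<beta> \<in> K" "m \<beta> b = b" "m \<beta> c = c" using r by (auto simp: misses1_def)
  have bc: "b \<noteq> c" "fin_graph F" using C by (auto simp: leaf_cfg_def)
  have l: "c \<in> kempe m \<beta> j b"
  proof (rule ccontr)
    assume n: "c \<notin> kempe m \<beta> j b"
    let ?m = "kswap m \<beta> j (kempe m \<beta> j b)"
    note l = leaf_st_leaves_kswap[OF R kclosed_kempe iK(1) j(1) cond, of b]
    obtain k where k: "misses1 K ?m b k" "misses1 K ?m c k"
      using C l unfolding leaf_cfg_def by blast
    have "?m j b = b" using iK j by (auto simp: kswap_def)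
    moreover have "?m \<beta> c = c" using n iK by (simp add: kswap_def)
    ultimately show False using k j iK(1) by (auto simp: misses1_def)
  qed
  show "b \<notin> kempe m \<beta> j x" "c \<notin> kempe m \<beta> j x"
    using kempe_avoid_linked[OF r(1) bc(2) iK(1) j(1) iK(2,3) l bc(1) x] by auto
qed

lemma leaf_st_swap:
  assumes C: "leaf_cfg K F S b c u s1 s2" and R: "leaf_st K F S b c s1 s2 m \<beta> t1 t2"
    and j: "j \<in> K" "j \<noteq> \<beta>"
    and cond: "t1 \<notin> {\<beta>, j} \<and> t2 \<notin> {\<beta>, j} \<or> \<beta> \<in> common K S m \<and> j \<in> common K S m"
    and Y: "\<forall>x\<in>Y. x \<noteq> b \<and> x \<noteq> c \<and> kend m \<beta> j x"
  defines "X \<equiv> \<Union>x\<in>Y. kempe m \<beta> j x"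
  defines "m' \<equiv> kswap m \<beta> j X"
  shows "leaf_st K F S b c s1 s2 m' \<beta> (if s1 \<in> X then trcol \<beta> j t1 else t1) (if s2 \<in> X then trcol \<beta> j t2 else t2)"
    and "\<And>i. m' i b = m i b" and "\<And>i. m' i c = m i c" and "\<And>i. i \<noteq> \<beta> \<Longrightarrow> i \<noteq> j \<Longrightarrow> m' i = m i"
    and "Y \<subseteq> X" and "kclosed m \<beta> j X" and "X \<inter> kempe m \<beta> j b = {}"
proof -
  have r: "mcol K F m" "misses1 K m b \<beta>" "misses1 K m c \<beta>" using R by (auto simp: leaf_st_def)
  have \<beta>: "\<beta> \<in> K" using r by (auto simp: misses1_def)
  have bX: "b \<notin> X" "c \<notin> X" using leaf_st_avoid[OF C R j cond] Y unfolding X_def by blast+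
  show cl: "kclosed m \<beta> j X" unfolding X_def by (intro kclosed_UN) auto
  show "Y \<subseteq> X" unfolding X_def by auto
  show v: "\<And>i. m' i b = m i b" "\<And>i. m' i c = m i c" using bX by (auto simp: m'_def kswap_def)
  show "\<And>i. i \<noteq> \<beta> \<Longrightarrow> i \<noteq> j \<Longrightarrow> m' i = m i" by (auto simp: m'_def kswap_def)
  show "leaf_st K F S b c s1 s2 m' \<beta> (if s1 \<in> X then trcol \<beta> j t1 else t1) (if s2 \<in> X then trcol \<beta> j t2 else t2)"
    using leaf_st_leaves_kswap[OF R cl \<beta> j(1) cond] r v unfolding leaf_st_def m'_def[symmetric] misses1_def by auto
  have "kclosed m \<beta> j (- X)"
    using kclosed_notin[OF r(1) \<beta> j(1) cl] by (auto simp: kclosed_def)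
  then show "X \<inter> kempe m \<beta> j b = {}" using kempe_minimal[of m \<beta> j "- X" b] bX by blast
qed

text \<open>Only the colours in \<open>Q\<close> and the edges \<open>F'\<close> having these
  colours are kept, and none of these edges meets \<open>S\<close>. A recolouring of
  \<open>F'\<close> by \<open>Q\<close>, completed by the old colours elsewhere, is a colouring of
  \<open>F\<close> that still has witnesses. So \<open>b\<close> and \<open>c\<close> are twins for
  \<open>Q\<close> and \<open>F'\<close>, and \<open>twin_kite\<close> applies.\<close>

lemma leaf_cfg_contradiction:
  assumes C: "leaf_cfg K F S b c u s1 s2" and R: "leaf_st K F S b c s1 s2 m \<beta> t1 t2"
    and Q: "\<beta> \<in> common K S m" "\<And>x. x \<in> {b, c, s1, s2} \<Longrightarrow> \<exists>q\<in>common K S m. m q u = x"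
  shows False
proof -
  define Q where "Q = common K S m"
  define F' where "F' = {{v, m q v} | q v. q \<in> Q \<and> m q v \<noteq> v}"
  have m: "mcol K F m" using R by (simp add: leaf_st_def)
  have QK: "Q \<subseteq> K" "finite Q" using C by (auto simp: Q_def common_def leaf_cfg_def)
  have F'F: "F' \<subseteq> F" unfolding F'_def using mcol_edge[OF m] QK by auto
  have F'D: "\<exists>q\<in>Q. m q v = w" if vw: "{v, w} \<in> F'" for v w
  proof -
    obtain q x where q: "q \<in> Q" "{v, w} = {x, m q x}" using vw unfolding F'_def by blast
    then have "v = x \<and> w = m q x \<or> v = m q x \<and> w = x" by (auto simp: doubleton_eq_iff)
    then show ?thesis using q(1) mcol_sym[OF m] QK by blast
  qed
  have F'I: "{v, m q v} \<in> F'" if "q \<in> Q" "m q v \<noteq> v" for q v using that unfolding F'_def by blast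
  have mQ: "mcol Q F' m"
    unfolding mcol_def using F'D F'I mcol_invol[OF m] mcol_inj[OF m] QK by blast
  have d: "distinct [b, c, u, s1, s2]" using C by (simp add: leaf_cfg_def)
  have st: "t1 \<in> Q" "t2 \<in> Q" "m t1 s1 = s1" "m t2 s2 = s2" "m \<beta> b = b" "\<beta> \<in> Q"
    using R Q(1) by (auto simp: leaf_st_def misses1_def Q_def)
  have "twin Q F' b c"
    unfolding twin_def
  proof (intro conjI allI impI)
    show "fin_graph F'" using F'F C by (auto simp: leaf_cfg_def fin_graph_def intro: finite_subset)
    show "b \<noteq> c" using d by simp
    fix m' assume m': "mcol Q F' m'"
    define n where "n = (\<lambda>i. if i \<in> Q then m' i else m i)"
    have n: "mcol K F n"
    proof -
      have 1: "n i (n i v) = v" if "i \<in> K" for i v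
        using mcol_invol[OF m that] mcol_invol[OF m'] by (auto simp: n_def)
      have 2: "{v, n i v} \<in> F" if "i \<in> K" "n i v \<noteq> v" for i v
        using that mcol_edge[OF m that(1), of v] mcol_edge[OF m', of i v] F'F by (auto simp: n_def split: if_splits)
      have 3: "\<exists>i\<in>K. n i v = w" if vw: "v \<noteq> w" "{v, w} \<in> F" for v w
      proof -
        obtain i where i: "i \<in> K" "m i v = w" using mcol_ex[OF m vw(2,1)] by blast
        show ?thesis
        proof (cases "i \<in> Q")
          case True
          then have "{v, w} \<in> F'" using F'I[of i v] i vw by auto
          then obtain k where "k \<in> Q" "m' k v = w" using mcol_ex[OF m'] vw by blast
          then show ?thesis using QK by (intro bexI[of _ k]) (auto simp: n_def)
        next
          case False then show ?thesis using i by (intro bexI[of _ i]) (auto simp: n_def)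
        qed
      qed
      \<comment> \<open>The two parts colour disjoint sets of edges, since every edge of
        \<open>F'\<close> had its old colour in \<open>Q\<close>.\<close>
      have x: False if "i \<in> Q" "j \<in> K" "j \<notin> Q" "m' i v = m j v" "m j v \<noteq> v" for i j v
      proof -
        have "{v, m j v} \<in> F'" using mcol_edge[OF m' that(1), of v] that by auto
        then obtain q where "q \<in> Q" "m q v = m j v" using F'D by blast
        then show False using mcol_inj[OF m, of q j v] that QK by auto
      qed
      have 4: "i = j" if "i \<in> K" "j \<in> K" "n i v = n j v" "n i v \<noteq> v" for i j v
        using that x[of i j v] x[of j i v] mcol_inj[OF m that(1,2), of v] mcol_inj[OF m', of i j v]
        by (auto simp: n_def split: if_splits)
      show ?thesis unfolding mcol_def using 1 2 3 4 by blast
    qed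
    have com: "Q \<subseteq> common K S n"
    proof
      fix q assume q: "q \<in> Q"
      have "m' q v = v" if "v \<in> S" for v
      proof (rule ccontr)
        assume "m' q v \<noteq> v"
        then have "{v, m' q v} \<in> F'" using mcol_edge[OF m' q] by blast
        then obtain r where "r \<in> Q" "m r v = m' q v" using F'D by blast
        then show False using \<open>v \<in> S\<close> \<open>m' q v \<noteq> v\<close> by (auto simp: Q_def common_def)
      qed
      then show "q \<in> common K S n" using q QK by (auto simp: common_def n_def)
    qed
    \<comment> \<open>Degrees in \<open>F'\<close> are unchanged, so \<open>s1\<close>,
      \<open>s2\<close> and \<open>b\<close> still miss colours of \<open>Q\<close>. For
      \<open>b\<close> this shows that the colour provided by \<open>leaf_cfg\<close> lies in
      \<open>Q\<close>.\<close>
    obtain r1 where r1: "r1 \<in> Q" "m' r1 s1 = s1"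
      using mcol_missing_transfer[OF mQ m' QK(2) st(1,3)] by blast
    obtain r2 where r2: "r2 \<in> Q" "m' r2 s2 = s2"
      using mcol_missing_transfer[OF mQ m' QK(2) st(2,4)] by blast
    obtain r3 where r3: "r3 \<in> Q" "m' r3 b = b"
      using mcol_missing_transfer[OF mQ m' QK(2) st(6,5)] by blast
    obtain i where i: "misses1 K n b i" "misses1 K n c i"
      using leaf_cfg_misses1[OF C n, of r1 r2] com r1 r2 by (auto simp: n_def)
    have "i = r3" using i(1) r3 QK by (auto simp: misses1_def n_def)
    moreover have "m' j v = v \<longleftrightarrow> n j v = v" "j \<in> K" if "j \<in> Q" for j v
      using that QK by (auto simp: n_def)
    ultimately have "misses1 Q m' b i \<and> misses1 Q m' c i"
      using i r3(1) unfolding misses1_def by simp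
    then show "\<exists>i. misses1 Q m' b i \<and> misses1 Q m' c i" by blast
  qed
  moreover have "{u, x} \<in> F'" if x: "x \<in> {b, c, s1, s2}" for x
  proof -
    obtain q where q: "q \<in> Q" "m q u = x" using Q(2)[OF x] unfolding Q_def by blast
    moreover have "x \<noteq> u" using x d by auto
    ultimately show ?thesis using F'I[of q u] by auto
  qed
  ultimately show False
    using twin_kite[OF _ mQ st(1,3,2,4), of b c u] d by (auto simp: insert_commute)
qed

text \<open>The aim is to bring the colours of the edges from \<open>u\<close> to \<open>b\<close>, \<open>c\<close>, \<open>s1\<close>, \<open>s2\<close>, and the colour missing at \<open>b\<close>
  and \<open>c\<close>, into the set of colours missing at all of \<open>S\<close>: then \<open>S\<close> plays no role for the Kempe changes of
  the kite argument, which is carried out with these colours only.\<close>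

definition common_edge :: "nat set \<Rightarrow> 'v set \<Rightarrow> (nat \<Rightarrow> 'v \<Rightarrow> 'v) \<Rightarrow> 'v \<Rightarrow> 'v \<Rightarrow> bool" where
  "common_edge K S m u y \<longleftrightarrow> (\<exists>q\<in>common K S m. m q u = y)"

section \<open>Bringing colours into \<open>common K S m\<close>\<close>

lemma leaf_cfg_fresh:
  assumes C: "leaf_cfg K F S b c u s1 s2" and m: "mcol K F m" and A: "length A \<le> 7"
  shows "\<exists>\<delta>\<in>common K S m. \<delta> \<notin> set A"
proof (rule ccontr)
  assume "\<not> ?thesis"
  then have "common K S m \<subseteq> set A" by blast
  then have "card (common K S m) \<le> card (set A)" by (intro card_mono) auto
  also have "\<dots> \<le> 7" using card_length[of A] A by linarith
  finally show False using C m unfolding leaf_cfg_def by fastforce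
qed

text \<open>The change is made on the chains of those vertices of \<open>S\<close> that have an edge
  of colour \<kappa>; they are ends because \<delta> is missing there. Afterwards \<kappa> is
  missing on all of \<open>S\<close>, and \<delta> is the only colour that may be lost. One of the
  two colours has to be \<beta>, so that the chains avoid \<open>b\<close> and
  \<open>c\<close>.\<close>

lemma leaf_st_op:
  assumes C: "leaf_cfg K F S b c u s1 s2" and R: "leaf_st K F S b c s1 s2 m \<beta> t1 t2"
    and \<delta>: "\<delta> \<in> common K S m" "t1 \<noteq> \<delta>" "t2 \<noteq> \<delta>" and \<kappa>: "\<kappa> \<in> K" "\<kappa> \<notin> common K S m"
    and \<beta>: "\<delta> = \<beta> \<or> \<kappa> = \<beta>"
  obtains X where "leaf_st K F S b c s1 s2 (kswap m \<delta> \<kappa> X) \<beta> t1 t2" "\<kappa> \<in> common K S (kswap m \<delta> \<kappa> X)"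
    "common K S m - {\<delta>} \<subseteq> common K S (kswap m \<delta> \<kappa> X)"
    "\<forall>i. kswap m \<delta> \<kappa> X i b = m i b" "\<forall>i. kswap m \<delta> \<kappa> X i c = m i c"
    "kclosed m \<delta> \<kappa> X" "X \<inter> kempe m \<delta> \<kappa> b = {}"
proof -
  define j where "j = (if \<delta> = \<beta> then \<kappa> else \<delta>)"
  have dk: "\<delta> \<noteq> \<kappa>" "\<delta> \<in> K" using \<delta> \<kappa> by (auto simp: common_def)
  have j: "j \<in> K" "j \<noteq> \<beta>" "{\<beta>, j} = {\<delta>, \<kappa>}" using \<beta> dk \<kappa> by (auto simp: j_def)
  have t: "t1 \<in> common K S m" "t2 \<in> common K S m" using R by (auto simp: leaf_st_def)
  have cond: "t1 \<notin> {\<beta>, j} \<and> t2 \<notin> {\<beta>, j}" using t \<delta> \<kappa> unfolding j(3) by auto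
  define Y where "Y = {v\<in>S. m \<kappa> v \<noteq> v}"
  have Y: "\<forall>x\<in>Y. x \<noteq> b \<and> x \<noteq> c \<and> kend m \<beta> j x"
    using C \<delta>(1) \<beta> unfolding Y_def leaf_cfg_def kend_def common_def j_def by auto
  let ?X = "\<Union>x\<in>Y. kempe m \<beta> j x"
  note sw = leaf_st_swap[OF C R j(1,2) disjI1[OF cond] Y]
  have eq: "kswap m \<beta> j ?X = kswap m \<delta> \<kappa> ?X" "kclosed m \<beta> j ?X = kclosed m \<delta> \<kappa> ?X" "kempe m \<beta> j b = kempe m \<delta> \<kappa> b"
    using \<beta> kswap_commute[of m \<beta> j ?X] kclosed_commute[of m \<beta> j ?X] kempe_commute[of m \<beta> j b]
    by (auto simp: j_def)
  have trcol: "trcol \<beta> j t1 = t1" "trcol \<beta> j t2 = t2" using cond by (auto simp: trcol_def)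
  have R': "leaf_st K F S b c s1 s2 (kswap m \<delta> \<kappa> ?X) \<beta> t1 t2" using sw(1) unfolding eq trcol by simp
  moreover have "\<kappa> \<in> common K S (kswap m \<delta> \<kappa> ?X)"
  proof -
    have "kswap m \<delta> \<kappa> ?X \<kappa> v = v" if v: "v \<in> S" for v
    proof (cases "m \<kappa> v = v")
      case True
      then show ?thesis using v \<delta>(1) dk by (auto simp: kswap_def common_def)
    next
      case False
      then have "v \<in> ?X" using v sw(5) by (auto simp: Y_def)
      then show ?thesis using v \<delta>(1) dk by (simp add: kswap_def common_def del: UN_iff)
    qed
    then show ?thesis using \<kappa> by (simp add: common_def)
  qed
  moreover have "common K S m - {\<delta>} \<subseteq> common K S (kswap m \<delta> \<kappa> ?X)"
    using \<kappa> by (auto simp: common_def kswap_def)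
  moreover have "kswap m \<delta> \<kappa> ?X i b = m i b" "kswap m \<delta> \<kappa> ?X i c = m i c" for i using sw(2,3) unfolding eq by auto
  ultimately show thesis using that[of ?X] sw(6,7) unfolding eq by blast
qed

lemma leaf_st_us:
  assumes C: "leaf_cfg K F S b c u s1 s2" and m: "mcol K F m"
  obtains c1 c2 where "c1 \<in> K" "m c1 u = s1" "m c1 s1 = u" "c2 \<in> K" "m c2 u = s2" "m c2 s2 = u"
    "\<forall>q. q \<in> K \<longrightarrow> m q u = s1 \<longrightarrow> q = c1" "\<forall>q. q \<in> K \<longrightarrow> m q u = s2 \<longrightarrow> q = c2"
proof -
  have e: "{u, s1} \<in> F" "{u, s2} \<in> F" "u \<noteq> s1" "u \<noteq> s2" using C by (auto simp: leaf_cfg_def)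
  obtain c1 where c1: "c1 \<in> K" "m c1 u = s1" using mcol_ex[OF m e(1,3)] by blast
  obtain c2 where c2: "c2 \<in> K" "m c2 u = s2" using mcol_ex[OF m e(2,4)] by blast
  show thesis
    using that[OF c1 mcol_sym[OF m c1] c2 mcol_sym[OF m c2]] mcol_inj[OF m _ c1(1), of _ u] mcol_inj[OF m _ c2(1), of _ u] c1 c2 e
    by metis
qed

text \<open>Both colours are missing on \<open>S\<close>, so nothing changes there, and an edge at
  \<open>u\<close> is only moved from one of them to the other.\<close>

lemma leaf_st_qswap:
  assumes C: "leaf_cfg K F S b c u s1 s2" and R: "leaf_st K F S b c s1 s2 m \<beta> t1 t2"
    and Q: "\<beta> \<in> common K S m" "j \<in> common K S m" "j \<noteq> \<beta>" and Y: "Y \<subseteq> {s1, s2}" "\<forall>x\<in>Y. kend m \<beta> j x"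
  defines "X \<equiv> \<Union>x\<in>Y. kempe m \<beta> j x"
  defines "m' \<equiv> kswap m \<beta> j X"
  shows "leaf_st K F S b c s1 s2 m' \<beta> (if s1 \<in> X then trcol \<beta> j t1 else t1) (if s2 \<in> X then trcol \<beta> j t2 else t2)"
    and "common K S m' = common K S m" and "\<And>i. m' i b = m i b" and "\<And>i. m' i c = m i c"
    and "\<And>y. common_edge K S m u y \<Longrightarrow> common_edge K S m' u y"
    and "Y \<subseteq> X" and "kclosed m \<beta> j X" and "X \<inter> kempe m \<beta> j b = {}"
proof -
  have jK: "j \<in> K" using Q by (simp add: common_def)
  have Y': "\<forall>x\<in>Y. x \<noteq> b \<and> x \<noteq> c \<and> kend m \<beta> j x" using Y C by (auto simp: leaf_cfg_def)
  note sw = leaf_st_swap[OF C R jK Q(3) _ Y', folded X_def, folded m'_def]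
  have cond: "t1 \<notin> {\<beta>, j} \<and> t2 \<notin> {\<beta>, j} \<or> \<beta> \<in> common K S m \<and> j \<in> common K S m" using Q by blast
  show "leaf_st K F S b c s1 s2 m' \<beta> (if s1 \<in> X then trcol \<beta> j t1 else t1) (if s2 \<in> X then trcol \<beta> j t2 else t2)"
    "\<And>i. m' i b = m i b" "\<And>i. m' i c = m i c" "Y \<subseteq> X" "kclosed m \<beta> j X" "X \<inter> kempe m \<beta> j b = {}"
    using sw(1-3,5-7)[OF cond] by auto
  show eq: "common K S m' = common K S m" unfolding m'_def by (rule common_kswap_in[OF Q(1,2)])
  fix y assume "common_edge K S m u y"
  then obtain q where q: "q \<in> common K S m" "m q u = y" by (auto simp: common_edge_def)
  have "m' (if u \<in> X then trcol \<beta> j q else q) u = y" using q by (auto simp: m'_def kswap_trcol)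
  moreover have "(if u \<in> X then trcol \<beta> j q else q) \<in> common K S m'" unfolding eq using q Q by (auto simp: trcol_def)
  ultimately show "common_edge K S m' u y" unfolding common_edge_def by blast
qed

text \<open>\<open>leaf_st_op\<close> may give up \<beta> only if \<beta> is not a witness; a fresh
  colour replaces it. The parameter \<open>x\<close> is a further colour that must not become a
  witness.\<close>

lemma leaf_st_free_leaves:
  assumes C: "leaf_cfg K F S b c u s1 s2" and R: "leaf_st K F S b c s1 s2 m \<beta> t1 t2" and Q: "\<beta> \<in> common K S m"
  obtains m' t1' t2' where "leaf_st K F S b c s1 s2 m' \<beta> t1' t2'" "common K S m' = common K S m"
    "\<forall>i. m' i b = m i b" "\<forall>i. m' i c = m i c" "\<forall>y. common_edge K S m u y \<longrightarrow> common_edge K S m' u y"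
    "t1' \<noteq> \<beta>" "t2' \<noteq> \<beta>" "t1 \<noteq> x \<longrightarrow> t1' \<noteq> x" "t2 \<noteq> x \<longrightarrow> t2' \<noteq> x"
    "m \<beta> u \<notin> {s1, s2} \<longrightarrow> m' \<beta> u \<notin> {s1, s2}"
proof -
  have m: "mcol K F m" using R by (simp add: leaf_st_def)
  obtain c1 c2 where cc: "c1 \<in> K" "m c1 u = s1" "m c1 s1 = u" "c2 \<in> K" "m c2 u = s2" "m c2 s2 = u"
    "\<forall>q. q \<in> K \<longrightarrow> m q u = s1 \<longrightarrow> q = c1" "\<forall>q. q \<in> K \<longrightarrow> m q u = s2 \<longrightarrow> q = c2"
    using leaf_st_us[OF C m] by blast
  \<comment> \<open>Avoiding \<open>c1\<close> and \<open>c2\<close> keeps the change from giving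
    \<beta> to \<open>u s1\<close> or \<open>u s2\<close>.\<close>
  obtain \<kappa> where \<kappa>: "\<kappa> \<in> common K S m" "\<kappa> \<notin> set [\<beta>, t1, t2, c1, c2, x]"
    using leaf_cfg_fresh[OF C m, of "[\<beta>, t1, t2, c1, c2, x]"] by auto
  have \<kappa>K: "\<kappa> \<in> K" "\<kappa> \<noteq> \<beta>" using \<kappa> by (auto simp: common_def)
  define Y where "Y = {s. s = s1 \<and> t1 = \<beta> \<or> s = s2 \<and> t2 = \<beta>}"
  have Y: "Y \<subseteq> {s1, s2}" "\<forall>x\<in>Y. kend m \<beta> \<kappa> x" using R by (auto simp: Y_def kend_def leaf_st_def)
  let ?X = "\<Union>x\<in>Y. kempe m \<beta> \<kappa> x"
  let ?m = "kswap m \<beta> \<kappa> ?X"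
  let ?t1 = "if s1 \<in> ?X then trcol \<beta> \<kappa> t1 else t1" and ?t2 = "if s2 \<in> ?X then trcol \<beta> \<kappa> t2 else t2"
  note sw = leaf_st_qswap[OF C R Q \<kappa>(1) \<kappa>K(2) Y]
  have t: "?t1 = (if t1 = \<beta> then \<kappa> else t1)" "?t2 = (if t2 = \<beta> then \<kappa> else t2)"
    using sw(6) \<kappa> unfolding Y_def trcol_def by auto
  show thesis
  proof (rule that[OF sw(1,2)])
    show "\<forall>i. ?m i b = m i b" "\<forall>i. ?m i c = m i c" using sw(3,4) by auto
    show "\<forall>y. common_edge K S m u y \<longrightarrow> common_edge K S ?m u y" using sw(5) by blast
    show "?t1 \<noteq> \<beta>" "?t2 \<noteq> \<beta>" "t1 \<noteq> x \<longrightarrow> ?t1 \<noteq> x" "t2 \<noteq> x \<longrightarrow> ?t2 \<noteq> x" unfolding t using \<kappa> by auto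
    have "m \<kappa> u \<notin> {s1, s2}" using cc(7,8)[rule_format, OF \<kappa>K(1)] \<kappa>(2) by auto
    then show "m \<beta> u \<notin> {s1, s2} \<longrightarrow> ?m \<beta> u \<notin> {s1, s2}" by (simp add: kswap_def del: UN_iff)
  qed
qed

text \<open>In this state \<beta> can be exchanged for a colour outside \<open>common K S m\<close>:
  it is not a witness, and it is not the colour of \<open>u s1\<close> or
  \<open>u s2\<close>.\<close>

definition leaf_inv :: "nat set \<Rightarrow> 'v set set \<Rightarrow> 'v set \<Rightarrow> 'v \<Rightarrow> 'v \<Rightarrow> 'v \<Rightarrow> 'v \<Rightarrow> 'v \<Rightarrow> (nat \<Rightarrow> 'v \<Rightarrow> 'v) \<Rightarrow> nat \<Rightarrow> nat \<Rightarrow> nat \<Rightarrow> bool" where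
  "leaf_inv K F S b c u s1 s2 m \<beta> t1 t2 \<longleftrightarrow> leaf_st K F S b c s1 s2 m \<beta> t1 t2 \<and> \<beta> \<in> common K S m \<and>
     t1 \<noteq> \<beta> \<and> t2 \<noteq> \<beta> \<and> m \<beta> u \<notin> {s1, s2}"

lemma leaf_inv_sym_s: "leaf_inv K F S b c u s1 s2 m \<beta> t1 t2 \<Longrightarrow> leaf_inv K F S b c u s2 s1 m \<beta> t2 t1"
  and leaf_inv_sym_b: "leaf_inv K F S b c u s1 s2 m \<beta> t1 t2 \<Longrightarrow> leaf_inv K F S c b u s1 s2 m \<beta> t1 t2"
  unfolding leaf_inv_def leaf_st_def by auto

text \<open>As \<open>u s1\<close> has colour \<beta>, the \<beta>/\<open>t1\<close> chain of
  \<open>s1\<close> contains \<open>u\<close>, and the change gives \<beta> to the edge, if any,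
  that had colour \<open>t1\<close> at \<open>u\<close>. Should this be \<open>u s2\<close>, the
  same is done with \<open>t2\<close> at \<open>s2\<close>.\<close>

lemma leaf_st_unbeta:
  assumes C: "leaf_cfg K F S b c u s1 s2" and R: "leaf_st K F S b c s1 s2 m \<beta> t1 t2" and Q: "\<beta> \<in> common K S m"
    and t: "t1 \<noteq> \<beta>" "t2 \<noteq> \<beta>" and us: "m \<beta> u = s1"
  obtains m' t1' t2' where "leaf_st K F S b c s1 s2 m' \<beta> t1' t2'" "common K S m' = common K S m"
    "\<forall>i. m' i b = m i b" "\<forall>i. m' i c = m i c" "\<forall>y. common_edge K S m u y \<longrightarrow> common_edge K S m' u y"
    "m' \<beta> u \<notin> {s1, s2}"
proof -
  have m: "mcol K F m" and r: "t1 \<in> common K S m" "t2 \<in> common K S m" "m t1 s1 = s1" "m t2 s2 = s2"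
    using R by (auto simp: leaf_st_def)
  have K: "t1 \<in> K" "t2 \<in> K" "\<beta> \<in> K" using r Q by (auto simp: common_def)
  have d: "distinct [b, c, u, s1, s2]" using C by (simp add: leaf_cfg_def)
  have us': "m \<beta> s1 = u" using mcol_sym[OF m K(3) us] .
  have Y: "{s1} \<subseteq> {s1, s2}" "\<forall>x\<in>{s1}. kend m \<beta> t1 x" using r by (auto simp: kend_def)
  let ?X = "\<Union>x\<in>{s1}. kempe m \<beta> t1 x"
  let ?m = "kswap m \<beta> t1 ?X"
  note sw = leaf_st_qswap[OF C R Q r(1) t(1) Y]
  have uX: "u \<in> ?X" using kempe_step(1)[of s1 m \<beta> t1 s1] us' by auto
  have v: "?m \<beta> u = m t1 u" using uX by (simp add: kswap_def del: UN_insert UN_iff)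
  have n1: "m t1 u \<noteq> s1" using mcol_sym[OF m K(1), of u s1] r d by auto
  show thesis
  proof (cases "m t1 u = s2")
    case False
    then show thesis using that[OF sw(1,2)] sw(3-5) v n1 by auto
  next
    case True
    have t1s2: "m t1 s2 = u" using mcol_sym[OF m K(1) True] .
    have t12: "t2 \<noteq> t1" using t1s2 r d by auto
    let ?t1 = "if s1 \<in> ?X then trcol \<beta> t1 t1 else t1"
    have R1: "leaf_st K F S b c s1 s2 ?m \<beta> ?t1 t2"
      using sw(1) t(2) t12 by (simp add: trcol_def split: if_splits)
    have Q1: "\<beta> \<in> common K S ?m" "t2 \<in> common K S ?m" using sw(2) Q r by auto
    have v1: "?m t2 = m t2" using t t12 by (auto simp: kswap_def)
    have Y1: "{s2} \<subseteq> {s1, s2}" "\<forall>x\<in>{s2}. kend ?m \<beta> t2 x" using r v1 by (auto simp: kend_def)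
    let ?X' = "\<Union>x\<in>{s2}. kempe ?m \<beta> t2 x"
    let ?n = "kswap ?m \<beta> t2 ?X'"
    note sw' = leaf_st_qswap[OF C R1 Q1 t(2) Y1]
    have m1: "mcol K F ?m" using R1 by (simp add: leaf_st_def)
    have "?m \<beta> u = s2" using v True by simp
    then have "?m \<beta> s2 = u" by (rule mcol_sym[OF m1 K(3)])
    then have uX': "u \<in> ?X'" using kempe_step(1)[of s2 ?m \<beta> t2 s2] by auto
    have "?n \<beta> u = m t2 u" using uX' v1 unfolding kswap_def[of ?m] by (simp del: UN_insert UN_iff)
    moreover have "m t2 u \<noteq> s2" using mcol_sym[OF m K(2), of u s2] r d by auto
    moreover have "m t2 u \<noteq> s1" using mcol_inj[OF m K(2,3), of u] us t d by auto
    ultimately have "?n \<beta> u \<notin> {s1, s2}" by simp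
    then show thesis
      using that[OF sw'(1)] sw'(2-5) sw(2-5) by auto
  qed
qed

text \<open>\<open>leaf_st_unbeta\<close> may turn \<beta> into a witness again, so the witnesses
  are freed both before and after it.\<close>

lemma leaf_st_normalise:
  assumes C: "leaf_cfg K F S b c u s1 s2" and R: "leaf_st K F S b c s1 s2 m \<beta> t1 t2" and Q: "\<beta> \<in> common K S m"
  obtains m' t1' t2' where "leaf_inv K F S b c u s1 s2 m' \<beta> t1' t2'"
    "\<forall>y. common_edge K S m u y \<longrightarrow> common_edge K S m' u y"
proof -
  obtain n t1' t2' where n: "leaf_st K F S b c s1 s2 n \<beta> t1' t2'" "common K S n = common K S m"
    "\<forall>i. n i b = m i b" "\<forall>i. n i c = m i c" "\<forall>y. common_edge K S m u y \<longrightarrow> common_edge K S n u y"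
    "t1' \<noteq> \<beta>" "t2' \<noteq> \<beta>" "t1 \<noteq> \<beta> \<longrightarrow> t1' \<noteq> \<beta>" "t2 \<noteq> \<beta> \<longrightarrow> t2' \<noteq> \<beta>"
    "m \<beta> u \<notin> {s1, s2} \<longrightarrow> n \<beta> u \<notin> {s1, s2}"
    by (rule leaf_st_free_leaves[OF C R Q, where x=\<beta>])
  have Qn: "\<beta> \<in> common K S n" using n Q by simp
  obtain n2 r1 r2 where n2: "leaf_st K F S b c s1 s2 n2 \<beta> r1 r2" "common K S n2 = common K S n"
    "\<forall>y. common_edge K S n u y \<longrightarrow> common_edge K S n2 u y" "n2 \<beta> u \<notin> {s1, s2}"
  proof (cases "n \<beta> u = s1")
    case True
    show thesis by (rule leaf_st_unbeta[OF C n(1) Qn n(6,7) True]) (rule that)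
  next
    case n1: False
    show thesis
    proof (cases "n \<beta> u = s2")
      case True
      show thesis
        by (rule leaf_st_unbeta[OF leaf_cfg_sym_s[OF C] leaf_st_sym_s[OF n(1)] Qn n(7,6) True], rule that)
          (auto dest: leaf_st_sym_s)
    next
      case False
      then show thesis using that[OF n(1)] n1 by auto
    qed
  qed
  have Q2: "\<beta> \<in> common K S n2" using n2 Qn by simp
  obtain n3 q1 q2 where n3: "leaf_st K F S b c s1 s2 n3 \<beta> q1 q2" "common K S n3 = common K S n2"
    "\<forall>i. n3 i b = n2 i b" "\<forall>i. n3 i c = n2 i c" "\<forall>y. common_edge K S n2 u y \<longrightarrow> common_edge K S n3 u y"
    "q1 \<noteq> \<beta>" "q2 \<noteq> \<beta>" "r1 \<noteq> \<beta> \<longrightarrow> q1 \<noteq> \<beta>" "r2 \<noteq> \<beta> \<longrightarrow> q2 \<noteq> \<beta>"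
    "n2 \<beta> u \<notin> {s1, s2} \<longrightarrow> n3 \<beta> u \<notin> {s1, s2}"
    by (rule leaf_st_free_leaves[OF C n2(1) Q2, where x=\<beta>])
  have "leaf_inv K F S b c u s1 s2 n3 \<beta> q1 q2" using n3 n2 Q2 by (auto simp: leaf_inv_def)
  then show thesis by (rule that) (use n3(5) n2(3) n(5) in blast)
qed

text \<open>A \<beta>/\<kappa> change gains \<kappa> but may lose \<beta>; a \<delta>/\<beta> change
  then regains \<beta> at the expense of \<delta>. The detour is taken because
  \<open>leaf_st_op\<close> requires \<beta> to be one of its two colours.\<close>

lemma leaf_st_bring:
  assumes C: "leaf_cfg K F S b c u s1 s2" and R: "leaf_st K F S b c s1 s2 m \<beta> t1 t2" and Q: "\<beta> \<in> common K S m"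
    and t: "t1 \<noteq> \<beta>" "t2 \<noteq> \<beta>" and \<kappa>: "\<kappa> \<in> K" "\<kappa> \<notin> common K S m"
    and \<delta>: "\<delta> \<in> common K S m" "\<delta> \<noteq> t1" "\<delta> \<noteq> t2" "\<delta> \<noteq> \<beta>"
  obtains m' where "leaf_st K F S b c s1 s2 m' \<beta> t1 t2" "\<kappa> \<in> common K S m'" "common K S m - {\<delta>} \<subseteq> common K S m'"
    "\<forall>i. i \<noteq> \<beta> \<longrightarrow> i \<noteq> \<kappa> \<longrightarrow> i \<noteq> \<delta> \<longrightarrow> m' i = m i"
    "\<forall>i. m' i b = m i b" "\<forall>i. m' i c = m i c" "m' \<beta> u \<in> {m \<beta> u, m \<kappa> u, m \<delta> u}"
proof -
  obtain X where X: "leaf_st K F S b c s1 s2 (kswap m \<beta> \<kappa> X) \<beta> t1 t2" "\<kappa> \<in> common K S (kswap m \<beta> \<kappa> X)"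
    "common K S m - {\<beta>} \<subseteq> common K S (kswap m \<beta> \<kappa> X)"
    "\<forall>i. kswap m \<beta> \<kappa> X i b = m i b" "\<forall>i. kswap m \<beta> \<kappa> X i c = m i c"
    "kclosed m \<beta> \<kappa> X" "X \<inter> kempe m \<beta> \<kappa> b = {}"
    by (rule leaf_st_op[OF C R Q t \<kappa>]) simp
  let ?m = "kswap m \<beta> \<kappa> X"
  have \<kappa>\<beta>: "\<kappa> \<noteq> \<beta>" "\<kappa> \<noteq> \<delta>" using \<kappa> Q \<delta> by auto
  show thesis
  proof (cases "\<beta> \<in> common K S ?m")
    case True
    show thesis
    proof (rule that[of ?m])
      show "?m \<beta> u \<in> {m \<beta> u, m \<kappa> u, m \<delta> u}" by (simp add: kswap_def)
    qed (use X True in \<open>auto simp: kswap_def\<close>)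
  next
    case False
    have \<delta>': "\<delta> \<in> common K S ?m" using X(3) \<delta> by auto
    have \<beta>K: "\<beta> \<in> K" using Q by (simp add: common_def)
    obtain Y where Y: "leaf_st K F S b c s1 s2 (kswap ?m \<delta> \<beta> Y) \<beta> t1 t2" "\<beta> \<in> common K S (kswap ?m \<delta> \<beta> Y)"
      "common K S ?m - {\<delta>} \<subseteq> common K S (kswap ?m \<delta> \<beta> Y)"
      "\<forall>i. kswap ?m \<delta> \<beta> Y i b = ?m i b" "\<forall>i. kswap ?m \<delta> \<beta> Y i c = ?m i c"
      "kclosed ?m \<delta> \<beta> Y" "Y \<inter> kempe ?m \<delta> \<beta> b = {}"
      by (rule leaf_st_op[OF C X(1) \<delta>' \<delta>(2,3)[symmetric] \<beta>K False]) simp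
    show thesis
    proof (rule that[of "kswap ?m \<delta> \<beta> Y"])
      show "kswap ?m \<delta> \<beta> Y \<beta> u \<in> {m \<beta> u, m \<kappa> u, m \<delta> u}" using \<kappa>\<beta> \<delta> by (auto simp: kswap_def)
      show "\<kappa> \<in> common K S (kswap ?m \<delta> \<beta> Y)" using X(2) Y(3) \<kappa>\<beta> by auto
      show "common K S m - {\<delta>} \<subseteq> common K S (kswap ?m \<delta> \<beta> Y)" using X(3) Y(2,3) by blast
      show "\<forall>i. i \<noteq> \<beta> \<longrightarrow> i \<noteq> \<kappa> \<longrightarrow> i \<noteq> \<delta> \<longrightarrow> kswap ?m \<delta> \<beta> Y i = m i" by (auto simp: kswap_def)
    qed (use X Y in auto)
  qed
qed

text \<open>All chains used here avoid \<open>b\<close>, so \<open>bu\<close> keeps its colour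
  \<alpha> while \<alpha> is brought into \<open>common K S m\<close>.\<close>

lemma leaf_inv_ensure:
  assumes C: "leaf_cfg K F S b c u s1 s2" and I: "leaf_inv K F S b c u s1 s2 m \<beta> t1 t2"
  obtains m' where "leaf_inv K F S b c u s1 s2 m' \<beta> t1 t2" "common_edge K S m' u b"
    "\<forall>y. y \<in> {c, s1, s2} \<longrightarrow> common_edge K S m u y \<longrightarrow> common_edge K S m' u y"
proof (cases "common_edge K S m u b")
  case True
  then show thesis using that I by blast
next
  case False
  have R: "leaf_st K F S b c s1 s2 m \<beta> t1 t2" and i: "\<beta> \<in> common K S m" "t1 \<noteq> \<beta>" "t2 \<noteq> \<beta>" "m \<beta> u \<notin> {s1, s2}"
    using I by (auto simp: leaf_inv_def)
  have m: "mcol K F m" using R by (simp add: leaf_st_def)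
  have d: "distinct [b, c, u, s1, s2]" and F: "{b, u} \<in> F" "{c, u} \<in> F" using C by (auto simp: leaf_cfg_def)
  obtain \<alpha> where \<alpha>: "\<alpha> \<in> K" "m \<alpha> b = u" using mcol_ex[OF m F(1)] d by auto
  obtain \<gamma> where \<gamma>: "\<gamma> \<in> K" "m \<gamma> c = u" using mcol_ex[OF m F(2)] d by auto
  have \<alpha>': "m \<alpha> u = b" "m \<gamma> u = c" using mcol_sym[OF m \<alpha>] mcol_sym[OF m \<gamma>] by auto
  have \<alpha>Q: "\<alpha> \<notin> common K S m" using False \<alpha>' by (auto simp: common_edge_def)
  obtain c1 c2 where cc: "c1 \<in> K" "m c1 u = s1" "m c1 s1 = u" "c2 \<in> K" "m c2 u = s2" "m c2 s2 = u"
    "\<forall>q. q \<in> K \<longrightarrow> m q u = s1 \<longrightarrow> q = c1" "\<forall>q. q \<in> K \<longrightarrow> m q u = s2 \<longrightarrow> q = c2"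
    by (rule leaf_st_us[OF C m])
  \<comment> \<open>The colour that may be sacrificed must not be that of \<open>u s1\<close>,
    \<open>u s2\<close> or \<open>uc\<close>.\<close>
  obtain \<delta> where \<delta>: "\<delta> \<in> common K S m" "\<delta> \<notin> set [\<beta>, t1, t2, c1, c2, \<gamma>]"
    using leaf_cfg_fresh[OF C m, of "[\<beta>, t1, t2, c1, c2, \<gamma>]"] by auto
  have \<delta>': "\<delta> \<noteq> t1" "\<delta> \<noteq> t2" "\<delta> \<noteq> \<beta>" "\<delta> \<in> K" using \<delta> by (auto simp: common_def)
  obtain m' where m': "leaf_st K F S b c s1 s2 m' \<beta> t1 t2" "\<alpha> \<in> common K S m'" "common K S m - {\<delta>} \<subseteq> common K S m'"
    "\<forall>i. i \<noteq> \<beta> \<longrightarrow> i \<noteq> \<alpha> \<longrightarrow> i \<noteq> \<delta> \<longrightarrow> m' i = m i"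
    "\<forall>i. m' i b = m i b" "\<forall>i. m' i c = m i c" "m' \<beta> u \<in> {m \<beta> u, m \<alpha> u, m \<delta> u}"
    by (rule leaf_st_bring[OF C R i(1-3) \<alpha>(1) \<alpha>Q \<delta>(1) \<delta>'(1-3)])
  have pm': "mcol K F m'" using m'(1) by (simp add: leaf_st_def)
  have "m \<delta> u \<notin> {s1, s2}" using cc(7,8)[rule_format, OF \<delta>'(4)] \<delta>(2) by auto
  then have "m' \<beta> u \<notin> {s1, s2}" using m'(7) i(4) \<alpha>' d by auto
  then have "leaf_inv K F S b c u s1 s2 m' \<beta> t1 t2" using m'(1,3) i \<delta>' by (auto simp: leaf_inv_def)
  moreover have "common_edge K S m' u b"
    using m'(2,5) \<alpha> mcol_sym[OF pm' \<alpha>(1), of b u] by (auto simp: common_edge_def)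
  moreover have "\<forall>y. y \<in> {c, s1, s2} \<longrightarrow> common_edge K S m u y \<longrightarrow> common_edge K S m' u y"
  proof (intro allI impI)
    fix y assume y: "y \<in> {c, s1, s2}" and r: "common_edge K S m u y"
    obtain q where q: "q \<in> common K S m" "m q u = y" using r by (auto simp: common_edge_def)
    have qK: "q \<in> K" using q by (simp add: common_def)
    have q\<delta>: "q \<noteq> \<delta>"
    proof
      assume "q = \<delta>"
      then have "y = c" using q(2) y \<open>m \<delta> u \<notin> {s1, s2}\<close> by auto
      then have "q = \<gamma>" using mcol_inj[OF m qK \<gamma>(1), of u] q(2) \<alpha>' d by auto
      then show False using \<open>q = \<delta>\<close> \<delta>(2) by auto
    qed
    have q\<alpha>: "q \<noteq> \<alpha>" using q \<alpha>Q by auto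
    have qm: "q \<in> common K S m'" using q q\<delta> m'(3) by auto
    show "common_edge K S m' u y"
    proof (cases "q = \<beta>")
      case False
      then have "m' q u = y" using m'(4)[rule_format, OF False q\<alpha> q\<delta>] q by simp
      then show ?thesis using qm by (auto simp: common_edge_def)
    next
      case True
      have "m \<beta> c = c" using R by (auto simp: leaf_st_def misses1_def)
      then have "y \<noteq> c" using mcol_sym[OF m qK q(2)] True d by auto
      then show ?thesis using y q True i(4) by auto
    qed
  qed
  ultimately show thesis by (rule that)
qed

text \<open>Unlike \<open>bu\<close>, the edge \<open>u s1\<close> may change its colour when
  \<sigma> is brought in. If it keeps \<sigma>, a lost \<beta> is regained at the expense of a fresh
  \<delta>. If it takes \<beta>, then \<beta> is regained at the expense of \<alpha>: the
  \<alpha>/\<beta> chain of \<open>b\<close> contains \<open>u\<close>, so this change does not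
  touch \<open>u s1\<close>.\<close>

lemma leaf_inv_fix:
  assumes C: "leaf_cfg K F S b c u s1 s2" and I: "leaf_inv K F S b c u s1 s2 m \<beta> t1 t2" and \<alpha>r: "common_edge K S m u b"
  obtains m' t1' t2' where "leaf_inv K F S b c u s1 s2 m' \<beta> t1' t2'" "common_edge K S m' u s1"
    "common_edge K S m u s2 \<longrightarrow> common_edge K S m' u s2"
proof (cases "common_edge K S m u s1")
  case True
  then show thesis using that I by blast
next
  case nr: False
  have d: "distinct [b, c, u, s1, s2]" and F: "{b, u} \<in> F" using C by (auto simp: leaf_cfg_def)
  have R0: "leaf_st K F S b c s1 s2 m \<beta> t1 t2" and i0: "\<beta> \<in> common K S m" "t1 \<noteq> \<beta>" "t2 \<noteq> \<beta>" "m \<beta> u \<notin> {s1, s2}"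
    using I by (auto simp: leaf_inv_def)
  have p0: "mcol K F m" using R0 by (simp add: leaf_st_def)
  obtain \<alpha> where \<alpha>0: "\<alpha> \<in> common K S m" "m \<alpha> u = b" using \<alpha>r by (auto simp: common_edge_def)
  have \<alpha>K: "\<alpha> \<in> K" and \<beta>K: "\<beta> \<in> K" using \<alpha>0 i0 by (auto simp: common_def)
  have \<alpha>b0: "m \<alpha> b = u" using mcol_sym[OF p0 \<alpha>K \<alpha>0(2)] .
  have \<alpha>\<beta>: "\<alpha> \<noteq> \<beta>" using \<alpha>b0 R0 d by (auto simp: leaf_st_def misses1_def)
  \<comment> \<open>The colour \<open>\<alpha>\<close> of \<open>bu\<close> may be given up below, so \<open>s1\<close> and \<open>s2\<close> must not rely on it.\<close>
  obtain n r1 r2 where n: "leaf_inv K F S b c u s1 s2 n \<beta> r1 r2" "r1 \<noteq> \<alpha>" "r2 \<noteq> \<alpha>" "common K S n = common K S m"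
    "n \<alpha> b = u" "common_edge K S m u s2 \<longrightarrow> common_edge K S n u s2"
  proof -
    define Y where "Y = {s. s = s1 \<and> t1 = \<alpha> \<or> s = s2 \<and> t2 = \<alpha>}"
    have Y: "Y \<subseteq> {s1, s2}" "\<forall>x\<in>Y. kend m \<beta> \<alpha> x" using R0 by (auto simp: Y_def kend_def leaf_st_def)
    let ?X = "\<Union>x\<in>Y. kempe m \<beta> \<alpha> x"
    let ?m = "kswap m \<beta> \<alpha> ?X"
    let ?t1 = "if s1 \<in> ?X then trcol \<beta> \<alpha> t1 else t1" and ?t2 = "if s2 \<in> ?X then trcol \<beta> \<alpha> t2 else t2"
    note sw = leaf_st_qswap[OF C R0 i0(1) \<alpha>0(1) \<alpha>\<beta> Y]
    have t: "?t1 \<noteq> \<alpha>" "?t2 \<noteq> \<alpha>" using sw(6) \<alpha>\<beta> i0 unfolding Y_def trcol_def by auto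
    have "u \<in> kempe m \<beta> \<alpha> b" using kempe_step(2)[of b m \<beta> \<alpha> b] \<alpha>b0 by auto
    then have "u \<notin> ?X" using sw(8) by blast
    then have us: "?m \<beta> u \<notin> {s1, s2}" using i0(4) by (simp add: kswap_def del: UN_iff)
    have Q: "\<beta> \<in> common K S ?m" using sw(2) i0 by simp
    obtain n r1 r2 where n: "leaf_st K F S b c s1 s2 n \<beta> r1 r2" "common K S n = common K S ?m"
      "\<forall>i. n i b = ?m i b" "\<forall>i. n i c = ?m i c" "\<forall>y. common_edge K S ?m u y \<longrightarrow> common_edge K S n u y"
      "r1 \<noteq> \<beta>" "r2 \<noteq> \<beta>" "?t1 \<noteq> \<alpha> \<longrightarrow> r1 \<noteq> \<alpha>" "?t2 \<noteq> \<alpha> \<longrightarrow> r2 \<noteq> \<alpha>"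
      "?m \<beta> u \<notin> {s1, s2} \<longrightarrow> n \<beta> u \<notin> {s1, s2}"
      by (rule leaf_st_free_leaves[OF C sw(1) Q, where x=\<alpha>])
    show thesis
    proof (rule that[of n r1 r2])
      show "leaf_inv K F S b c u s1 s2 n \<beta> r1 r2" using n us Q by (auto simp: leaf_inv_def)
      show "r1 \<noteq> \<alpha>" "r2 \<noteq> \<alpha>" using n(8,9) t by blast+
      show "common K S n = common K S m" using n(2) sw(2) by simp
      show "n \<alpha> b = u" using n(3) sw(3) \<alpha>b0 by simp
      show "common_edge K S m u s2 \<longrightarrow> common_edge K S n u s2" using n(5) sw(5) by blast
    qed
  qed
  show thesis
  proof (cases "common_edge K S n u s1")
    case True
    then show thesis using that n by blast
  next
    case nr: False
    have R: "leaf_st K F S b c s1 s2 n \<beta> r1 r2" and i: "\<beta> \<in> common K S n" "r1 \<noteq> \<beta>" "r2 \<noteq> \<beta>" "n \<beta> u \<notin> {s1, s2}"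
      using n by (auto simp: leaf_inv_def)
    have p: "mcol K F n" using R by (simp add: leaf_st_def)
    have \<alpha>Q: "\<alpha> \<in> common K S n" using n \<alpha>0 by simp
    have \<alpha>u: "n \<alpha> u = b" using mcol_sym[OF p \<alpha>K n(5)] .
    obtain \<sigma> c2 where cc: "\<sigma> \<in> K" "n \<sigma> u = s1" "n \<sigma> s1 = u" "c2 \<in> K" "n c2 u = s2" "n c2 s2 = u"
      "\<forall>q. q \<in> K \<longrightarrow> n q u = s1 \<longrightarrow> q = \<sigma>" "\<forall>q. q \<in> K \<longrightarrow> n q u = s2 \<longrightarrow> q = c2"
      by (rule leaf_st_us[OF C p])
    have \<sigma>Q: "\<sigma> \<notin> common K S n" using nr cc(2) by (auto simp: common_edge_def)
    have ne: "\<sigma> \<noteq> \<beta>" "\<sigma> \<noteq> \<alpha>" "c2 \<noteq> \<alpha>" "c2 \<noteq> \<beta>" "c2 \<noteq> \<sigma>" using \<sigma>Q i \<alpha>Q cc(2,5) \<alpha>u d by auto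
    obtain X where X: "leaf_st K F S b c s1 s2 (kswap n \<beta> \<sigma> X) \<beta> r1 r2" "\<sigma> \<in> common K S (kswap n \<beta> \<sigma> X)"
      "common K S n - {\<beta>} \<subseteq> common K S (kswap n \<beta> \<sigma> X)"
      "\<forall>i. kswap n \<beta> \<sigma> X i b = n i b" "\<forall>i. kswap n \<beta> \<sigma> X i c = n i c"
      "kclosed n \<beta> \<sigma> X" "X \<inter> kempe n \<beta> \<sigma> b = {}"
      by (rule leaf_st_op[OF C R i(1-3) cc(1) \<sigma>Q]) simp
    let ?m = "kswap n \<beta> \<sigma> X"
    have m1: "mcol K F ?m" using X(1) by (simp add: leaf_st_def)
    have c2': "?m c2 u = s2" "common_edge K S n u s2 \<Longrightarrow> c2 \<in> common K S n"
    proof -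
      show "?m c2 u = s2" using cc(5) ne by (simp add: kswap_def)
      assume "common_edge K S n u s2"
      then obtain q where q: "q \<in> common K S n" "n q u = s2" by (auto simp: common_edge_def)
      then have "q = c2" using cc(8) by (simp add: common_def)
      then show "c2 \<in> common K S n" using q by simp
    qed
    show thesis
    proof (cases "u \<in> X")
      case False
      have v: "?m \<sigma> u = s1" "?m \<beta> u \<notin> {s1, s2}" using False cc(2) i by (auto simp: kswap_def)
      show thesis
      proof (cases "\<beta> \<in> common K S ?m")
        case True
        have "leaf_inv K F S b c u s1 s2 ?m \<beta> r1 r2" using X(1) True i v by (auto simp: leaf_inv_def)
        moreover have "common_edge K S ?m u s1" using X(2) v by (auto simp: common_edge_def)
        moreover have "common_edge K S m u s2 \<longrightarrow> common_edge K S ?m u s2"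
          using n(6) c2' X(3) ne unfolding common_edge_def[of K S ?m] by blast
        ultimately show thesis by (rule that)
      next
        case False
        obtain \<delta> where \<delta>: "\<delta> \<in> common K S n" "\<delta> \<notin> set [\<beta>, r1, r2, c2]"
          using leaf_cfg_fresh[OF C p, of "[\<beta>, r1, r2, c2]"] by auto
        have \<delta>': "\<delta> \<in> common K S ?m" "r1 \<noteq> \<delta>" "r2 \<noteq> \<delta>" "\<delta> \<noteq> \<sigma>" "\<delta> \<noteq> c2" "\<delta> \<noteq> \<beta>" "\<delta> \<in> K"
          using \<delta> X(3) \<sigma>Q by (auto simp: common_def)
        obtain Z where Z: "leaf_st K F S b c s1 s2 (kswap ?m \<delta> \<beta> Z) \<beta> r1 r2" "\<beta> \<in> common K S (kswap ?m \<delta> \<beta> Z)"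
          "common K S ?m - {\<delta>} \<subseteq> common K S (kswap ?m \<delta> \<beta> Z)"
          "\<forall>i. kswap ?m \<delta> \<beta> Z i b = ?m i b" "\<forall>i. kswap ?m \<delta> \<beta> Z i c = ?m i c"
          "kclosed ?m \<delta> \<beta> Z" "Z \<inter> kempe ?m \<delta> \<beta> b = {}"
          by (rule leaf_st_op[OF C X(1) \<delta>'(1-3) \<beta>K False]) simp
        let ?k = "kswap ?m \<delta> \<beta> Z"
        have "?m \<delta> u \<notin> {s1, s2}"
          using cc(7,8)[rule_format, OF \<delta>'(7)] \<delta>' by (auto simp: kswap_def)
        then have "?k \<beta> u \<notin> {s1, s2}" using v(2) \<delta>'(6) unfolding kswap_def[of ?m] by auto
        then have "leaf_inv K F S b c u s1 s2 ?k \<beta> r1 r2" using Z(1,2) i by (auto simp: leaf_inv_def)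
        moreover have "?k \<sigma> u = s1" "?k c2 u = s2"
          using v(1) c2'(1) \<delta>' ne unfolding kswap_def[of ?m] by auto
        moreover have "\<sigma> \<in> common K S ?k" "common_edge K S n u s2 \<Longrightarrow> c2 \<in> common K S ?k"
          using X(2,3) Z(3) \<delta>' c2'(2) ne by blast+
        ultimately show thesis using that[of ?k r1 r2] n(6) unfolding common_edge_def[of K S ?k] by blast
      qed
    next
      case True
      have v: "?m \<beta> u = s1" using True cc(2) ne by (auto simp: kswap_def)
      have s2Q: "c2 \<in> common K S ?m" if "common_edge K S n u s2" using that c2' X(3) ne by blast
      obtain k where k: "leaf_st K F S b c s1 s2 k \<beta> r1 r2" "\<beta> \<in> common K S k" "k \<beta> u = s1"
          "common_edge K S n u s2 \<longrightarrow> common_edge K S k u s2"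
      proof (cases "\<beta> \<in> common K S ?m")
        case True
        show thesis using that[OF X(1) True v] s2Q c2'(1) unfolding common_edge_def[of K S ?m] by blast
      next
        case False
        have \<alpha>m: "\<alpha> \<in> common K S ?m" using X(3) \<alpha>Q \<alpha>\<beta> by blast
        obtain Z where Z: "leaf_st K F S b c s1 s2 (kswap ?m \<alpha> \<beta> Z) \<beta> r1 r2" "\<beta> \<in> common K S (kswap ?m \<alpha> \<beta> Z)"
          "common K S ?m - {\<alpha>} \<subseteq> common K S (kswap ?m \<alpha> \<beta> Z)"
          "\<forall>i. kswap ?m \<alpha> \<beta> Z i b = ?m i b" "\<forall>i. kswap ?m \<alpha> \<beta> Z i c = ?m i c"
          "kclosed ?m \<alpha> \<beta> Z" "Z \<inter> kempe ?m \<alpha> \<beta> b = {}"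
          by (rule leaf_st_op[OF C X(1) \<alpha>m n(2,3) \<beta>K False]) simp
        let ?k = "kswap ?m \<alpha> \<beta> Z"
        have "?m \<alpha> b = u" using X(4) n(5) by simp
        then have "u \<in> kempe ?m \<alpha> \<beta> b" using kempe_step(1)[of b ?m \<alpha> \<beta> b] by simp
        then have "u \<notin> Z" using Z(7) by blast
        then have w: "?k \<beta> u = s1" "?k c2 u = s2" using v c2'(1) unfolding kswap_def[of ?m] by auto
        show thesis using that[OF Z(1,2) w(1)] w(2) s2Q Z(3) ne unfolding common_edge_def[of K S ?k] by blast
      qed
      have ks1: "common_edge K S k u s1" using k by (auto simp: common_edge_def)
      obtain l q1 q2 where l: "leaf_inv K F S b c u s1 s2 l \<beta> q1 q2" "\<forall>y. common_edge K S k u y \<longrightarrow> common_edge K S l u y"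
        by (rule leaf_st_normalise[OF C k(1,2)])
      show thesis using that[OF l(1)] l(2) ks1 k(4) n(6) by blast
    qed
  qed
qed

text \<open>The order matters. \<open>leaf_inv_fix\<close> needs \<open>bu\<close> as a common edge
  and may lose it, and it promises nothing for \<open>cu\<close>, whereas
  \<open>leaf_inv_ensure\<close> keeps the other three edges. So \<open>bu\<close> is restored after
  each use of \<open>leaf_inv_fix\<close>, and \<open>cu\<close> comes last.\<close>

lemma leaf_cfg_False:
  assumes C: "leaf_cfg K F S b c u s1 s2" and m: "mcol K F m"
    and t: "t1 \<in> common K S m" "t2 \<in> common K S m" "m t1 s1 = s1" "m t2 s2 = s2"
  shows False
proof -
  note Cs = leaf_cfg_sym_s[OF C] and Cb = leaf_cfg_sym_b[OF C]
  obtain \<beta> where \<beta>: "misses1 K m b \<beta>" "misses1 K m c \<beta>" using leaf_cfg_misses1[OF C m t] by blast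
  have \<beta>K: "\<beta> \<in> K" using \<beta> by (simp add: misses1_def)
  have R: "leaf_st K F S b c s1 s2 m \<beta> t1 t2" using m \<beta> t by (simp add: leaf_st_def)
  obtain m0 where m0: "leaf_st K F S b c s1 s2 m0 \<beta> t1 t2" "\<beta> \<in> common K S m0"
  proof (cases "\<beta> \<in> common K S m")
    case True then show thesis using that R by blast
  next
    case False
    obtain \<delta> where \<delta>: "\<delta> \<in> common K S m" "\<delta> \<notin> set [t1, t2]"
      using leaf_cfg_fresh[OF C m, of "[t1, t2]"] by auto
    show thesis
      by (rule leaf_st_op[OF C R \<delta>(1) _ _ \<beta>K False]) (use \<delta> that in auto)
  qed
  obtain m1 p1 p2 where m1: "leaf_inv K F S b c u s1 s2 m1 \<beta> p1 p2" "\<forall>y. common_edge K S m0 u y \<longrightarrow> common_edge K S m1 u y"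
    by (rule leaf_st_normalise[OF C m0])
  obtain m2 where m2: "leaf_inv K F S b c u s1 s2 m2 \<beta> p1 p2" "common_edge K S m2 u b"
      "\<forall>y. y \<in> {c, s1, s2} \<longrightarrow> common_edge K S m1 u y \<longrightarrow> common_edge K S m2 u y"
    by (rule leaf_inv_ensure[OF C m1(1)])
  obtain m3 q1 q2 where m3: "leaf_inv K F S b c u s1 s2 m3 \<beta> q1 q2" "common_edge K S m3 u s1"
      "common_edge K S m2 u s2 \<longrightarrow> common_edge K S m3 u s2"
    by (rule leaf_inv_fix[OF C m2(1,2)])
  obtain m4 where m4: "leaf_inv K F S b c u s1 s2 m4 \<beta> q1 q2" "common_edge K S m4 u b"
      "\<forall>y. y \<in> {c, s1, s2} \<longrightarrow> common_edge K S m3 u y \<longrightarrow> common_edge K S m4 u y"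
    by (rule leaf_inv_ensure[OF C m3(1)])
  obtain m5 r2 r1 where m5: "leaf_inv K F S b c u s2 s1 m5 \<beta> r2 r1" "common_edge K S m5 u s2"
      "common_edge K S m4 u s1 \<longrightarrow> common_edge K S m5 u s1"
    by (rule leaf_inv_fix[OF Cs leaf_inv_sym_s[OF m4(1)] m4(2)])
  have s1: "common_edge K S m5 u s1" using m3(2) m4(3) m5(3) by blast
  obtain m6 where m6: "leaf_inv K F S b c u s1 s2 m6 \<beta> r1 r2" "common_edge K S m6 u b"
      "\<forall>y. y \<in> {c, s1, s2} \<longrightarrow> common_edge K S m5 u y \<longrightarrow> common_edge K S m6 u y"
    by (rule leaf_inv_ensure[OF C leaf_inv_sym_s[OF m5(1)]])
  obtain m7 where m7: "leaf_inv K F S c b u s1 s2 m7 \<beta> r1 r2" "common_edge K S m7 u c"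
      "\<forall>y. y \<in> {b, s1, s2} \<longrightarrow> common_edge K S m6 u y \<longrightarrow> common_edge K S m7 u y"
    by (rule leaf_inv_ensure[OF Cb leaf_inv_sym_b[OF m6(1)]])
  have "common_edge K S m7 u y" if "y \<in> {b, c, s1, s2}" for y
    using that m7(2,3) m6(2,3) m5(2) s1 by blast
  then have "\<And>x. x \<in> {c, b, s1, s2} \<Longrightarrow> \<exists>q\<in>common K S m7. m7 q u = x" by (auto simp: common_edge_def)
  then show False
    using leaf_cfg_contradiction[OF Cb, of m7 \<beta> r1 r2] m7(1) by (auto simp: leaf_inv_def)
qed

subsection \<open>Complementary missing colours\<close>

text \<open>This holds for a full-deficiency pair whose edge is uncoloured: \<open>a\<close> and
  \<open>b\<close> miss \<Delta> colours altogether and no colour in common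
  (\<open>pairwI\<close>).\<close>

definition compl_pair :: "nat set \<Rightarrow> 'v set set \<Rightarrow> 'v \<Rightarrow> 'v \<Rightarrow> bool" where
  "compl_pair K F a b \<longleftrightarrow> fin_graph F \<and> a \<noteq> b \<and> (\<forall>m. mcol K F m \<longrightarrow> (\<forall>i\<in>K. m i a = a \<longleftrightarrow> m i b \<noteq> b))"

lemma compl_pair_iff: "compl_pair K F a b \<Longrightarrow> mcol K F m \<Longrightarrow> i \<in> K \<Longrightarrow> m i a = a \<longleftrightarrow> m i b \<noteq> b"
  unfolding compl_pair_def by blast

text \<open>\<open>a\<close> and \<open>b\<close> are the two ends of one
  \<open>p\<close>/\<open>q\<close> chain, since a change on the chain of \<open>b\<close> alone
  would leave \<open>p\<close> missing at both. The chain of any other end is disjoint from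
  it.\<close>

lemma compl_pair_swap:
  assumes T: "compl_pair K F a b" and m: "mcol K F m"
    and pq: "p \<in> K" "q \<in> K" "m p b \<noteq> b" "m q b = b" and x: "x \<noteq> a" "x \<noteq> b" "m p x = x \<or> m q x = x"
  obtains X where "mcol K F (kswap m p q X)" "\<forall>i. kswap m p q X i b = m i b" "x \<in> X" "kclosed m p q X"
    "X \<inter> kempe m p q b = {}" "\<forall>i. i \<noteq> p \<longrightarrow> i \<noteq> q \<longrightarrow> kswap m p q X i = m i"
proof -
  let ?X = "kempe m p q x"
  have ab: "a \<noteq> b" "fin_graph F" using T by (auto simp: compl_pair_def)
  have pa: "m p a = a" using compl_pair_iff[OF T m pq(1)] pq(3) by simp
  have l: "a \<in> kempe m p q b"
  proof (rule ccontr)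
    assume n: "a \<notin> kempe m p q b"
    let ?m = "kswap m p q (kempe m p q b)"
    have c: "mcol K F ?m" using mcol_kswap[OF m pq(1,2)] by simp
    have "?m p b = b" using pq by (simp add: kswap_def)
    moreover have "?m p a = a" using pa n by (simp add: kswap_def)
    ultimately show False using compl_pair_iff[OF T c pq(1)] by simp
  qed
  have b: "b \<notin> ?X"
  proof
    assume "b \<in> ?X"
    then have eq: "kempe m p q b = kempe m p q x" using kempe_sym[OF m pq(1,2)] by blast
    show False
      by (rule three_ends[OF m ab(2) pq(1,2), of x b b a])
        (use eq l x ab pa pq in \<open>auto simp: kend_def\<close>)
  qed
  have dis: "?X \<inter> kempe m p q b = {}"
  proof (rule ccontr)
    assume "\<not> ?thesis"
    then obtain z where "z \<in> kempe m p q x" "z \<in> kempe m p q b" by blast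
    then have "kempe m p q x = kempe m p q b" using kempe_sym[OF m pq(1,2)] by metis
    then show False using b by auto
  qed
  show thesis
    by (rule that[of ?X]) (use mcol_kswap[OF m pq(1,2)] b dis in \<open>auto simp: kswap_def\<close>)
qed

text \<open>If \<open>b\<close> misses \<delta> too, moving \<open>bu\<close> to \<delta> makes
  \<alpha> missing at both \<open>a\<close> and \<open>b\<close>. Otherwise a \<delta>/\<beta>
  change at \<open>u\<close> first replaces \<delta> by \<beta>.\<close>

lemma compl_pair_nbr_full:
  assumes T: "compl_pair K F a b" and m: "mcol K F m" and \<alpha>: "\<alpha> \<in> K" "m \<alpha> b = u" "u \<noteq> a" "u \<noteq> b"
    and \<delta>: "\<delta> \<in> K" "m \<delta> u = u" and \<beta>: "\<beta> \<in> K" "m \<beta> b = b"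
  shows False
proof -
  have *: False if m: "mcol K F m" and \<alpha>b: "m \<alpha> b = u" and \<delta>: "\<delta> \<in> K" "m \<delta> u = u" "m \<delta> b = b" for m \<delta>
  proof -
    have bu: "{b, u} \<in> F" using mcol_edge[OF m \<alpha>(1), of b] \<alpha>b \<alpha> by auto
    have \<alpha>\<delta>: "\<alpha> \<noteq> \<delta>" using \<alpha>b \<delta> \<alpha> by auto
    let ?m = "uncolour m \<alpha> b u"
    have "mcol K (F - {{b, u}}) ?m" using mcol_uncolour[OF m \<alpha>(1) \<alpha>b] \<alpha> by auto
    then have p: "mcol K F (colour_edge ?m \<delta> b u)" using \<delta> \<alpha> bu by (intro mcol_colour_edge') (auto simp: uncolour_simps)
    have "m \<alpha> a = a" using compl_pair_iff[OF T m \<alpha>(1)] \<alpha>b \<alpha> by auto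
    then have "colour_edge ?m \<delta> b u \<alpha> a = a" "colour_edge ?m \<delta> b u \<alpha> b = b"
      using \<alpha> \<alpha>\<delta> T by (auto simp: colour_edge_simps uncolour_simps compl_pair_def)
    then show False using compl_pair_iff[OF T p \<alpha>(1)] by simp
  qed
  show False
  proof (cases "m \<delta> b = b")
    case True then show False using * m \<alpha> \<delta> by blast
  next
    case False
    obtain X where X: "mcol K F (kswap m \<delta> \<beta> X)" "\<forall>i. kswap m \<delta> \<beta> X i b = m i b" "u \<in> X" "kclosed m \<delta> \<beta> X"
      "X \<inter> kempe m \<delta> \<beta> b = {}" "\<forall>i. i \<noteq> \<delta> \<longrightarrow> i \<noteq> \<beta> \<longrightarrow> kswap m \<delta> \<beta> X i = m i"
      by (rule compl_pair_swap[OF T m \<delta>(1) \<beta>(1) False \<beta>(2) \<alpha>(3,4) disjI1[OF \<delta>(2)]])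
    have "kswap m \<delta> \<beta> X \<beta> u = u" using X(3) \<delta> by (simp add: kswap_def)
    then show False using *[OF X(1) _ \<beta>(1)] X(2) \<alpha> \<beta> by simp
  qed
qed

text \<open>\<open>B\<close> holds the colours missing at \<open>b\<close>. In the position
  \<open>T4\<close>, \<open>ux\<close> has a colour \<gamma> of \<open>B\<close> and \<alpha> is
  missing at \<open>x\<close>; moving \<open>ux\<close> to \<alpha> and \<open>bu\<close> to
  \<gamma> makes \<alpha> missing at \<open>a\<close> and \<open>b\<close>. A second colour of
  \<open>B\<close> allows changes at \<open>x\<close> that leave \<gamma> alone.\<close>

lemma compl_pair_path4:
  assumes T: "compl_pair K F a b" and m: "mcol K F m" and d: "distinct [a, b, u, x]"
    and F: "{b, u} \<in> F" "{u, x} \<in> F"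
    and \<beta>: "\<beta>1 \<in> K" "m \<beta>1 b = b" "\<beta>2 \<in> K" "m \<beta>2 b = b" "\<beta>1 \<noteq> \<beta>2"
    and \<delta>: "\<delta> \<in> K" "m \<delta> x = x"
  shows False
proof -
  obtain \<alpha> where \<alpha>: "\<alpha> \<in> K" "m \<alpha> b = u" using mcol_ex[OF m F(1)] d by auto
  define B where "B = {i\<in>K. m i b = b}"
  have xab: "x \<noteq> a" "x \<noteq> b" using d by auto
  define ok where "ok = (\<lambda>n. mcol K F n \<and> (\<forall>i. n i b = m i b))"
  have okm: "ok m" using m by (simp add: ok_def)
  have sw: "\<exists>X. ok (kswap n p q X) \<and> x \<in> X \<and> kclosed n p q X \<and> (\<forall>i. i \<noteq> p \<longrightarrow> i \<noteq> q \<longrightarrow> kswap n p q X i = n i)"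
    if n: "ok n" and pq: "p \<in> K" "p \<notin> B" "q \<in> B" and x: "n p x = x \<or> n q x = x" for n p q
  proof -
    have n': "mcol K F n" "n p b \<noteq> b" "n q b = b" "q \<in> K" using n pq by (auto simp: ok_def B_def)
    show ?thesis
      by (rule compl_pair_swap[OF T n'(1) pq(1) n'(4,2,3) xab x]) (use n in \<open>auto simp: ok_def\<close>)
  qed
  have \<alpha>B: "\<alpha> \<notin> B" using \<alpha> d by (auto simp: B_def)
  have BK: "i \<in> K" if "i \<in> B" for i using that by (simp add: B_def)
  have other: "\<exists>\<beta>'\<in>B. \<beta>' \<noteq> \<beta>" for \<beta> using \<beta> by (auto simp: B_def)
  have T4: False if n: "ok n" and \<gamma>: "\<gamma> \<in> B" "n \<gamma> u = x" and \<alpha>x: "n \<alpha> x = x" for n \<gamma>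
  proof -
    have pn: "mcol K F n" and nbrs: "n \<alpha> b = u" "n \<gamma> b = b" "\<gamma> \<in> K" using n \<alpha> \<gamma> by (auto simp: ok_def B_def)
    have \<alpha>\<gamma>: "\<alpha> \<noteq> \<gamma>" using \<alpha>B \<gamma> by auto
    let ?m = "uncolour n \<alpha> b u"
    have m0: "mcol K (F - {{b, u}}) ?m" using mcol_uncolour[OF pn \<alpha>(1) nbrs(1)] d by auto
    let ?n = "recolour ?m \<gamma> \<alpha> u x"
    have m1: "mcol K (F - {{b, u}}) ?n" using m0 nbrs \<alpha> \<alpha>x \<gamma> d \<alpha>\<gamma> by (intro mcol_recolour) (auto simp: uncolour_simps)
    have m2: "mcol K F (colour_edge ?n \<gamma> b u)" using m1 nbrs \<alpha>\<gamma> d F(1)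
      by (intro mcol_colour_edge') (auto simp: recolour_simps uncolour_simps)
    have "n \<alpha> a = a" using compl_pair_iff[OF T pn \<alpha>(1)] nbrs d by auto
    then have "colour_edge ?n \<gamma> b u \<alpha> a = a" "colour_edge ?n \<gamma> b u \<alpha> b = b"
      using \<alpha>\<gamma> d by (auto simp: colour_edge_simps recolour_simps uncolour_simps)
    then show False using compl_pair_iff[OF T m2 \<alpha>(1)] by simp
  qed
  have F4b: False if n: "ok n" and \<gamma>: "\<gamma> \<in> B" "n \<gamma> u = x" and \<delta>: "\<delta> \<in> B" "n \<delta> x = x" for n \<gamma> \<delta>
  proof -
    have ne: "\<alpha> \<noteq> \<gamma>" "\<alpha> \<noteq> \<delta>" using \<alpha>B \<gamma> \<delta> by auto
    have "n \<gamma> x = u" using mcol_sym[of K F n \<gamma> u x] n \<gamma> BK by (auto simp: ok_def)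
    then have \<gamma>\<delta>: "\<gamma> \<noteq> \<delta>" using \<delta> d by auto
    obtain X where X: "ok (kswap n \<alpha> \<delta> X)" "x \<in> X" "\<forall>i. i \<noteq> \<alpha> \<longrightarrow> i \<noteq> \<delta> \<longrightarrow> kswap n \<alpha> \<delta> X i = n i"
      using sw[OF n \<alpha>(1) \<alpha>B \<delta>(1)] \<delta>(2) by blast
    have "kswap n \<alpha> \<delta> X \<alpha> x = x" using X(2) \<delta> by (simp add: kswap_def)
    moreover have "kswap n \<alpha> \<delta> X \<gamma> u = x" using X(3) \<gamma> \<gamma>\<delta> ne by auto
    ultimately show False using T4[OF X(1) \<gamma>(1)] by blast
  qed
  have F4a: False if n: "ok n" and \<gamma>: "\<gamma> \<in> B" "n \<gamma> u = x" and \<delta>: "\<delta> \<in> K" "n \<delta> x = x" for n \<gamma> \<delta>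
  proof (cases "\<delta> \<in> B")
    case True then show False using F4b[OF n \<gamma>] \<delta> by blast
  next
    case False
    obtain \<beta>' where \<beta>': "\<beta>' \<in> B" "\<beta>' \<noteq> \<gamma>" using other by blast
    obtain X where X: "ok (kswap n \<delta> \<beta>' X)" "x \<in> X" "\<forall>i. i \<noteq> \<delta> \<longrightarrow> i \<noteq> \<beta>' \<longrightarrow> kswap n \<delta> \<beta>' X i = n i"
      using sw[OF n \<delta>(1) False \<beta>'(1)] \<delta>(2) by blast
    have "kswap n \<delta> \<beta>' X \<beta>' x = x" using X(2) \<delta> by (simp add: kswap_def)
    moreover have "kswap n \<delta> \<beta>' X \<gamma> u = x" using X(3) \<gamma> \<beta>' False by auto
    ultimately show False using F4b[OF X(1) \<gamma>(1) _ \<beta>'(1)] by blast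
  qed
  obtain \<gamma> where \<gamma>: "\<gamma> \<in> K" "m \<gamma> u = x" using mcol_ex[OF m F(2)] d by auto
  show False
  proof (cases "\<gamma> \<in> B")
    case True then show False using F4a[OF okm True \<gamma>(2) \<delta>] by blast
  next
    case False
    have "\<exists>n \<beta>. ok n \<and> \<beta> \<in> B \<and> n \<beta> x = x \<and> n \<gamma> u = x"
    proof (cases "\<delta> \<in> B")
      case True then show ?thesis using okm \<delta> \<gamma> by blast
    next
      case n: False
      have \<gamma>\<delta>: "\<gamma> \<noteq> \<delta>" using mcol_sym[OF m \<gamma>] \<delta> d by auto
      have b1: "\<beta>1 \<in> B" using \<beta> by (simp add: B_def)
      obtain X where X: "ok (kswap m \<delta> \<beta>1 X)" "x \<in> X" "\<forall>i. i \<noteq> \<delta> \<longrightarrow> i \<noteq> \<beta>1 \<longrightarrow> kswap m \<delta> \<beta>1 X i = m i"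
        using sw[OF okm \<delta>(1) n b1] \<delta>(2) by blast
      have "kswap m \<delta> \<beta>1 X \<beta>1 x = x" using X(2) \<delta> by (simp add: kswap_def)
      moreover have "kswap m \<delta> \<beta>1 X \<gamma> u = x" using X(3) \<gamma> \<gamma>\<delta> b1 False by auto
      ultimately show ?thesis using X(1) b1 by blast
    qed
    then obtain n \<beta> where n: "ok n" "\<beta> \<in> B" "n \<beta> x = x" "n \<gamma> u = x" by blast
    have \<gamma>x: "n \<gamma> x = u" using mcol_sym[of K F n \<gamma> u x] n \<gamma> by (auto simp: ok_def)
    obtain X where X: "ok (kswap n \<gamma> \<beta> X)" "x \<in> X" "kclosed n \<gamma> \<beta> X"
      using sw[OF n(1) \<gamma>(1) False n(2)] n(3) by blast
    \<comment> \<open>The chain of \<open>x\<close> runs through \<open>u\<close>, so the change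
      moves \<open>ux\<close> itself to the colour \<beta> of \<open>B\<close>.\<close>
    have "u \<in> X" using X(2,3) \<gamma>x by (auto simp: kclosed_def)
    then have "kswap n \<gamma> \<beta> X \<beta> u = x" "kswap n \<gamma> \<beta> X \<gamma> x = x" using X(2) n False by (auto simp: kswap_def)
    then show False using F4a[OF X(1) n(2) _ \<gamma>(1)] by blast
  qed
qed

text \<open>In the position \<open>T5\<close> the edges \<open>bu\<close>, \<open>uy\<close>,
  \<open>yx\<close> have colours \<alpha>, \<gamma>, \<alpha>, and \<open>b\<close> and
  \<open>x\<close> miss \<gamma>; exchanging the two colours along the path makes \<alpha> missing
  at \<open>a\<close> and \<open>b\<close>. The facts \<open>L1\<close> to \<open>L5\<close> lead
  there when the colour of \<open>uy\<close> is in \<open>B\<close>, and \<open>S1\<close> to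
  \<open>S3\<close> reduce to that case. By \<open>miss\<close>, \<open>x\<close> still misses a
  colour when two are reserved.\<close>

lemma compl_pair_path5:
  assumes T: "compl_pair K F a b" and m: "mcol K F m" and d: "distinct [a, b, u, y, x]"
    and F: "{b, u} \<in> F" "{u, y} \<in> F" "{y, x} \<in> F"
    and \<beta>: "\<beta>1 \<in> K" "m \<beta>1 b = b" "\<beta>2 \<in> K" "m \<beta>2 b = b" "\<beta>1 \<noteq> \<beta>2"
    and miss: "\<And>n p q. mcol K F n \<Longrightarrow> \<exists>\<delta>\<in>K. n \<delta> x = x \<and> \<delta> \<noteq> p \<and> \<delta> \<noteq> q"
  shows False
proof -
  obtain \<alpha> where \<alpha>: "\<alpha> \<in> K" "m \<alpha> b = u" using mcol_ex[OF m F(1)] d by auto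
  define B where "B = {i\<in>K. m i b = b}"
  have xab: "x \<noteq> a" "x \<noteq> b" using d by auto
  define ok where "ok = (\<lambda>n. mcol K F n \<and> (\<forall>i. n i b = m i b))"
  have okm: "ok m" using m by (simp add: ok_def)
  have sw: "\<exists>X. ok (kswap n p q X) \<and> x \<in> X \<and> kclosed n p q X \<and> X \<inter> kempe n p q b = {} \<and>
      (\<forall>i. i \<noteq> p \<longrightarrow> i \<noteq> q \<longrightarrow> kswap n p q X i = n i) \<and> kswap n p q X p x = n q x \<and> kswap n p q X q x = n p x"
    if n: "ok n" and pq: "p \<in> K" "p \<notin> B" "q \<in> B" and x: "n p x = x \<or> n q x = x" for n p q
  proof -
    have n': "mcol K F n" "n p b \<noteq> b" "n q b = b" "q \<in> K" using n pq by (auto simp: ok_def B_def)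
    show ?thesis
      by (rule compl_pair_swap[OF T n'(1) pq(1) n'(4,2,3) xab x]) (use n in \<open>auto simp: ok_def kswap_def\<close>)
  qed
  have \<alpha>B: "\<alpha> \<notin> B" using \<alpha> d by (auto simp: B_def)
  have BK: "i \<in> K" if "i \<in> B" for i using that by (simp add: B_def)
  have other: "\<exists>\<beta>'\<in>B. \<beta>' \<noteq> \<beta>" for \<beta> using \<beta> by (auto simp: B_def)
  have pn: "mcol K F n" "n \<alpha> b = u" if "ok n" for n using that \<alpha> by (auto simp: ok_def)
  have mis: "\<exists>\<delta>\<in>K. n \<delta> x = x \<and> \<delta> \<noteq> p \<and> \<delta> \<noteq> q" if "ok n" for n p q using miss[OF pn(1)[OF that]] .
  have yx: "\<exists>\<tau>\<in>K. n \<tau> y = x \<and> n \<tau> x = y" if "ok n" for n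
    using mcol_ex[OF pn(1)[OF that] F(3)] mcol_sym[OF pn(1)[OF that]] d by fastforce
  have T5: False if n: "ok n" and \<gamma>: "\<gamma> \<in> B" "n \<gamma> u = y" and \<alpha>x: "n \<alpha> y = x" and \<gamma>x: "n \<gamma> x = x" for n \<gamma>
  proof -
    note p = pn[OF n]
    have nbrs: "n \<gamma> b = b" "\<gamma> \<in> K" using n \<gamma> by (auto simp: ok_def B_def)
    have \<alpha>\<gamma>: "\<alpha> \<noteq> \<gamma>" using \<alpha>B \<gamma> by auto
    let ?m0 = "uncolour n \<alpha> b u"
    have m0: "mcol K (F - {{b, u}}) ?m0" using mcol_uncolour[OF p(1) \<alpha>(1) p(2)] d by auto
    let ?m1 = "uncolour ?m0 \<alpha> y x"
    have m1: "mcol K (F - {{b, u}} - {{y, x}}) ?m1"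
      using mcol_uncolour[OF m0 \<alpha>(1), of y x] \<alpha>x d by (auto simp: uncolour_simps)
    let ?m2 = "recolour ?m1 \<gamma> \<alpha> u y"
    have m2: "mcol K (F - {{b, u}} - {{y, x}}) ?m2"
      using m1 \<alpha> nbrs \<gamma> d \<alpha>\<gamma> by (intro mcol_recolour) (auto simp: uncolour_simps)
    let ?m3 = "colour_edge ?m2 \<gamma> y x"
    have yxb: "{y, x} \<noteq> {b, u}" using d by (auto simp: doubleton_eq_iff)
    have m3: "mcol K (F - {{b, u}}) ?m3"
      using m2 \<gamma>x nbrs d \<alpha>\<gamma> F(3) yxb by (intro mcol_colour_edge') (auto simp: uncolour_simps recolour_simps)
    have m4: "mcol K F (colour_edge ?m3 \<gamma> b u)" using m3 nbrs \<alpha>\<gamma> d F(1)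
      by - (rule mcol_colour_edge', auto simp: recolour_simps uncolour_simps colour_edge_simps)
    have "n \<alpha> a = a" using compl_pair_iff[OF T p(1) \<alpha>(1)] p(2) d by auto
    then have "colour_edge ?m3 \<gamma> b u \<alpha> a = a" "colour_edge ?m3 \<gamma> b u \<alpha> b = b"
      using \<alpha>\<gamma> d by (auto simp: colour_edge_simps recolour_simps uncolour_simps)
    then show False using compl_pair_iff[OF T m4 \<alpha>(1)] by simp
  qed
  have L1: False if n: "ok n" and \<gamma>: "\<gamma> \<in> B" "n \<gamma> u = y" "n \<gamma> x = x" and \<alpha>x: "n \<alpha> x = x"
    and \<tau>: "\<tau> \<in> B" "n \<tau> y = x" for n \<gamma> \<tau>
  proof -
    have \<tau>x: "n \<tau> x = y" using mcol_sym[OF pn(1)[OF n] BK \<tau>(2)] \<tau>(1) by blast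
    have ne: "\<tau> \<noteq> \<gamma>" "\<alpha> \<noteq> \<gamma>" "\<alpha> \<noteq> \<tau>" using \<tau>x \<gamma> \<tau> \<alpha>B d by auto
    obtain X where X: "ok (kswap n \<alpha> \<tau> X)" "x \<in> X" "kclosed n \<alpha> \<tau> X" "\<forall>i. i \<noteq> \<alpha> \<longrightarrow> i \<noteq> \<tau> \<longrightarrow> kswap n \<alpha> \<tau> X i = n i"
      using sw[OF n \<alpha>(1) \<alpha>B \<tau>(1)] \<alpha>x by blast
    have "y \<in> X" using X(2,3) \<tau>x by (auto simp: kclosed_def)
    then have "kswap n \<alpha> \<tau> X \<alpha> y = x" using \<tau> by (simp add: kswap_def)
    then show False using T5[OF X(1) \<gamma>(1)] X(4) \<gamma> ne by metis
  qed
  have L2: False if n: "ok n" and \<gamma>: "\<gamma> \<in> B" "n \<gamma> u = y" "n \<gamma> x = x" and \<alpha>x: "n \<alpha> x = x"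
    and \<beta>': "\<beta>' \<in> B" "\<beta>' \<noteq> \<gamma>" "n \<beta>' x = x" for n \<gamma> \<beta>'
  proof -
    obtain \<tau> where \<tau>: "\<tau> \<in> K" "n \<tau> y = x" "n \<tau> x = y" using yx[OF n] by blast
    show False
    proof (cases "\<tau> \<in> B")
      case True then show False using L1[OF n \<gamma> \<alpha>x True \<tau>(2)] by blast
    next
      case False
      have ne: "\<tau> \<noteq> \<alpha>" "\<tau> \<noteq> \<gamma>" "\<tau> \<noteq> \<beta>'" "\<alpha> \<noteq> \<beta>'" using \<tau> \<alpha>x \<gamma> \<beta>' \<alpha>B d by auto
      obtain X where X: "ok (kswap n \<tau> \<beta>' X)" "x \<in> X" "kclosed n \<tau> \<beta>' X" "\<forall>i. i \<noteq> \<tau> \<longrightarrow> i \<noteq> \<beta>' \<longrightarrow> kswap n \<tau> \<beta>' X i = n i"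
        using sw[OF n \<tau>(1) False \<beta>'(1)] \<beta>' by blast
      have "y \<in> X" using X(2,3) \<tau> by (auto simp: kclosed_def)
      then have "kswap n \<tau> \<beta>' X \<beta>' y = x" using \<tau> ne by (simp add: kswap_def)
      then show False using L1[OF X(1) \<gamma>(1) _ _ _ \<beta>'(1)] X(4) \<gamma> \<alpha>x \<beta>' ne by metis
    qed
  qed
  have L3: False if n: "ok n" and \<gamma>: "\<gamma> \<in> B" "n \<gamma> u = y" "n \<gamma> x = x"
    and \<beta>': "\<beta>' \<in> B" "\<beta>' \<noteq> \<gamma>" "n \<beta>' x = x" for n \<gamma> \<beta>'
  proof (cases "n \<alpha> x = x")
    case True then show False using L2[OF n \<gamma> _ \<beta>'] by blast
  next
    case \<alpha>x: False
    obtain \<delta> where \<delta>: "\<delta> \<in> K" "n \<delta> x = x" "\<delta> \<noteq> \<gamma>" "\<delta> \<noteq> \<beta>'" using mis[OF n] by blast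
    have ne: "\<alpha> \<noteq> \<gamma>" "\<alpha> \<noteq> \<beta>'" "\<alpha> \<noteq> \<delta>" using \<alpha>B \<gamma> \<beta>' \<delta> \<alpha>x by auto
    show False
    proof (cases "\<delta> \<in> B")
      case True
      obtain X where X: "ok (kswap n \<alpha> \<delta> X)" "\<forall>i. i \<noteq> \<alpha> \<longrightarrow> i \<noteq> \<delta> \<longrightarrow> kswap n \<alpha> \<delta> X i = n i" "kswap n \<alpha> \<delta> X \<alpha> x = n \<delta> x"
        using sw[OF n \<alpha>(1) \<alpha>B True] \<delta> by blast
      show False using L2[OF X(1) \<gamma>(1) _ _ _ \<beta>'(1,2)] X(2,3) \<gamma> \<beta>' \<delta> ne by metis
    next
      case False
      obtain X where X: "ok (kswap n \<alpha> \<beta>' X)" "\<forall>i. i \<noteq> \<alpha> \<longrightarrow> i \<noteq> \<beta>' \<longrightarrow> kswap n \<alpha> \<beta>' X i = n i" "kswap n \<alpha> \<beta>' X \<alpha> x = n \<beta>' x"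
        using sw[OF n \<alpha>(1) \<alpha>B \<beta>'(1)] \<beta>' by blast
      let ?n = "kswap n \<alpha> \<beta>' X"
      have v: "?n \<delta> x = x" "?n \<gamma> u = y" "?n \<gamma> x = x" "?n \<alpha> x = x" using X(2,3) \<delta> \<gamma> \<beta>' ne by auto
      obtain Y where Y: "ok (kswap ?n \<delta> \<beta>' Y)" "\<forall>i. i \<noteq> \<delta> \<longrightarrow> i \<noteq> \<beta>' \<longrightarrow> kswap ?n \<delta> \<beta>' Y i = ?n i" "kswap ?n \<delta> \<beta>' Y \<beta>' x = ?n \<delta> x"
        using sw[OF X(1) \<delta>(1) False \<beta>'(1)] v(1) by blast
      show False using L2[OF Y(1) \<gamma>(1) _ _ _ \<beta>'(1,2)] Y(2,3) v \<beta>' \<delta> ne by metis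
    qed
  qed
  have L4: False if n: "ok n" and \<gamma>: "\<gamma> \<in> B" "n \<gamma> u = y" "n \<gamma> x = x" for n \<gamma>
  proof -
    obtain \<beta>' where \<beta>': "\<beta>' \<in> B" "\<beta>' \<noteq> \<gamma>" using other by blast
    obtain \<delta> where \<delta>: "\<delta> \<in> K" "n \<delta> x = x" "\<delta> \<noteq> \<gamma>" using mis[OF n] by blast
    show False
    proof (cases "\<delta> \<in> B")
      case True then show False using L3[OF n \<gamma> True \<delta>(3,2)] by blast
    next
      case False
      obtain X where X: "ok (kswap n \<delta> \<beta>' X)" "\<forall>i. i \<noteq> \<delta> \<longrightarrow> i \<noteq> \<beta>' \<longrightarrow> kswap n \<delta> \<beta>' X i = n i" "kswap n \<delta> \<beta>' X \<beta>' x = n \<delta> x"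
        using sw[OF n \<delta>(1) False \<beta>'(1)] \<delta> by blast
      show False using L3[OF X(1) \<gamma>(1) _ _ \<beta>'] X(2,3) \<gamma> \<beta>' \<delta> by metis
    qed
  qed
  have L5: False if n: "ok n" and \<gamma>: "\<gamma> \<in> B" "n \<gamma> u = y" for n \<gamma>
  proof -
    have \<alpha>\<gamma>: "\<alpha> \<noteq> \<gamma>" using \<alpha>B \<gamma> by auto
    have A: False if n: "ok n" and \<gamma>u: "n \<gamma> u = y" and \<alpha>x: "n \<alpha> x = x" for n
    proof -
      obtain X where X: "ok (kswap n \<alpha> \<gamma> X)" "X \<inter> kempe n \<alpha> \<gamma> b = {}" "kswap n \<alpha> \<gamma> X \<gamma> x = n \<alpha> x"
        using sw[OF n \<alpha>(1) \<alpha>B \<gamma>(1)] \<alpha>x by blast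
      \<comment> \<open>The edge \<open>bu\<close> has colour \<alpha>, so \<open>u\<close> lies on
        the chain of \<open>b\<close>, and the change at \<open>x\<close> leaves \<open>uy\<close>
        alone.\<close>
      have "u \<in> kempe n \<alpha> \<gamma> b" using kempe_step(1)[of b n \<alpha> \<gamma> b] pn(2)[OF n] by simp
      then have "u \<notin> X" using X(2) by blast
      then have "kswap n \<alpha> \<gamma> X \<gamma> u = y" using \<gamma>u by (simp add: kswap_def)
      then show False using L4[OF X(1) \<gamma>(1)] X(3) \<alpha>x by simp
    qed
    have B': False if n: "ok n" and \<gamma>u: "n \<gamma> u = y" and \<delta>: "\<delta> \<in> B" "n \<delta> x = x" "\<delta> \<noteq> \<gamma>" for n \<delta>
    proof -
      obtain X where X: "ok (kswap n \<alpha> \<delta> X)" "\<forall>i. i \<noteq> \<alpha> \<longrightarrow> i \<noteq> \<delta> \<longrightarrow> kswap n \<alpha> \<delta> X i = n i" "kswap n \<alpha> \<delta> X \<alpha> x = n \<delta> x"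
        using sw[OF n \<alpha>(1) \<alpha>B \<delta>(1)] \<delta> by blast
      show False using A[OF X(1)] X(2,3) \<gamma>u \<alpha>\<gamma> \<delta> by auto
    qed
    obtain \<delta> where \<delta>: "\<delta> \<in> K" "n \<delta> x = x" "\<delta> \<noteq> \<gamma>" using mis[OF n] by blast
    show False
    proof (cases "\<delta> \<in> B")
      case True then show False using B'[OF n \<gamma>(2) True \<delta>(2,3)] by blast
    next
      case False
      obtain \<beta>' where \<beta>': "\<beta>' \<in> B" "\<beta>' \<noteq> \<gamma>" using other by blast
      obtain X where X: "ok (kswap n \<delta> \<beta>' X)" "\<forall>i. i \<noteq> \<delta> \<longrightarrow> i \<noteq> \<beta>' \<longrightarrow> kswap n \<delta> \<beta>' X i = n i" "kswap n \<delta> \<beta>' X \<beta>' x = n \<delta> x"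
        using sw[OF n \<delta>(1) False \<beta>'(1)] \<delta> by blast
      show False using B'[OF X(1) _ \<beta>'(1) _ \<beta>'(2)] X(2,3) \<gamma> \<delta> \<beta>' by auto
    qed
  qed
  have S1: False if n: "ok n" and \<gamma>: "\<gamma> \<in> K" "\<gamma> \<notin> B" "n \<gamma> u = y" "n \<gamma> x = x" and \<tau>: "\<tau> \<in> B" "n \<tau> y = x" for n \<gamma> \<tau>
  proof -
    have \<tau>x: "n \<tau> x = y" using mcol_sym[OF pn(1)[OF n] BK \<tau>(2)] \<tau>(1) by blast
    have \<gamma>y: "n \<gamma> y = u" using mcol_sym[OF pn(1)[OF n] \<gamma>(1,3)] .
    have ne: "\<gamma> \<noteq> \<tau>" using \<gamma> \<tau> by auto
    obtain X where X: "ok (kswap n \<gamma> \<tau> X)" "x \<in> X" "kclosed n \<gamma> \<tau> X"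
      using sw[OF n \<gamma>(1,2) \<tau>(1)] \<gamma>(4) by blast
    \<comment> \<open>The chain of \<open>x\<close> passes through \<open>y\<close> and
      \<open>u\<close>, so \<open>uy\<close> takes the colour \<tau> of \<open>B\<close>.\<close>
    have "y \<in> X" using X(2,3) \<tau>x by (auto simp: kclosed_def)
    then have "u \<in> X" using X(3) \<gamma>y by (auto simp: kclosed_def)
    then have "kswap n \<gamma> \<tau> X \<tau> u = y" using \<gamma> ne by (simp add: kswap_def)
    then show False using L5[OF X(1) \<tau>(1)] by blast
  qed
  have S2: False if n: "ok n" and \<gamma>: "\<gamma> \<in> K" "\<gamma> \<notin> B" "n \<gamma> u = y" and \<tau>: "\<tau> \<in> B" "n \<tau> y = x" for n \<gamma> \<tau>
  proof -
    have A: False if n: "ok n" and \<gamma>u: "n \<gamma> u = y" and \<tau>y: "n \<tau> y = x" and \<delta>: "\<delta> \<in> B" "n \<delta> x = x" for n \<delta>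
    proof -
      have \<tau>x: "n \<tau> x = y" using mcol_sym[OF pn(1)[OF n] BK \<tau>y] \<tau>(1) by blast
      have ne: "\<tau> \<noteq> \<delta>" "\<tau> \<noteq> \<gamma>" "\<gamma> \<noteq> \<delta>" using \<tau>x \<delta> \<gamma> \<tau> d by auto
      obtain X where X: "ok (kswap n \<gamma> \<delta> X)" "x \<in> X" "\<forall>i. i \<noteq> \<gamma> \<longrightarrow> i \<noteq> \<delta> \<longrightarrow> kswap n \<gamma> \<delta> X i = n i" "kswap n \<gamma> \<delta> X \<gamma> x = n \<delta> x"
        using sw[OF n \<gamma>(1,2) \<delta>(1)] \<delta> by blast
      show False
      proof (cases "u \<in> X")
        case True
        then have "kswap n \<gamma> \<delta> X \<delta> u = y" using \<gamma>u ne by (simp add: kswap_def)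
        then show False using L5[OF X(1) \<delta>(1)] by blast
      next
        case False
        then have "kswap n \<gamma> \<delta> X \<gamma> u = y" using \<gamma>u by (simp add: kswap_def)
        then show False using S1[OF X(1) \<gamma>(1,2) _ _ \<tau>(1)] X(3,4) \<delta> \<tau>y ne by metis
      qed
    qed
    obtain \<delta> where \<delta>: "\<delta> \<in> K" "n \<delta> x = x" using mis[OF n] by blast
    show False
    proof (cases "\<delta> \<in> B")
      case True then show False using A[OF n \<gamma>(3) \<tau>(2) True \<delta>(2)] by blast
    next
      case False
      show False
      proof (cases "\<delta> = \<gamma>")
        case True then show False using S1[OF n \<gamma> _ \<tau>] \<delta> by blast
      next
        case ne: False
        obtain \<beta>' where \<beta>': "\<beta>' \<in> B" "\<beta>' \<noteq> \<tau>" using other by blast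
        obtain X where X: "ok (kswap n \<delta> \<beta>' X)" "\<forall>i. i \<noteq> \<delta> \<longrightarrow> i \<noteq> \<beta>' \<longrightarrow> kswap n \<delta> \<beta>' X i = n i" "kswap n \<delta> \<beta>' X \<beta>' x = n \<delta> x"
          using sw[OF n \<delta>(1) False \<beta>'(1)] \<delta> by blast
        have "\<tau> \<noteq> \<delta>" "\<gamma> \<noteq> \<beta>'" using \<tau> False \<gamma> \<beta>' by auto
        then show False using A[OF X(1) _ _ \<beta>'(1)] X(2,3) \<gamma> \<tau> \<delta> \<beta>' ne by metis
      qed
    qed
  qed
  have S3: False if n: "ok n" and \<gamma>: "\<gamma> \<in> K" "\<gamma> \<notin> B" "n \<gamma> u = y" and \<tau>: "\<tau> \<in> K" "\<tau> \<notin> B" "n \<tau> y = x"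
    and \<delta>: "\<delta> \<in> B" "n \<delta> x = x" for n \<gamma> \<tau> \<delta>
  proof -
    have \<tau>x: "n \<tau> x = y" using mcol_sym[OF pn(1)[OF n] \<tau>(1,3)] .
    have \<gamma>y: "n \<gamma> y = u" using mcol_sym[OF pn(1)[OF n] \<gamma>(1,3)] .
    have ne: "\<gamma> \<noteq> \<tau>" "\<gamma> \<noteq> \<delta>" "\<tau> \<noteq> \<delta>" using \<gamma>y \<tau> \<gamma> \<delta> d by auto
    obtain X where X: "ok (kswap n \<tau> \<delta> X)" "x \<in> X" "kclosed n \<tau> \<delta> X" "\<forall>i. i \<noteq> \<tau> \<longrightarrow> i \<noteq> \<delta> \<longrightarrow> kswap n \<tau> \<delta> X i = n i"
      using sw[OF n \<tau>(1,2) \<delta>(1)] \<delta> by blast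
    have "y \<in> X" using X(2,3) \<tau>x by (auto simp: kclosed_def)
    then have "kswap n \<tau> \<delta> X \<delta> y = x" using \<tau> ne by (simp add: kswap_def)
    moreover have "kswap n \<tau> \<delta> X \<gamma> u = y" using X(4) ne \<gamma> by auto
    ultimately show False using S2[OF X(1) \<gamma>(1,2) _ \<delta>(1)] by blast
  qed
  obtain \<gamma> where \<gamma>: "\<gamma> \<in> K" "m \<gamma> u = y" using mcol_ex[OF m F(2)] d by auto
  obtain \<tau> where \<tau>: "\<tau> \<in> K" "m \<tau> y = x" "m \<tau> x = y" using yx[OF okm] by blast
  obtain \<delta> where \<delta>: "\<delta> \<in> K" "m \<delta> x = x" using mis[OF okm] by blast
  have b1: "\<beta>1 \<in> B" using \<beta> by (simp add: B_def)
  show False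
  proof (cases "\<gamma> \<in> B \<or> \<tau> \<in> B \<or> \<delta> \<in> B")
    case True
    then show False using L5[OF okm _ \<gamma>(2)] S2[OF okm \<gamma>(1) _ \<gamma>(2) _ \<tau>(2)] S3[OF okm \<gamma>(1) _ \<gamma>(2) \<tau>(1) _ \<tau>(2) _ \<delta>(2)]
      by blast
  next
    case False
    then have nB: "\<gamma> \<notin> B" "\<tau> \<notin> B" "\<delta> \<notin> B" by auto
    have ne: "\<tau> \<noteq> \<delta>" "\<tau> \<noteq> \<beta>1" "\<gamma> \<noteq> \<beta>1" "\<delta> \<noteq> \<beta>1" using \<tau> \<delta> d nB b1 by auto
    obtain X where X: "ok (kswap m \<delta> \<beta>1 X)" "\<forall>i. i \<noteq> \<delta> \<longrightarrow> i \<noteq> \<beta>1 \<longrightarrow> kswap m \<delta> \<beta>1 X i = m i" "kswap m \<delta> \<beta>1 X \<beta>1 x = m \<delta> x"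
      using sw[OF okm \<delta>(1) nB(3) b1] \<delta> by blast
    let ?n = "kswap m \<delta> \<beta>1 X"
    have v: "?n \<tau> y = x" "?n \<beta>1 x = x" using X(2,3) ne \<tau> \<delta> by auto
    show False
    proof (cases "?n \<gamma> u = y")
      case True then show False using S3[OF X(1) \<gamma>(1) nB(1) _ \<tau>(1) nB(2) v(1) b1 v(2)] by blast
    next
      case False
      then have "\<gamma> = \<delta>" "u \<in> X" using X(2) \<gamma> ne by (auto simp: kswap_def split: if_splits)
      then have "?n \<beta>1 u = y" using \<gamma> ne by (simp add: kswap_def)
      then show False using L5[OF X(1) b1] by blast
    qed
  qed
qed

subsection \<open>Critical graphs\<close>

definition nbrs :: "'v set set \<Rightarrow> 'v \<Rightarrow> 'v set" where
  "nbrs F v = {w. w \<noteq> v \<and> {v, w} \<in> F}"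

lemma nbrs_sym: "w \<in> nbrs F v \<longleftrightarrow> v \<in> nbrs F w"
  by (auto simp: nbrs_def insert_commute)

lemma nbrs_self [simp]: "v \<notin> nbrs F v"
  by (simp add: nbrs_def)

lemma card_ge_2_ex:
  assumes "2 \<le> card A" shows "\<exists>x\<in>A. \<exists>y\<in>A. x \<noteq> y"
proof (rule ccontr)
  assume "\<not> ?thesis"
  moreover have "finite A" using assms by (intro card_ge_0_finite) simp
  ultimately have "card A \<le> Suc 0" by (simp add: card_le_Suc0_iff_eq)
  then show False using assms by simp
qed

lemma card_ge_3_ex:
  assumes "3 \<le> card A" shows "\<exists>x\<in>A. x \<noteq> p \<and> x \<noteq> q"
proof (rule ccontr)
  assume "\<not> ?thesis"
  then have "A \<subseteq> {p, q}" by blast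
  then have "card A \<le> card {p, q}" by (rule card_mono[rotated]) simp
  also have "\<dots> \<le> 2" by (simp add: card_insert_if)
  finally show False using assms by simp
qed

lemma even_card_nonfixed:
  assumes "finite V" "\<And>v. f (f v) = v" "\<And>v. v \<in> V \<Longrightarrow> f v \<in> V"
  shows "even (card {v\<in>V. f v \<noteq> v})"
  using assms(1,3)
proof (induction V rule: finite_psubset_induct)
  case (psubset V)
  show ?case
  proof (cases "\<exists>v\<in>V. f v \<noteq> v")
    case False
    then have "{v\<in>V. f v \<noteq> v} = {}" by blast
    then show ?thesis by (metis card.empty even_zero)
  next
    case True
    then obtain v where v: "v \<in> V" "f v \<noteq> v" by blast
    let ?W = "V - {v, f v}"
    have fv: "f v \<in> V" using psubset.prems v by blast
    have "f w \<in> ?W" if "w \<in> ?W" for w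
      using that psubset.prems assms(2) by (metis Diff_iff insertE insert_iff singletonD)
    then have "even (card {w\<in>?W. f w \<noteq> w})" using v by (intro psubset.IH) auto
    moreover have "{w\<in>V. f w \<noteq> w} = insert v (insert (f v) {w\<in>?W. f w \<noteq> w})"
      using v fv assms(2)[of v] by auto
    moreover have "finite {w\<in>?W. f w \<noteq> w}" using psubset.hyps by simp
    ultimately show ?thesis using v by simp
  qed
qed

text \<open>Criticality is used for two kinds of subgraphs only: \<open>crit\<close> comes from
  deleting one edge, and \<open>noiso\<close> from deleting an isolated vertex.\<close>

locale critical_graph =
  fixes V :: "'v set" and E :: "'v set set" and \<Delta> :: nat
  assumes finV: "finite V" and EV: "e \<in> E \<Longrightarrow> e \<subseteq> V" and E2: "e \<in> E \<Longrightarrow> card e = 2"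
    and deg_le: "card (nbrs E v) \<le> \<Delta>"
    and nocol: "\<not> mcol {..<\<Delta>} E m"
    and crit: "e \<in> E \<Longrightarrow> \<exists>m. mcol {..<\<Delta>} (E - {e}) m"
    and noiso: "v \<in> V \<Longrightarrow> nbrs E v \<noteq> {}"
begin

abbreviation "K \<equiv> {..<\<Delta>}"
abbreviation "deg v \<equiv> card (nbrs E v)"

lemma fin_graph_E: "fin_graph E"
  unfolding fin_graph_def
proof
  have "E \<subseteq> Pow V" using EV by blast
  then show "finite E" using finV by (meson finite_Pow_iff finite_subset)
  show "\<forall>e\<in>E. finite e" using EV finV by (meson finite_subset)
qed

lemma nbrs_V: "nbrs E v \<subseteq> V" using EV by (auto simp: nbrs_def)

lemma finite_nbrs [simp]: "finite (nbrs E v)" using nbrs_V finV by (rule finite_subset)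

lemma nbrs_in_V: "w \<in> nbrs E v \<Longrightarrow> v \<in> V" using nbrs_V nbrs_sym by fast

lemma edge_ne: "{v, w} \<in> E \<Longrightarrow> v \<noteq> w" using E2 by fastforce

lemma nbrs_iff: "w \<in> nbrs E v \<longleftrightarrow> {v, w} \<in> E" using edge_ne by (auto simp: nbrs_def)

lemma card_missing:
  assumes m: "mcol K F m"
  shows "card {i\<in>K. m i v = v} + card (nbrs F v) = \<Delta>"
proof -
  have "K = {i\<in>K. m i v = v} \<union> {i\<in>K. m i v \<noteq> v}" by blast
  then have "card K = card {i\<in>K. m i v = v} + card {i\<in>K. m i v \<noteq> v}"
    by (metis (no_types, lifting) card_Un_disjoint disjoint_iff finite_Un finite_lessThan mem_Collect_eq)
  then show ?thesis using mcol_degree[OF m, of v] by (simp add: nbrs_def)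
qed

lemma nbrs_Diff:
  assumes "{v, w} \<in> E" shows "nbrs (E - {{v, w}}) v = nbrs E v - {w}"
  using assms by (auto simp: nbrs_def doubleton_eq_iff)

lemma nbrs_Diff_other: "x \<noteq> v \<Longrightarrow> x \<noteq> w \<Longrightarrow> nbrs (F - {{v, w}}) x = nbrs F x"
  by (auto simp: nbrs_def doubleton_eq_iff)

lemma card_nbrs_Diff:
  assumes "{v, w} \<in> E" shows "Suc (card (nbrs (E - {{v, w}}) v)) = deg v"
  using assms by (metis card_Suc_Diff1 finite_nbrs nbrs_Diff nbrs_iff)

lemma disjoint_missing:
  assumes e: "{v, w} \<in> E" and m: "mcol K (E - {{v, w}}) m" and i: "i \<in> K" "m i v = v"
  shows "m i w \<noteq> w"
  using mcol_colour_edge'[OF m e i] nocol edge_ne[OF e] by blast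

text \<open>In a colouring without \<open>vw\<close> the two ends miss
  \<open>\<Delta> - deg v + 1\<close> and \<open>\<Delta> - deg w + 1\<close> colours, and these
  sets are disjoint.\<close>

lemma edge_sum:
  assumes e: "{v, w} \<in> E" shows "\<Delta> + 2 \<le> deg v + deg w"
proof -
  obtain m where m: "mcol K (E - {{v, w}}) m" using crit[OF e] by blast
  let ?A = "{i\<in>K. m i v = v}" and ?B = "{i\<in>K. m i w = w}"
  have "card (?A \<union> ?B) = card ?A + card ?B"
    using disjoint_missing[OF e m] by (intro card_Un_disjoint) auto
  moreover have "card (?A \<union> ?B) \<le> card K" by (intro card_mono) auto
  moreover have "card ?A + (deg v - 1) = \<Delta>" "deg v \<ge> 1"
    using card_missing[OF m, of v] card_nbrs_Diff[OF e] by auto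
  moreover have "card ?B + (deg w - 1) = \<Delta>" "deg w \<ge> 1"
    using card_missing[OF m, of w] card_nbrs_Diff[of w v] e by (auto simp: insert_commute)
  ultimately show ?thesis by simp
qed

lemma pairwI:
  assumes e: "{a, b} \<in> E" and d: "deg a + deg b = \<Delta> + 2"
  shows "compl_pair K (E - {{a, b}}) a b"
  unfolding compl_pair_def
proof (intro conjI allI impI ballI)
  show "fin_graph (E - {{a, b}})" using fin_graph_E fin_graph_Diff by blast
  show "a \<noteq> b" using edge_ne[OF e] .
  fix m i assume m: "mcol K (E - {{a, b}}) m" and i: "i \<in> K"
  let ?A = "{i\<in>K. m i a = a}" and ?B = "{i\<in>K. m i b = b}"
  have dj: "card (?A \<union> ?B) = card ?A + card ?B"
    using disjoint_missing[OF e m] by (intro card_Un_disjoint) auto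
  have "card ?A + (deg a - 1) = \<Delta>" "deg a \<ge> 1"
    using card_missing[OF m, of a] card_nbrs_Diff[OF e] by auto
  moreover have "card ?B + (deg b - 1) = \<Delta>" "deg b \<ge> 1"
    using card_missing[OF m, of b] card_nbrs_Diff[of b a] e by (auto simp: insert_commute)
  ultimately have "card (?A \<union> ?B) = card K" using dj d by simp
  then have "?A \<union> ?B = K" by (intro card_subset_eq) auto
  then show "m i a = a \<longleftrightarrow> m i b \<noteq> b" using disjoint_missing[OF e m i] i by blast
qed

lemma full_if_no_missing:
  assumes m: "mcol K F m" and n: "nbrs F v = nbrs E v" and "\<And>i. i \<in> K \<Longrightarrow> m i v = v \<Longrightarrow> False"
  shows "deg v = \<Delta>"
proof -
  have "{i\<in>K. m i v = v} = {}" using assms(3) by blast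
  then have "card {i\<in>K. m i v = v} = 0" by (metis card.empty)
  then show ?thesis using card_missing[OF m, of v] unfolding n by linarith
qed

lemma nbr_full:
  assumes e: "{a, b} \<in> E" and d: "deg a + deg b = \<Delta> + 2" and u: "u \<in> nbrs E b" "u \<noteq> a"
  shows "deg u = \<Delta>"
proof -
  note pw = pairwI[OF e d]
  obtain m where m: "mcol K (E - {{a, b}}) m" using crit[OF e] by blast
  have ne: "u \<noteq> b" "b \<noteq> u" using u by (auto simp: nbrs_def)
  have bu: "{b, u} \<in> E - {{a, b}}" using u ne by (auto simp: nbrs_def doubleton_eq_iff)
  obtain \<alpha> where \<alpha>: "\<alpha> \<in> K" "m \<alpha> b = u" using mcol_ex[OF m bu ne(2)] by blast
  have "card {i\<in>K. m i b = b} + (deg b - 1) = \<Delta>" "deg b \<ge> 1"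
    using card_missing[OF m, of b] card_nbrs_Diff[of b a] e by (auto simp: insert_commute)
  then have "card {i\<in>K. m i b = b} > 0" using deg_le[of b] by linarith
  then obtain \<beta> where \<beta>: "\<beta> \<in> K" "m \<beta> b = b" by (auto simp: card_gt_0_iff)
  show ?thesis
  proof (rule full_if_no_missing[OF m])
    show "nbrs (E - {{a, b}}) u = nbrs E u" using u ne by (intro nbrs_Diff_other) auto
    show False if "i \<in> K" "m i u = u" for i
      using compl_pair_nbr_full[OF pw m \<alpha> u(2) ne(1) that \<beta>] .
  qed
qed

text \<open>If no edge left \<open>X\<close>, a colouring without \<open>ab\<close>, used on
  \<open>X\<close>, and a colouring without some edge inside \<open>X\<close>, used elsewhere, would
  combine to a colouring of all of \<open>E\<close>.\<close>

lemma connected_step: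
  assumes ab: "{a, b} \<in> E" "a \<notin> X" "b \<notin> X" and v: "v \<in> X" "X \<subseteq> V"
  shows "\<exists>x\<in>X. \<exists>y. y \<notin> X \<and> {x, y} \<in> E"
proof (rule ccontr)
  assume "\<not> ?thesis"
  then have no: "{x, y} \<notin> E" if "x \<in> X" "y \<notin> X" for x y using that by blast
  obtain w where w: "w \<in> nbrs E v" using noiso v by blast
  then have vw: "{v, w} \<in> E" "v \<noteq> w" by (auto simp: nbrs_def)
  then have wX: "w \<in> X" using no v by blast
  obtain m1 where m1: "mcol K (E - {{a, b}}) m1" using crit[OF ab(1)] by blast
  obtain m2 where m2: "mcol K (E - {{v, w}}) m2" using crit[OF vw(1)] by blast
  have c1: "m1 i x \<in> X" if "i \<in> K" "x \<in> X" for i x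
    using mcol_edge[OF m1 that(1), of x] no[OF that(2)] that(2) by (metis DiffD1)
  have c2: "m2 i x \<notin> X" if "i \<in> K" "x \<notin> X" for i x
    using mcol_edge[OF m2 that(1), of x] no[of "m2 i x" x] that(2) by (metis DiffD1 insert_commute)
  define m where "m = (\<lambda>i x. if x \<in> X then m1 i x else m2 i x)"
  have "mcol K E m"
    unfolding mcol_def
  proof (intro conjI ballI allI impI)
    fix i x assume i: "i \<in> K"
    show "m i (m i x) = x"
      using mcol_invol[OF m1 i] mcol_invol[OF m2 i] c1[OF i] c2[OF i] by (simp add: m_def)
    show "{x, m i x} \<in> E" if "m i x \<noteq> x"
      using that mcol_edge[OF m1 i, of x] mcol_edge[OF m2 i, of x] by (auto simp: m_def split: if_splits)
  next
    fix x y assume xy: "x \<noteq> y" "{x, y} \<in> E"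
    show "\<exists>i\<in>K. m i x = y"
    proof (cases "x \<in> X")
      case True
      then have "{x, y} \<in> E - {{a, b}}" using xy ab by (auto simp: doubleton_eq_iff)
      then show ?thesis using mcol_ex[OF m1 _ xy(1)] True by (auto simp: m_def)
    next
      case False
      then have "{x, y} \<in> E - {{v, w}}" using xy v wX by (auto simp: doubleton_eq_iff)
      then show ?thesis using mcol_ex[OF m2 _ xy(1)] False by (auto simp: m_def)
    qed
  next
    fix i j x assume "i \<in> K" "j \<in> K" "m i x = m j x" "m i x \<noteq> x"
    then show "i = j" using mcol_inj[OF m1, of i j x] mcol_inj[OF m2, of i j x] by (auto simp: m_def split: if_splits)
  qed
  then show False using nocol by blast
qed

lemma two_missing_at:
  assumes e: "{a, b} \<in> E" and d: "deg a + deg b = \<Delta> + 2" "3 \<le> deg a" and m: "mcol K (E - {{a, b}}) m"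
  shows "\<exists>\<beta>1\<in>K. \<exists>\<beta>2\<in>K. m \<beta>1 b = b \<and> m \<beta>2 b = b \<and> \<beta>1 \<noteq> \<beta>2"
proof -
  have "card {i\<in>K. m i b = b} + (deg b - 1) = \<Delta>" "deg b \<ge> 1"
    using card_missing[OF m, of b] card_nbrs_Diff[of b a] e by (auto simp: insert_commute)
  then have "2 \<le> card {i\<in>K. m i b = b}" using d by linarith
  then show ?thesis using card_ge_2_ex[of "{i\<in>K. m i b = b}"] by blast
qed

lemma dist2_full:
  assumes e: "{a, b} \<in> E" and d: "deg a + deg b = \<Delta> + 2" "3 \<le> deg a"
    and u: "u \<in> nbrs E b" "u \<noteq> a" and x: "x \<in> nbrs E u" "x \<noteq> a" "x \<noteq> b"
  shows "deg x = \<Delta>"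
proof -
  obtain m where m: "mcol K (E - {{a, b}}) m" using crit[OF e] by blast
  obtain \<beta>1 \<beta>2 where \<beta>: "\<beta>1 \<in> K" "m \<beta>1 b = b" "\<beta>2 \<in> K" "m \<beta>2 b = b" "\<beta>1 \<noteq> \<beta>2"
    using two_missing_at[OF e d m] by blast
  have dd: "distinct [a, b, u, x]" using u x edge_ne[OF e] by (auto simp: nbrs_def)
  have F: "{b, u} \<in> E - {{a, b}}" "{u, x} \<in> E - {{a, b}}" using u x dd by (auto simp: nbrs_def doubleton_eq_iff)
  show ?thesis
  proof (rule full_if_no_missing[OF m])
    show "nbrs (E - {{a, b}}) x = nbrs E x" using x by (intro nbrs_Diff_other) auto
    show False if "i \<in> K" "m i x = x" for i
      using compl_pair_path4[OF pairwI[OF e d(1)] m dd F \<beta> that] .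
  qed
qed

lemma no_dist3:
  assumes e: "{a, b} \<in> E" and d: "deg a + deg b = \<Delta> + 2" "3 \<le> deg a"
    and u: "u \<in> nbrs E b" and y: "y \<in> nbrs E u" and x: "x \<in> nbrs E y" and dd: "distinct [a, b, u, y, x]"
    and dx: "deg x + 3 \<le> \<Delta>"
  shows False
proof -
  obtain m where m: "mcol K (E - {{a, b}}) m" using crit[OF e] by blast
  obtain \<beta>1 \<beta>2 where \<beta>: "\<beta>1 \<in> K" "m \<beta>1 b = b" "\<beta>2 \<in> K" "m \<beta>2 b = b" "\<beta>1 \<noteq> \<beta>2"
    using two_missing_at[OF e d m] by blast
  have F: "{b, u} \<in> E - {{a, b}}" "{u, y} \<in> E - {{a, b}}" "{y, x} \<in> E - {{a, b}}"
    using u y x dd by (auto simp: nbrs_def doubleton_eq_iff)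
  have n: "nbrs (E - {{a, b}}) x = nbrs E x" using dd by (intro nbrs_Diff_other) auto
  have "\<exists>\<delta>\<in>K. n \<delta> x = x \<and> \<delta> \<noteq> p \<and> \<delta> \<noteq> q" if "mcol K (E - {{a, b}}) n" for n p q
  proof -
    have "card {i\<in>K. n i x = x} + deg x = \<Delta>" using card_missing[OF that, of x] n by simp
    then have "3 \<le> card {i\<in>K. n i x = x}" using dx by linarith
    then show ?thesis using card_ge_3_ex[of "{i\<in>K. n i x = x}" p q] by blast
  qed
  then show False using compl_pair_path5[OF pairwI[OF e d(1)] m dd F \<beta>] by blast
qed

text \<open>\<open>X\<close> is the set of vertices at distance at least 3 from
  \<open>{a, b}\<close>; by \<open>nbr_full\<close> and \<open>dist2_full\<close> it contains every
  deficient vertex. An edge leaving \<open>X\<close> yields a vertex \<open>x\<close> at distance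
  exactly 3, whose neighbourhood is disjoint from that of \<open>b\<close>. This bounds its degree
  so strongly that \<open>no_dist3\<close> applies.\<close>

lemma all_full_both_ge3:
  assumes e: "{a, b} \<in> E" and d: "deg a + deg b = \<Delta> + 2" "3 \<le> deg a" "deg a \<le> deg b"
    and n: "3 * card V \<le> 4 * \<Delta> + 3" and v: "v \<in> V" "v \<noteq> a" "v \<noteq> b"
  shows "deg v = \<Delta>"
proof (rule ccontr)
  assume nf: "deg v \<noteq> \<Delta>"
  have e': "{b, a} \<in> E" using e by (simp add: insert_commute)
  have d': "deg b + deg a = \<Delta> + 2" "3 \<le> deg b" using d by auto
  define X where "X = {x\<in>V. x \<noteq> a \<and> x \<noteq> b \<and> x \<notin> nbrs E a \<and> x \<notin> nbrs E b \<and> nbrs E x \<inter> (nbrs E a \<union> nbrs E b) = {}}"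
  have vX: "v \<in> X"
  proof -
    have 1: "v \<notin> nbrs E a" "v \<notin> nbrs E b" using nbr_full[OF e d(1)] nbr_full[OF e' d'(1)] nf v by blast+
    moreover have "nbrs E v \<inter> (nbrs E a \<union> nbrs E b) = {}"
    proof (rule ccontr)
      assume "\<not> ?thesis"
      then obtain w where w: "w \<in> nbrs E v" "w \<in> nbrs E a \<or> w \<in> nbrs E b" by blast
      have w': "v \<in> nbrs E w" "w \<noteq> a" "w \<noteq> b" using w(1) 1 nbrs_sym by fast+
      show False using w(2) dist2_full[OF e d(1,2) _ w'(2,1) v(2,3)] dist2_full[OF e' d' _ w'(3,1) v(3,2)] nf by blast
    qed
    ultimately show ?thesis using v by (simp add: X_def)
  qed
  obtain x y where xy: "x \<in> X" "y \<notin> X" "{x, y} \<in> E"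
    using connected_step[OF e, of X v] vX by (auto simp: X_def)
  have x: "x \<in> V" "x \<noteq> a" "x \<noteq> b" "x \<notin> nbrs E a" "x \<notin> nbrs E b" "nbrs E x \<inter> (nbrs E a \<union> nbrs E b) = {}"
    using xy by (auto simp: X_def)
  have yx: "y \<in> nbrs E x" "x \<in> nbrs E y" using xy nbrs_iff nbrs_sym by fast+
  have y: "y \<noteq> a" "y \<noteq> b" "y \<notin> nbrs E a" "y \<notin> nbrs E b" "y \<in> V"
    using yx x nbrs_sym nbrs_in_V by fast+
  then obtain u where u: "u \<in> nbrs E y" "u \<in> nbrs E a \<or> u \<in> nbrs E b" using xy(2) by (auto simp: X_def)
  have uy: "y \<in> nbrs E u" using u nbrs_sym by fast
  have dd: "distinct [a, b, u, y, x]" "distinct [b, a, u, y, x]"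
  proof -
    have "u \<noteq> a" "u \<noteq> b" using uy y by blast+
    moreover have "u \<noteq> y" "y \<noteq> x" using uy yx nbrs_self by metis+
    moreover have "u \<noteq> x" using u x by blast
    ultimately show "distinct [a, b, u, y, x]" "distinct [b, a, u, y, x]" using x y edge_ne[OF e] by simp_all
  qed
  have "card (nbrs E x \<union> (nbrs E b \<union> {b, x})) \<le> card V"
    using nbrs_V x nbrs_in_V e nbrs_iff finV EV[OF e] by (intro card_mono) auto
  moreover have "card (nbrs E x \<union> (nbrs E b \<union> {b, x})) = deg x + card (nbrs E b \<union> {b, x})"
    using x nbrs_sym[of b E x] by (intro card_Un_disjoint) auto
  moreover have "card (nbrs E b \<union> {b, x}) = deg b + 2"
    using x by (subst card_Un_disjoint) auto
  \<comment> \<open>\<open>3 * (deg x + deg b + 2) \<le> 4 * \<Delta> + 3\<close>, and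
    \<open>2 * deg b \<ge> \<Delta> + 2\<close> because \<open>b\<close> is the end of larger
    degree.\<close>
  ultimately have "deg x + 3 \<le> \<Delta>" using d n by linarith
  then show False
    using u(2) no_dist3[OF e d(1,2) _ uy yx(2) dd(1)] no_dist3[OF e' d' _ uy yx(2) dd(2)] by blast
qed

end

subsection \<open>A full-deficiency pair with a vertex of degree two\<close>

locale critical_deg2 = critical_graph V E \<Delta> for V :: "'v set" and E \<Delta> +
  fixes a b c :: 'v
  assumes nba: "nbrs E a = {b, c}" and bc: "b \<noteq> c" and degb: "deg b = \<Delta>" and degc: "deg c = \<Delta>"
    and dense: "3 * card V \<le> 4 * \<Delta> + 3"
begin

abbreviation "Ea \<equiv> E - {{a, b}} - {{a, c}}"

lemma ab: "{a, b} \<in> E" "{a, c} \<in> E" "a \<noteq> b" "a \<noteq> c"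
  using nba by (auto simp: nbrs_def)

lemma dega: "deg a = 2"
  using nba bc by simp

lemma nbrs_b_full: "u \<in> nbrs E b \<Longrightarrow> u \<noteq> a \<Longrightarrow> deg u = \<Delta>"
  and nbrs_c_full: "u \<in> nbrs E c \<Longrightarrow> u \<noteq> a \<Longrightarrow> deg u = \<Delta>"
  using nbr_full[OF ab(1)] nbr_full[OF ab(2)] dega degb degc by auto

lemma nbrs_Ea: "v \<noteq> a \<Longrightarrow> v \<noteq> b \<Longrightarrow> v \<noteq> c \<Longrightarrow> nbrs Ea v = nbrs E v"
  by (simp add: nbrs_Diff_other)

lemma Ea_I: "{v, w} \<in> E \<Longrightarrow> v \<noteq> a \<Longrightarrow> w \<noteq> a \<Longrightarrow> {v, w} \<in> Ea"
  by (auto simp: doubleton_eq_iff)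

lemma card_nbrs_Ea: "Suc (card (nbrs Ea b)) = \<Delta>" "Suc (card (nbrs Ea c)) = \<Delta>"
proof -
  have "nbrs Ea b = nbrs E b - {a}" "nbrs Ea c = nbrs E c - {a}"
    using ab bc by (auto simp: nbrs_def doubleton_eq_iff)
  moreover have "a \<in> nbrs E b" "a \<in> nbrs E c" using nba nbrs_sym by fast+
  ultimately show "Suc (card (nbrs Ea b)) = \<Delta>" "Suc (card (nbrs Ea c)) = \<Delta>"
    using degb degc by (metis card_Suc_Diff1 finite_nbrs)+
qed

lemma Ea_a:
  assumes "mcol K Ea m" "i \<in> K" shows "m i a = a"
proof (rule ccontr)
  assume "m i a \<noteq> a"
  then have "{a, m i a} \<in> Ea" "m i a \<noteq> a" using mcol_edge[OF assms] by auto
  moreover from this have "m i a \<in> nbrs E a" by (auto simp: nbrs_def)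
  ultimately show False using nba by auto
qed

lemma misses1_ex:
  assumes m: "mcol K Ea m" and v: "Suc (card (nbrs Ea v)) = \<Delta>"
  shows "\<exists>i. misses1 K m v i"
proof -
  have "card {i\<in>K. m i v = v} = 1" using card_missing[OF m, of v] v by linarith
  then obtain i where "{i\<in>K. m i v = v} = {i}" by (auto simp: card_1_singleton_iff)
  then have "misses1 K m v i" unfolding misses1_def by blast
  then show ?thesis by blast
qed

text \<open>Two different missing colours could be given to \<open>ab\<close> and
  \<open>ac\<close>.\<close>

lemma twin_Ea: "twin K Ea b c"
  unfolding twin_def
proof (intro conjI allI impI)
  show "fin_graph Ea" using fin_graph_E fin_graph_Diff by blast
  show "b \<noteq> c" by (rule bc)
  fix m assume m: "mcol K Ea m"
  obtain i where i: "misses1 K m b i" using misses1_ex[OF m card_nbrs_Ea(1)] by blast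
  obtain j where j: "misses1 K m c j" using misses1_ex[OF m card_nbrs_Ea(2)] by blast
  have "i = j"
  proof (rule ccontr)
    assume ne: "i \<noteq> j"
    have ij: "i \<in> K" "j \<in> K" "m i b = b" "m j c = c" using i j by (auto simp: misses1_def)
    have e: "{a, c} \<in> E - {{a, b}}" using ab bc by (auto simp: doubleton_eq_iff)
    have "mcol K (E - {{a, b}}) (colour_edge m j a c)"
      using mcol_colour_edge'[OF m e ij(2)] Ea_a[OF m ij(2)] ij ab by auto
    then have "mcol K E (colour_edge (colour_edge m j a c) i a b)"
      using mcol_colour_edge'[OF _ ab(1) ij(1)] Ea_a[OF m ij(1)] ij ab bc ne by (auto simp: colour_edge_simps)
    then show False using nocol by blast
  qed
  then show "\<exists>i. misses1 K m b i \<and> misses1 K m c i" using i j by blast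
qed

lemma Ea_col: "\<exists>m. mcol K Ea m"
proof -
  obtain m where m: "mcol K (E - {{a, b}}) m" using crit[OF ab(1)] by blast
  have "{a, c} \<in> E - {{a, b}}" using ab bc by (auto simp: doubleton_eq_iff)
  then obtain i where i: "i \<in> K" "m i a = c" using mcol_ex[OF m _ ab(4)] by blast
  show ?thesis using mcol_uncolour[OF m i ab(4)] by blast
qed

section \<open>Neighbourhoods of deficient vertices\<close>

lemma deficient_nbrs:
  assumes "v \<noteq> a" "v \<noteq> b" "v \<noteq> c" "deg v < \<Delta>"
  shows "v \<notin> nbrs E b" "v \<notin> nbrs E c" "v \<notin> nbrs E a"
  using nbrs_b_full nbrs_c_full assms nba by auto

lemma low_nbrs_disjoint:
  assumes v: "v \<noteq> a" "v \<noteq> b" "v \<noteq> c" "deg v + 2 \<le> \<Delta>"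
  shows "nbrs E v \<inter> nbrs E b = {}" "nbrs E v \<inter> nbrs E c = {}"
proof -
  have *: "nbrs E v \<inter> nbrs E b' = {}" if T: "twin K Ea b' c'" and b': "b' \<in> {b, c}" "c' \<in> {b, c}" for b' c'
  proof (rule ccontr)
    assume "\<not> ?thesis"
    then obtain w where w: "w \<in> nbrs E v" "w \<in> nbrs E b'" by blast
    have dv: "v \<notin> nbrs E b" "v \<notin> nbrs E c" "v \<notin> nbrs E a" using deficient_nbrs v by auto
    have wn: "w \<noteq> a" "w \<noteq> b" "w \<noteq> c" using w(1) dv nbrs_sym by fast+
    have "w \<noteq> v" "b' \<noteq> c'" using w T by (auto simp: twin_def)
    then have d: "distinct [b', c', w, v]" using wn b' v by auto
    have e: "{b', w} \<in> Ea" "{w, v} \<in> Ea"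
      using w wn v b' ab nbrs_sym[of w E v] by (auto simp: nbrs_iff intro!: Ea_I)
    obtain m where m: "mcol K Ea m" using Ea_col by blast
    have "card {i\<in>K. m i v = v} + deg v = \<Delta>" using card_missing[OF m, of v] nbrs_Ea[OF v(1-3)] by simp
    then have "2 \<le> card {i\<in>K. m i v = v}" using v by linarith
    then obtain p q where "p \<in> K" "q \<in> K" "p \<noteq> q" "m p v = v" "m q v = v"
      using card_ge_2_ex[of "{i\<in>K. m i v = v}"] by blast
    then show False using twin_two_missing[OF T m _ _ _ _ _ e d] by blast
  qed
  show "nbrs E v \<inter> nbrs E b = {}" using *[OF twin_Ea] by blast
  show "nbrs E v \<inter> nbrs E c = {}" using *[OF twin_sym[OF twin_Ea]] by blast
qed

text \<open>The sets \<open>nbrs E v\<close>, \<open>nbrs E b\<close>, \<open>{b, v}\<close> and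
  \<open>W\<close> are disjoint. With \<open>dense\<close> this gives
  \<open>3 * deg v + 3 \<le> \<Delta>\<close>; \<open>W\<close> makes room for a second vertex of
  low degree.\<close>

lemma low_degree:
  assumes v: "v \<in> V" "v \<noteq> a" "v \<noteq> b" "v \<noteq> c" "deg v + 2 \<le> \<Delta>"
    and W: "W \<subseteq> V" "W \<inter> nbrs E v = {}" "W \<inter> nbrs E b = {}" "b \<notin> W" "v \<notin> W" "finite W"
  shows "deg v + \<Delta> + 2 + card W \<le> card V" "2 \<le> deg v"
proof -
  have dj: "nbrs E v \<inter> nbrs E b = {}" using low_nbrs_disjoint v by blast
  have dn: "v \<notin> nbrs E b" "b \<notin> nbrs E v" using deficient_nbrs v nbrs_sym[of b E v] by auto
  have bV: "b \<in> V" using EV[OF ab(1)] by simp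
  have "card (nbrs E v \<union> (nbrs E b \<union> ({b, v} \<union> W))) \<le> card V"
    using nbrs_V bV v W finV by (intro card_mono) auto
  moreover have "card ({b, v} \<union> W) = 2 + card W" using W v by (subst card_Un_disjoint) auto
  moreover have "card (nbrs E b \<union> ({b, v} \<union> W)) = \<Delta> + card ({b, v} \<union> W)"
    using W dn degb by (subst card_Un_disjoint) auto
  moreover have "card (nbrs E v \<union> (nbrs E b \<union> ({b, v} \<union> W))) = deg v + card (nbrs E b \<union> ({b, v} \<union> W))"
    using W dn dj by (intro card_Un_disjoint) auto
  ultimately show "deg v + \<Delta> + 2 + card W \<le> card V" by linarith
  obtain w where "w \<in> nbrs E v" using noiso v by blast
  then have "{v, w} \<in> E" by (simp add: nbrs_iff)
  then show "2 \<le> deg v" using edge_sum[of v w] deg_le[of w] by linarith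
qed

text \<open>This prepares \<open>common_neighbour\<close> for a neighbour \<open>y\<close> in place
  of \<open>v\<close>. If \<open>y\<close> had low degree as well, both degrees would be below
  \<open>\<Delta> / 3\<close>, against \<open>edge_sum\<close>.\<close>

lemma low_nbr:
  assumes v: "v \<in> V" "v \<noteq> a" "v \<noteq> b" "v \<noteq> c" "deg v + 2 \<le> \<Delta>" and y: "y \<in> nbrs E v"
  shows "y \<in> V" "y \<noteq> a" "y \<noteq> b" "y \<noteq> c" "y \<notin> nbrs E b" "y \<notin> nbrs E c" "\<Delta> \<le> deg y + 1" "y \<noteq> v"
proof -
  have dn: "v \<notin> nbrs E b" "v \<notin> nbrs E c" "v \<notin> nbrs E a" using deficient_nbrs v by auto
  show yV: "y \<in> V" using y nbrs_V by blast
  show ny: "y \<noteq> a" "y \<noteq> b" "y \<noteq> c" using dn y nbrs_sym by fast+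
  show "y \<notin> nbrs E b" "y \<notin> nbrs E c" using low_nbrs_disjoint[OF v(2-)] y by auto
  show "y \<noteq> v" using y by auto
  show "\<Delta> \<le> deg y + 1"
  proof (rule ccontr)
    assume "\<not> ?thesis"
    then have "deg y + \<Delta> + 2 + 0 \<le> card V" using low_degree(1)[OF yV ny, of "{}"] by simp
    moreover have "deg v + \<Delta> + 2 + 0 \<le> card V" using low_degree(1)[OF v, of "{}"] by simp
    moreover have "\<Delta> + 2 \<le> deg v + deg y" using edge_sum y by (simp add: nbrs_iff)
    ultimately show False using dense by linarith
  qed
qed

text \<open>Outside \<open>?T\<close> each of \<open>b\<close>, \<open>c\<close>, \<open>s1\<close>,
  \<open>s2\<close> has at most \<open>card V - 3 - \<Delta>\<close> non-neighbours: within
  \<open>?T\<close> there are at least three for \<open>b\<close> and \<open>c\<close>, and four for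
  \<open>s1\<close> and \<open>s2\<close>, which make up for a degree of
  \<open>\<Delta> - 1\<close>. Four times this number is less than
  \<open>card V - 5\<close>.\<close>

lemma common_neighbour:
  assumes s: "s1 \<in> V" "s1 \<notin> {a, b, c}" "s1 \<notin> nbrs E b" "s1 \<notin> nbrs E c" "\<Delta> \<le> deg s1 + 1"
    and s': "s2 \<in> V" "s2 \<notin> {a, b, c}" "s2 \<notin> nbrs E b" "s2 \<notin> nbrs E c" "\<Delta> \<le> deg s2 + 1" and ne: "s1 \<noteq> s2"
  obtains u where "distinct [b, c, u, s1, s2]" "{b, u} \<in> Ea" "{c, u} \<in> Ea" "{u, s1} \<in> Ea" "{u, s2} \<in> Ea"
    "u \<in> nbrs E b" "u \<in> V"
proof -
  let ?T = "{a, b, c, s1, s2}"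
  have TV: "?T \<subseteq> V" using s s' EV[OF ab(1)] EV[OF ab(2)] by auto
  have T5: "card ?T = 5" using s s' ne ab bc by auto
  have cnt: "card (V - nbrs E w - ?T) + card P + deg w \<le> card V"
    if P: "P \<subseteq> ?T" "P \<inter> nbrs E w = {}" for w P
  proof -
    have fP: "finite P" using P by (meson finite.emptyI finite.insertI finite_subset)
    have "card ((V - nbrs E w - ?T) \<union> (P \<union> nbrs E w)) \<le> card V"
      using nbrs_V P TV finV by (intro card_mono) auto
    moreover have "card ((V - nbrs E w - ?T) \<union> (P \<union> nbrs E w)) = card (V - nbrs E w - ?T) + card (P \<union> nbrs E w)"
      using P finV fP by (intro card_Un_disjoint) auto
    moreover have "card (P \<union> nbrs E w) = card P + deg w" using P fP by (intro card_Un_disjoint) auto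
    ultimately show ?thesis by linarith
  qed
  have na: "s1 \<notin> nbrs E a" "s2 \<notin> nbrs E a" using nba s s' by auto
  have "card (V - nbrs E b - ?T) + 3 + \<Delta> \<le> card V"
    using cnt[of "{b, s1, s2}" b] s s' ne degb by auto
  moreover have "card (V - nbrs E c - ?T) + 3 + \<Delta> \<le> card V"
    using cnt[of "{c, s1, s2}" c] s s' ne degc by auto
  moreover have "card (V - nbrs E s1 - ?T) + 4 + deg s1 \<le> card V"
  proof -
    have "a \<notin> nbrs E s1" "b \<notin> nbrs E s1" "c \<notin> nbrs E s1" using s na nbrs_sym by fast+
    then show ?thesis using cnt[of "{a, b, c, s1}" s1] s ab bc by auto
  qed
  moreover have "card (V - nbrs E s2 - ?T) + 4 + deg s2 \<le> card V"
  proof -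
    have "a \<notin> nbrs E s2" "b \<notin> nbrs E s2" "c \<notin> nbrs E s2" using s' na nbrs_sym by fast+
    then show ?thesis using cnt[of "{a, b, c, s2}" s2] s' ab bc by auto
  qed
  moreover have "card (V - ?T) + 5 = card V"
    using T5 TV finV by (metis card_Diff_subset card_mono finite_subset le_add_diff_inverse2)
  ultimately have lt: "card (V - nbrs E b - ?T) + card (V - nbrs E c - ?T) + card (V - nbrs E s1 - ?T) + card (V - nbrs E s2 - ?T)
      < card (V - ?T)" using dense s s' by linarith
  have "\<exists>u\<in>V - ?T. u \<in> nbrs E b \<and> u \<in> nbrs E c \<and> u \<in> nbrs E s1 \<and> u \<in> nbrs E s2"
  proof (rule ccontr)
    assume "\<not> ?thesis"
    then have "V - ?T \<subseteq> ((V - nbrs E b - ?T) \<union> (V - nbrs E c - ?T)) \<union> ((V - nbrs E s1 - ?T) \<union> (V - nbrs E s2 - ?T))"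
      by blast
    then have "card (V - ?T) \<le> card (((V - nbrs E b - ?T) \<union> (V - nbrs E c - ?T)) \<union> ((V - nbrs E s1 - ?T) \<union> (V - nbrs E s2 - ?T)))"
      using finV by (intro card_mono) auto
    also have "\<dots> \<le> card ((V - nbrs E b - ?T) \<union> (V - nbrs E c - ?T)) + card ((V - nbrs E s1 - ?T) \<union> (V - nbrs E s2 - ?T))"
      by (rule card_Un_le)
    also have "\<dots> \<le> card (V - nbrs E b - ?T) + card (V - nbrs E c - ?T) + (card (V - nbrs E s1 - ?T) + card (V - nbrs E s2 - ?T))"
      by (intro add_mono card_Un_le)
    finally show False using lt by linarith
  qed
  then obtain u where u: "u \<in> V" "u \<notin> ?T" "u \<in> nbrs E b" "u \<in> nbrs E c" "u \<in> nbrs E s1" "u \<in> nbrs E s2" by blast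
  show thesis
  proof (rule that[of u])
    show "distinct [b, c, u, s1, s2]" using u s s' ne bc by auto
    show "{b, u} \<in> Ea" "{c, u} \<in> Ea" using u ab by (auto simp: nbrs_iff intro!: Ea_I)
    show "{u, s1} \<in> Ea" using u s nbrs_iff[of u s1] by (intro Ea_I) (auto simp: insert_commute)
    show "{u, s2} \<in> Ea" using u s' nbrs_iff[of u s2] by (intro Ea_I) (auto simp: insert_commute)
  qed (use u in auto)
qed

end

context critical_deg2
begin

section \<open>At most one deficient vertex\<close>

lemma deficient_missing:
  assumes "mcol K Ea m" "v \<noteq> a" "v \<noteq> b" "v \<noteq> c" "deg v < \<Delta>"
  obtains t where "t \<in> K" "m t v = v"
proof -
  have "card {i\<in>K. m i v = v} + deg v = \<Delta>" using card_missing[OF assms(1), of v] nbrs_Ea[OF assms(2-4)] by simp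
  then have "card {i\<in>K. m i v = v} > 0" using assms by linarith
  then show thesis using that by (auto simp: card_gt_0_iff)
qed

lemma no_two_high:
  assumes v: "v1 \<in> V" "v1 \<notin> {a, b, c}" "deg v1 < \<Delta>" "\<Delta> \<le> deg v1 + 1"
    and w: "v2 \<in> V" "v2 \<notin> {a, b, c}" "deg v2 < \<Delta>" "\<Delta> \<le> deg v2 + 1" and ne: "v1 \<noteq> v2"
  shows False
proof -
  have v': "v1 \<noteq> a" "v1 \<noteq> b" "v1 \<noteq> c" and w': "v2 \<noteq> a" "v2 \<noteq> b" "v2 \<noteq> c" using v w by auto
  obtain u where u: "distinct [b, c, u, v1, v2]" "{b, u} \<in> Ea" "{c, u} \<in> Ea" "{u, v1} \<in> Ea" "{u, v2} \<in> Ea"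
    "u \<in> nbrs E b" "u \<in> V"
    by (rule common_neighbour[OF v(1,2) deficient_nbrs(1,2)[OF v' v(3)] v(4) w(1,2) deficient_nbrs(1,2)[OF w' w(3)] w(4) ne])
  obtain m where m: "mcol K Ea m" using Ea_col by blast
  obtain t1 where t1: "t1 \<in> K" "m t1 v1 = v1" by (rule deficient_missing[OF m v' v(3)])
  obtain t2 where t2: "t2 \<in> K" "m t2 v2 = v2" by (rule deficient_missing[OF m w' w(3)])
  show False using twin_kite[OF twin_Ea m t1 t2 u(2-5,1)] .
qed

text \<open>A neighbour \<open>s1\<close> of \<open>v1\<close> takes the place of \<open>v1\<close>
  in the kite, and \<open>v1 s1\<close> is uncoloured: \<open>leaf_cfg\<close> with
  \<open>S = {v1}\<close>.\<close>

lemma no_low_high: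
  assumes v: "v1 \<in> V" "v1 \<notin> {a, b, c}" "deg v1 + 2 \<le> \<Delta>"
    and w: "v2 \<in> V" "v2 \<notin> {a, b, c}" "deg v2 < \<Delta>" "\<Delta> \<le> deg v2 + 1"
  shows False
proof -
  have v': "v1 \<noteq> a" "v1 \<noteq> b" "v1 \<noteq> c" and w': "v2 \<noteq> a" "v2 \<noteq> b" "v2 \<noteq> c" using v w by auto
  have ne: "v1 \<noteq> v2" using v w by auto
  obtain m0 where m0: "mcol K Ea m0" using Ea_col by blast
  obtain t2 where t2: "t2 \<in> K" "m0 t2 v2 = v2" by (rule deficient_missing[OF m0 w' w(3)])
  have dv: "2 \<le> deg v1" "deg v1 + \<Delta> + 2 \<le> card V"
    using low_degree[OF v(1) v' v(3), of "{}"] by auto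
  \<comment> \<open>Both witnesses must be missing at \<open>v1\<close> in the end. If
    \<open>t2\<close> is present there, its edge is the one to be uncoloured; otherwise any edge to
    a vertex other than \<open>v2\<close> will do.\<close>
  obtain s1 t1 where s1: "s1 \<in> nbrs E v1" "s1 \<noteq> v2" "t1 \<in> K" "m0 t1 v1 = s1" "m0 t2 v1 = v1 \<or> t2 = t1"
  proof (cases "m0 t2 v1 = v1")
    case False
    have "{v1, m0 t2 v1} \<in> Ea" using mcol_edge[OF m0 t2(1) False] .
    then have "m0 t2 v1 \<in> nbrs E v1" using False by (simp add: nbrs_def)
    moreover have "m0 t2 v1 \<noteq> v2" using mcol_sym[OF m0 t2(1), of v1 v2] t2 ne by auto
    ultimately show thesis using that t2 by blast
  next
    case True
    obtain y where y: "y \<in> nbrs E v1" "y \<noteq> v2" using card_ge_2_ex[OF dv(1)] by metis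
    have ya: "y \<noteq> a" "v1 \<noteq> y" using low_nbr[OF v(1) v' v(3) y(1)] by auto
    then have "{v1, y} \<in> Ea" using y v' by (intro Ea_I) (auto simp: nbrs_iff)
    then obtain t where "t \<in> K" "m0 t v1 = y" using mcol_ex[OF m0 _ ya(2)] by blast
    then show thesis using that y True by blast
  qed
  note sp = low_nbr[OF v(1) v' v(3) s1(1)]
  have s1n: "s1 \<notin> {a, b, c}" using sp by auto
  obtain u where u: "distinct [b, c, u, s1, v2]" "{b, u} \<in> Ea" "{c, u} \<in> Ea" "{u, s1} \<in> Ea" "{u, v2} \<in> Ea"
    "u \<in> nbrs E b" "u \<in> V"
    by (rule common_neighbour[OF sp(1) s1n sp(5-7) w(1,2) deficient_nbrs(1,2)[OF w' w(3)] w(4) s1(2)])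
  have uv: "u \<noteq> v1" using u(6) deficient_nbrs[OF v'] v by auto
  let ?F = "Ea - {{v1, s1}}"
  have e: "{v1, s1} \<in> Ea" using s1(1) v' sp by (intro Ea_I) (auto simp: nbrs_iff)
  have d: "distinct [v1, s1, u, b, c, v2]" using u(1) uv v' ne sp by auto
  have nbF: "Suc (card (nbrs ?F v1)) = deg v1"
  proof -
    have "nbrs ?F v1 = nbrs Ea v1 - {s1}" "s1 \<in> nbrs Ea v1" using e sp by (auto simp: nbrs_def doubleton_eq_iff)
    then show ?thesis using nbrs_Ea[OF v'] by (metis card_Suc_Diff1 finite_nbrs)
  qed
  have R: "leaf_cfg K ?F {v1} b c u s1 v2"
    unfolding leaf_cfg_def
  proof (intro conjI allI impI)
    show "fin_graph ?F" using twin_fin_graph[OF twin_Ea] fin_graph_Diff by blast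
    show "finite K" by simp
    show "distinct [b, c, u, s1, v2]" by (rule u(1))
    show "b \<notin> {v1}" "c \<notin> {v1}" using v' by auto
    show "{b, u} \<in> ?F" "{c, u} \<in> ?F" "{u, s1} \<in> ?F" "{u, v2} \<in> ?F"
      using u d by (auto simp: doubleton_eq_iff)
    \<comment> \<open>The number is \<open>\<Delta> - deg v1 + 1\<close>. From
      \<open>3 * deg v1 + 3 \<le> \<Delta>\<close> and \<open>deg v1 \<ge> 2\<close> follow
      \<open>\<Delta> \<ge> 9\<close> and the lower bound \<open>2 * \<Delta> / 3 + 2\<close>, hence
      8.\<close>
    show "8 \<le> card (common K {v1} m)" if m: "mcol K ?F m" for m
    proof -
      have "common K {v1} m = {i\<in>K. m i v1 = v1}" by (auto simp: common_def)
      then have "card (common K {v1} m) + card (nbrs ?F v1) = \<Delta>" using card_missing[OF m, of v1] by simp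
      then show ?thesis using nbF dv dense by linarith
    qed
    fix m t1 t2 assume m: "mcol K ?F m" and t: "t1 \<in> common K {v1} m" "m t1 s1 = s1"
    have t1: "t1 \<in> K" "m t1 v1 = v1" using t by (auto simp: common_def)
    have "mcol K Ea (colour_edge m t1 v1 s1)" using mcol_colour_edge'[OF m e t1 t(2)] d by auto
    then obtain i where "misses1 K (colour_edge m t1 v1 s1) b i" "misses1 K (colour_edge m t1 v1 s1) c i"
      using twin_Ea unfolding twin_def by blast
    then show "\<exists>i. misses1 K m b i \<and> misses1 K m c i" using d by (auto simp: misses1_def colour_edge_simps)
  qed
  let ?m = "uncolour m0 t1 v1 s1"
  have m: "mcol K ?F ?m" using mcol_uncolour[OF m0 s1(3,4)] d by auto
  show False
    by (rule leaf_cfg_False[OF R m, of t1 t2]) (use s1 t2 d in \<open>auto simp: common_def uncolour_simps\<close>)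
qed

lemma no_two_low:
  assumes v: "v1 \<in> V" "v1 \<notin> {a, b, c}" "deg v1 + 2 \<le> \<Delta>"
    and w: "v2 \<in> V" "v2 \<notin> {a, b, c}" "deg v2 + 2 \<le> \<Delta>" and ne: "v1 \<noteq> v2"
  shows False
proof -
  have v': "v1 \<noteq> a" "v1 \<noteq> b" "v1 \<noteq> c" and w': "v2 \<noteq> a" "v2 \<noteq> b" "v2 \<noteq> c" using v w by auto
  have nadj: "v2 \<notin> nbrs E v1" "v1 \<notin> nbrs E v2"
    using low_nbr(7)[OF v(1) v' v(3)] low_nbr(7)[OF w(1) w' w(3)] w v by fastforce+
  have dv: "2 \<le> deg v1" "deg v1 + \<Delta> + 3 \<le> card V"
    using low_degree[OF v(1) v' v(3), of "{v2}"] w w' ne nadj deficient_nbrs[OF w'] by auto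
  have dw: "2 \<le> deg v2" "deg v2 + \<Delta> + 3 \<le> card V"
    using low_degree[OF w(1) w' w(3), of "{v1}"] v v' ne nadj deficient_nbrs[OF v'] by auto
  obtain m0 where m0: "mcol K Ea m0" using Ea_col by blast
  have nbE: "m0 t x \<in> nbrs E x" if "t \<in> K" "m0 t x \<noteq> x" for t x
    using mcol_edge[OF m0 that] that by (simp add: nbrs_def)
  have colour: "\<exists>t\<in>K. m0 t x = y" if x: "x \<in> V" "x \<notin> {a, b, c}" "deg x + 2 \<le> \<Delta>" and y: "y \<in> nbrs E x" for x y
  proof -
    have "y \<noteq> a" "x \<noteq> y" using low_nbr[of x y] x y by auto
    moreover from this have "{x, y} \<in> Ea" using x y by (intro Ea_I) (auto simp: nbrs_iff)
    ultimately show ?thesis using mcol_ex[OF m0] by blast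
  qed
  \<comment> \<open>Both witnesses must be missing at \<open>v1\<close> and \<open>v2\<close> once
    the two edges are uncoloured. If the colour of one chosen edge occurs at the other vertex too,
    the two edges of that colour are taken instead.\<close>
  obtain s1 s2 t1 t2 where s: "s1 \<in> nbrs E v1" "s2 \<in> nbrs E v2" "s1 \<noteq> s2" "t1 \<in> K" "t2 \<in> K" "m0 t1 v1 = s1" "m0 t2 v2 = s2"
     "m0 t1 v2 = v2 \<or> t1 = t2" "m0 t2 v1 = v1 \<or> t1 = t2"
  proof -
    note main = that
    have same: thesis if t: "t \<in> K" "m0 t v1 \<noteq> v1" "m0 t v2 \<noteq> v2" for t
    proof -
      have "m0 t v1 \<noteq> m0 t v2" using mcol_invol[OF m0 t(1)] ne by metis
      then show thesis using main[of "m0 t v1" "m0 t v2" t t] t nbE by blast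
    qed
    obtain y1 where y1: "y1 \<in> nbrs E v1" using noiso v by blast
    obtain y2 where y2: "y2 \<in> nbrs E v2" "y2 \<noteq> y1" using card_ge_2_ex[OF dw(1)] by metis
    obtain t1 where t1: "t1 \<in> K" "m0 t1 v1 = y1" using colour[OF v y1] by blast
    obtain t2 where t2: "t2 \<in> K" "m0 t2 v2 = y2" using colour[OF w y2(1)] by blast
    have n: "y1 \<noteq> v1" "y2 \<noteq> v2" using y1 y2 nbrs_self by metis+
    show thesis
    proof (cases "m0 t1 v2 = v2 \<and> m0 t2 v1 = v1")
      case True then show thesis using main[of y1 y2 t1 t2] y1 y2 t1 t2 by blast
    next
      case False then show thesis using same[of t1] same[of t2] t1 t2 n by auto
    qed
  qed
  note sp = low_nbr[OF v(1) v' v(3) s(1)] and sq = low_nbr[OF w(1) w' w(3) s(2)]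
  have sn: "s1 \<notin> {a, b, c}" "s2 \<notin> {a, b, c}" using sp sq by auto
  obtain u where u: "distinct [b, c, u, s1, s2]" "{b, u} \<in> Ea" "{c, u} \<in> Ea" "{u, s1} \<in> Ea" "{u, s2} \<in> Ea"
    "u \<in> nbrs E b" "u \<in> V"
    by (rule common_neighbour[OF sp(1) sn(1) sp(5-7) sq(1) sn(2) sq(5-7) s(3)])
  have uv: "u \<noteq> v1" "u \<noteq> v2" using u(6) deficient_nbrs[OF v'] deficient_nbrs[OF w'] v w by auto
  have sv: "s1 \<noteq> v2" "s2 \<noteq> v1" using s nadj by auto
  have d: "distinct [v1, v2, s1, s2, u, b, c]" using u(1) uv v' w' ne sp sq sv by auto
  let ?F1 = "Ea - {{v1, s1}}"
  let ?F = "?F1 - {{v2, s2}}"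
  have e1: "{v1, s1} \<in> Ea" using s(1) v' sp by (intro Ea_I) (auto simp: nbrs_iff)
  have e2: "{v2, s2} \<in> ?F1" using s(2) w' sq d Ea_I[of v2 s2] by (auto simp: nbrs_iff doubleton_eq_iff)
  have nbF: "Suc (card (nbrs ?F v1)) = deg v1" "Suc (card (nbrs ?F v2)) = deg v2"
  proof -
    have "nbrs ?F v1 = nbrs Ea v1 - {s1}" "s1 \<in> nbrs Ea v1" using e1 d by (auto simp: nbrs_def doubleton_eq_iff)
    then show "Suc (card (nbrs ?F v1)) = deg v1" using nbrs_Ea[OF v'] by (metis card_Suc_Diff1 finite_nbrs)
    have "nbrs ?F v2 = nbrs Ea v2 - {s2}" "s2 \<in> nbrs Ea v2" using e2 d by (auto simp: nbrs_def doubleton_eq_iff)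
    then show "Suc (card (nbrs ?F v2)) = deg v2" using nbrs_Ea[OF w'] by (metis card_Suc_Diff1 finite_nbrs)
  qed
  have R: "leaf_cfg K ?F {v1, v2} b c u s1 s2"
    unfolding leaf_cfg_def
  proof (intro conjI allI impI)
    show "fin_graph ?F" using twin_fin_graph[OF twin_Ea] fin_graph_Diff by blast
    show "finite K" by simp
    show "distinct [b, c, u, s1, s2]" by (rule u(1))
    show "b \<notin> {v1, v2}" "c \<notin> {v1, v2}" using v' w' by auto
    show "{b, u} \<in> ?F" "{c, u} \<in> ?F" "{u, s1} \<in> ?F" "{u, s2} \<in> ?F"
      using u(2-5) d by (auto simp: doubleton_eq_iff)
    \<comment> \<open>Now \<open>3 * deg + 6 \<le> \<Delta>\<close> for both vertices, so at most
      \<open>2 * \<Delta> / 3 - 6\<close> colours occur at \<open>v1\<close> or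
      \<open>v2\<close>.\<close>
    show "8 \<le> card (common K {v1, v2} m)" if m: "mcol K ?F m" for m
    proof -
      let ?A = "{i\<in>K. m i v1 \<noteq> v1}" and ?B = "{i\<in>K. m i v2 \<noteq> v2}"
      have "card K = card (common K {v1, v2} m \<union> (?A \<union> ?B))"
        by (rule arg_cong[where f = card]) (auto simp: common_def)
      also have "\<dots> \<le> card (common K {v1, v2} m) + card (?A \<union> ?B)" by (rule card_Un_le)
      finally have 1: "\<Delta> \<le> card (common K {v1, v2} m) + card (?A \<union> ?B)" by simp
      have 2: "card (?A \<union> ?B) \<le> card ?A + card ?B" by (rule card_Un_le)
      have 3: "card ?A = card (nbrs ?F v1)" "card ?B = card (nbrs ?F v2)"
        using mcol_degree[OF m, of v1] mcol_degree[OF m, of v2] unfolding nbrs_def .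
      show ?thesis using 1 2 3 nbF dv dw dense by linarith
    qed
    fix m t1 t2 assume m: "mcol K ?F m"
      and t: "t1 \<in> common K {v1, v2} m" "t2 \<in> common K {v1, v2} m" "m t1 s1 = s1" "m t2 s2 = s2"
    have tt: "t1 \<in> K" "m t1 v1 = v1" "t2 \<in> K" "m t2 v2 = v2" using t by (auto simp: common_def)
    let ?n = "colour_edge m t2 v2 s2"
    have n: "mcol K ?F1 ?n" using mcol_colour_edge'[OF m e2 tt(3,4) t(4)] d by auto
    have "?n t1 v1 = v1" "?n t1 s1 = s1" using tt t d by (auto simp: colour_edge_simps)
    then have "mcol K Ea (colour_edge ?n t1 v1 s1)" using mcol_colour_edge'[OF n e1 tt(1)] d by auto
    then obtain i where i: "misses1 K (colour_edge ?n t1 v1 s1) b i" "misses1 K (colour_edge ?n t1 v1 s1) c i"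
      using twin_Ea unfolding twin_def by blast
    have "colour_edge ?n t1 v1 s1 j x = m j x" if "x \<in> {b, c}" for j x using that d by (auto simp: colour_edge_simps)
    then show "\<exists>i. misses1 K m b i \<and> misses1 K m c i" using i by (auto simp: misses1_def)
  qed
  let ?m1 = "uncolour m0 t1 v1 s1"
  have m1: "mcol K ?F1 ?m1" using mcol_uncolour[OF m0 s(4,6)] d by auto
  let ?m = "uncolour ?m1 t2 v2 s2"
  have "?m1 t2 v2 = s2" using s(7) d by (auto simp: uncolour_simps)
  then have m: "mcol K ?F ?m" using mcol_uncolour[OF m1 s(5)] d by auto
  show False
    by (rule leaf_cfg_False[OF R m, of t1 t2]) (use s(4-) d in \<open>auto simp: common_def uncolour_simps\<close>)
qed

text \<open>Without \<open>a\<close>, every colour covers all of \<open>W\<close> and both or none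
  of \<open>b\<close> and \<open>c\<close>. Hence covering \<open>v\<close> determines the parity of
  \<open>card W\<close>; but some colour is missing at \<open>v\<close>, and some colour is present
  there.\<close>

lemma all_full_deg2:
  assumes v: "v \<in> V" "v \<noteq> a" "v \<noteq> b"
  shows "deg v = \<Delta>"
proof (rule ccontr)
  assume nf: "deg v \<noteq> \<Delta>"
  then have lt: "deg v < \<Delta>" using deg_le[of v] by linarith
  have vc: "v \<noteq> c" using nf degc by auto
  have uniq: "deg w = \<Delta>" if w: "w \<in> V" "w \<noteq> a" "w \<noteq> b" "w \<noteq> c" "w \<noteq> v" for w
  proof (rule ccontr)
    assume "deg w \<noteq> \<Delta>"
    then have "deg w < \<Delta>" using deg_le[of w] by linarith
    then show False
      using no_two_high[of v w] no_low_high[of v w] no_low_high[of w v] no_two_low[of v w] lt v vc w by fastforce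
  qed
  obtain m where m: "mcol K Ea m" using Ea_col by blast
  obtain \<beta> where \<beta>: "misses1 K m b \<beta>" "misses1 K m c \<beta>" using twin_Ea m unfolding twin_def by blast
  have present: "m i w \<noteq> w" if "i \<in> K" "w \<in> V" "w \<noteq> a" "w \<noteq> b" "w \<noteq> c" "w \<noteq> v" for i w
  proof
    assume "m i w = w"
    then have "{i\<in>K. m i w = w} \<noteq> {}" using that by blast
    then have "card {i\<in>K. m i w = w} > 0" by (simp add: card_gt_0_iff)
    moreover have "card {i\<in>K. m i w = w} + deg w = \<Delta>" using card_missing[OF m, of w] nbrs_Ea[of w] that by simp
    ultimately show False using uniq[of w] that by linarith
  qed
  obtain j where j: "j \<in> K" "m j v = v" by (rule deficient_missing[OF m v(2,3) vc lt])
  obtain y where y: "y \<in> nbrs E v" using noiso v by blast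
  have ya: "y \<noteq> a" using y vc v nba nbrs_sym by fast
  have yE: "{v, y} \<in> E" using y by (simp add: nbrs_iff)
  obtain i where i: "i \<in> K" "m i v = y" "m i v \<noteq> v"
    using mcol_ex[OF m Ea_I[OF yE v(2) ya] edge_ne[OF yE]] edge_ne[OF yE] by auto
  have par: "even (card {w\<in>V. m k w \<noteq> w})" if "k \<in> K" for k
  proof (rule even_card_nonfixed[OF finV])
    show "m k (m k w) = w" for w using mcol_invol[OF m that] .
    show "m k w \<in> V" if "w \<in> V" for w
      using mcol_edge[OF m \<open>k \<in> K\<close>, of w] EV that by (metis DiffD1 insert_subset)
  qed
  have bcV: "b \<in> V" "c \<in> V" "a \<in> V" using EV[OF ab(1)] EV[OF ab(2)] by auto
  define W where "W = V - {a, b, c, v}"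
  have nonfix: "{w\<in>V. m k w \<noteq> w} = W \<union> (if k = \<beta> then {} else {b, c}) \<union> (if m k v = v then {} else {v})"
    if "k \<in> K" for k
    using present[OF that] Ea_a[OF m that] \<beta> bcV v vc ab that unfolding W_def misses1_def by auto
  have cW: "card {w\<in>V. m k w \<noteq> w} = card W + (if k = \<beta> then 0 else 2) + (if m k v = v then 0 else 1)"
    if "k \<in> K" for k
  proof -
    have "finite W" using finV by (simp add: W_def)
    then show ?thesis unfolding nonfix[OF that] using bc v vc
      by (subst card_Un_disjoint, (auto simp: W_def)[3], subst card_Un_disjoint) (auto simp: W_def)
  qed
  have "even (card W)" using par[OF j(1)] cW[OF j(1)] j(2) by (auto split: if_splits)
  moreover have "odd (card W)" using par[OF i(1)] cW[OF i(1)] i(3) by (auto split: if_splits)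
  ultimately show False by blast
qed

end

lemma (in critical_graph) all_full:
  assumes e: "{a, b} \<in> E" and d: "deg a + deg b = \<Delta> + 2" and n: "3 * card V \<le> 4 * \<Delta> + 3"
    and v: "v \<in> V" "v \<noteq> a" "v \<noteq> b"
  shows "deg v = \<Delta>"
proof -
  have *: "deg v = \<Delta>" if e: "{a, b} \<in> E" and d: "deg a + deg b = \<Delta> + 2" and le: "deg a \<le> deg b"
    and v: "v \<in> V" "v \<noteq> a" "v \<noteq> b" for a b
  proof (cases "3 \<le> deg a")
    case True then show ?thesis using all_full_both_ge3[OF e d True le n v] by blast
  next
    case False
    then have da: "deg a = 2" "deg b = \<Delta>" using d deg_le[of b] by auto
    have bn: "b \<in> nbrs E a" using e by (simp add: nbrs_iff)
    have "card (nbrs E a - {b}) = 1" using da bn by simp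
    then obtain c where c: "nbrs E a - {b} = {c}" by (auto simp: card_1_singleton_iff)
    have nba: "nbrs E a = {b, c}" "b \<noteq> c" using c bn by auto
    then have "c \<in> nbrs E a" "c \<noteq> b" by auto
    moreover have "{b, a} \<in> E" using e by (simp add: insert_commute)
    ultimately have "deg c = \<Delta>" using nbr_full[of b a c] d by (simp add: add.commute)
    then interpret critical_deg2 V E \<Delta> a b c using nba da n by unfold_locales auto
    show ?thesis using all_full_deg2 v by blast
  qed
  show ?thesis
  proof (cases "deg a \<le> deg b")
    case True then show ?thesis using *[OF e d True v] by blast
  next
    case False
    have "{b, a} \<in> E" using e by (simp add: insert_commute)
    then show ?thesis using *[of b a] d False v by (simp add: add.commute)
  qed
qed

subsection \<open>Edge colourings as families of matchings\<close>

lemma card_2_other: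
  assumes "card A = 2" "v \<in> A" shows "\<exists>w. A = {v, w} \<and> v \<noteq> w"
proof -
  obtain x y where "A = {x, y}" "x \<noteq> y" using assms(1) by (auto simp: card_2_iff)
  then show ?thesis using assms(2) by (cases "v = x") (auto simp: insert_commute)
qed

text \<open>The second conjunct lets facts about missing colours return to \<open>c\<close>, as the
  final colouring of \<open>H\<close> requires.\<close>

lemma mcol_of_coloring:
  assumes H: "multigraph H" and inj: "inj_on (ends H) (edges H)" and c: "proper_edge_coloring H k c"
  shows "\<exists>m. mcol {..<k} (ends H ` edges H) m \<and> (\<forall>e\<in>edges H. \<forall>v\<in>ends H e. m (c e) v \<noteq> v)"
proof -
  define R where "R = (\<lambda>i v w. v \<noteq> w \<and> (\<exists>e\<in>edges H. c e = i \<and> ends H e = {v, w}))"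
  have Rsym: "R i v w \<longleftrightarrow> R i w v" for i v w by (auto simp: R_def insert_commute)
  have Runiq: "w = w'" if r: "R i v w" "R i v w'" for i v w w'
  proof -
    obtain e e' where e: "e \<in> edges H" "c e = i" "ends H e = {v, w}" "e' \<in> edges H" "c e' = i" "ends H e' = {v, w'}"
      using r unfolding R_def by blast
    have "e = e'" using c e unfolding proper_edge_coloring_def by (metis Int_iff empty_iff insertI1)
    then show ?thesis using e r by (auto simp: doubleton_eq_iff R_def)
  qed
  define m where "m = (\<lambda>i v. if \<exists>w. R i v w then THE w. R i v w else v)"
  have mR: "m i v = w" if r: "R i v w" for i v w
  proof -
    have "(THE w. R i v w) = w" using r by (rule the_equality) (rule Runiq[OF _ r])
    then show ?thesis using r unfolding m_def by metis
  qed
  have mR': "R i v (m i v)" if n: "m i v \<noteq> v" for i v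
  proof -
    have "\<exists>w. R i v w" using n by (auto simp: m_def split: if_splits)
    then obtain w where w: "R i v w" by blast
    then show ?thesis using mR[OF w] by simp
  qed
  have "mcol {..<k} (ends H ` edges H) m"
    unfolding mcol_def
  proof (intro conjI ballI allI impI)
    fix i v
    show "m i (m i v) = v"
    proof (cases "m i v = v")
      case False
      then show ?thesis using mR'[of i v] mR Rsym by blast
    qed simp
    show "{v, m i v} \<in> ends H ` edges H" if "m i v \<noteq> v" using mR'[OF that] unfolding R_def by blast
  next
    fix v w assume vw: "v \<noteq> w" "{v, w} \<in> ends H ` edges H"
    then obtain e where e: "e \<in> edges H" "ends H e = {v, w}" by auto
    then have "R (c e) v w" using vw by (auto simp: R_def)
    moreover have "c e < k" using c e by (simp add: proper_edge_coloring_def)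
    ultimately show "\<exists>i\<in>{..<k}. m i v = w" using mR by blast
  next
    fix i j v assume "m i v = m j v" "m i v \<noteq> v"
    then have "R i v (m i v)" "R j v (m i v)" using mR'[of i v] mR'[of j v] by auto
    then show "i = j" using inj unfolding R_def inj_on_def by metis
  qed
  moreover have "m (c e) v \<noteq> v" if e: "e \<in> edges H" "v \<in> ends H e" for e v
  proof -
    have "card (ends H e) = 2" using multigraph.card_ends[OF H] e by blast
    then obtain w where "ends H e = {v, w}" "v \<noteq> w" using card_2_other[OF _ e(2)] by blast
    then have "R (c e) v w" using e by (auto simp: R_def)
    then show ?thesis using mR \<open>v \<noteq> w\<close> by metis
  qed
  ultimately show ?thesis by blast
qed

lemma coloring_of_mcol:
  assumes G: "simple_graph G" and m: "mcol {..<k} (ends G ` edges G) m"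
  shows "\<exists>c. proper_edge_coloring G k c"
proof -
  interpret simple_graph G by (rule G)
  define c where "c = (\<lambda>e. SOME i. i < k \<and> (\<forall>v\<in>ends G e. m i v \<noteq> v \<and> ends G e = {v, m i v}))"
  have cP: "c e < k \<and> (\<forall>v\<in>ends G e. m (c e) v \<noteq> v \<and> ends G e = {v, m (c e) v})" if e: "e \<in> edges G" for e
  proof -
    obtain v w where vw: "ends G e = {v, w}" "v \<noteq> w" using card_ends[OF e] by (auto simp: card_2_iff)
    have "{v, w} \<in> ends G ` edges G" using vw e by (metis imageI)
    then obtain i where i: "i \<in> {..<k}" "m i v = w" using mcol_ex[OF m _ vw(2)] by blast
    have "m i w = v" using mcol_sym[OF m i] .
    then have "i < k \<and> (\<forall>v\<in>ends G e. m i v \<noteq> v \<and> ends G e = {v, m i v})" using vw i by auto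
    then show ?thesis unfolding c_def by (rule someI)
  qed
  have "proper_edge_coloring G k c"
    unfolding proper_edge_coloring_def
  proof (intro conjI ballI impI)
    show "c e < k" if "e \<in> edges G" for e using cP[OF that] by blast
    fix e f assume ef: "e \<in> edges G" "f \<in> edges G" "e \<noteq> f \<and> ends G e \<inter> ends G f \<noteq> {}"
    then obtain v where v: "v \<in> ends G e" "v \<in> ends G f" by blast
    show "c e \<noteq> c f"
    proof
      assume "c e = c f"
      then have "ends G e = ends G f" using cP[OF ef(1)] cP[OF ef(2)] v by metis
      then show False using ends_inj ef by (auto simp: inj_on_def)
    qed
  qed
  then show ?thesis by blast
qed

text \<open>An injective numbering of the edges is a proper colouring, so the \<open>LEAST\<close>
  in \<open>chromatic_index\<close> is attained.\<close>

lemma chromatic_index_coloring: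
  assumes "multigraph H"
  shows "\<exists>c. proper_edge_coloring H (chromatic_index H) c"
proof -
  obtain f :: "'b \<Rightarrow> nat" and n where f: "f ` edges H = {i. i < n}" "inj_on f (edges H)"
    using finite_imp_inj_to_nat_seg[OF multigraph.finite_edges[OF assms]] by blast
  then have "proper_edge_coloring H n f"
    unfolding proper_edge_coloring_def inj_on_def by blast
  then have "\<exists>k c. proper_edge_coloring H k c" by blast
  then show ?thesis unfolding chromatic_index_def by (rule LeastI_ex)
qed

lemma coloring_mono: "proper_edge_coloring H k c \<Longrightarrow> k \<le> k' \<Longrightarrow> proper_edge_coloring H k' c"
  unfolding proper_edge_coloring_def by (meson order_less_le_trans)

lemma degree_eq_nb:
  assumes G: "simple_graph G"
  shows "degree G v = card (nbrs (ends G ` edges G) v)"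
proof -
  interpret simple_graph G by (rule G)
  have "degree G v = card (ends G ` incident_edges G v)"
    unfolding degree_def using ends_inj by (intro card_image[symmetric]) (auto simp: incident_edges_def inj_on_def)
  also have "ends G ` incident_edges G v = (\<lambda>w. {v, w}) ` nbrs (ends G ` edges G) v"
  proof
    show "ends G ` incident_edges G v \<subseteq> (\<lambda>w. {v, w}) ` nbrs (ends G ` edges G) v"
    proof
      fix x assume "x \<in> ends G ` incident_edges G v"
      then obtain e where e: "e \<in> edges G" "v \<in> ends G e" "x = ends G e" by (auto simp: incident_edges_def)
      then obtain w where w: "ends G e = {v, w}" "v \<noteq> w" using card_2_other[OF card_ends[OF e(1)]] by blast
      then have "w \<in> nbrs (ends G ` edges G) v" using e by (auto simp: nbrs_def)
      then show "x \<in> (\<lambda>w. {v, w}) ` nbrs (ends G ` edges G) v" using e w by blast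
    qed
    show "(\<lambda>w. {v, w}) ` nbrs (ends G ` edges G) v \<subseteq> ends G ` incident_edges G v"
    proof
      fix x assume "x \<in> (\<lambda>w. {v, w}) ` nbrs (ends G ` edges G) v"
      then obtain w where w: "x = {v, w}" "{v, w} \<in> ends G ` edges G" by (auto simp: nbrs_def)
      then obtain e where "e \<in> edges G" "ends G e = {v, w}" by auto
      then have "e \<in> incident_edges G v" "ends G e = x" using w by (auto simp: incident_edges_def)
      then show "x \<in> ends G ` incident_edges G v" by blast
    qed
  qed
  also have "card \<dots> = card (nbrs (ends G ` edges G) v)"
    by (intro card_image inj_onI) (auto simp: doubleton_eq_iff)
  finally show ?thesis .
qed

lemma critical_critical_graph:
  assumes G: "simple_graph G" and cr: "critical \<Delta> G"
  shows "critical_graph (verts G) (ends G ` edges G) \<Delta>"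
proof
  interpret simple_graph G by (rule G)
  let ?E = "ends G ` edges G"
  have mg: "multigraph G" by unfold_locales
  show "finite (verts G)" by (rule finite_verts)
  show sub: "e \<subseteq> verts G" if "e \<in> ?E" for e using that ends_subset by auto
  show "card e = 2" if "e \<in> ?E" for e using that card_ends by auto
  show "card (nbrs ?E v) \<le> \<Delta>" for v
  proof (cases "v \<in> verts G")
    case True
    have "degree G v \<le> max_degree G" unfolding max_degree_def
      using True finite_verts by (intro Max_ge) auto
    then show ?thesis using degree_eq_nb[OF G, of v] cr by (simp add: critical_def)
  next
    case False
    then have "nbrs ?E v = {}" using sub by (auto simp: nbrs_def)
    then show ?thesis by simp
  qed
  show "\<not> mcol {..<\<Delta>} ?E m" for m
  proof
    assume "mcol {..<\<Delta>} ?E m"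
    then have "\<exists>c. proper_edge_coloring G \<Delta> c" by (rule coloring_of_mcol[OF G])
    then have "chromatic_index G \<le> \<Delta>" unfolding chromatic_index_def by (rule Least_le)
    then show False using cr by (simp add: critical_def)
  qed
  have small: "\<exists>c. proper_edge_coloring H \<Delta> c" if H: "multigraph H" "proper_subgraph H G" for H
  proof -
    obtain c where "proper_edge_coloring H (chromatic_index H) c" using chromatic_index_coloring[OF H(1)] by blast
    moreover have "chromatic_index H \<le> \<Delta>" using cr H(2) unfolding critical_def by fastforce
    ultimately show ?thesis using coloring_mono by blast
  qed
  show "\<exists>m. mcol {..<\<Delta>} (?E - {e}) m" if e: "e \<in> ?E" for e
  proof -
    obtain f where f: "f \<in> edges G" "ends G f = e" using e by auto
    let ?H = "G\<lparr>edges := edges G - {f}\<rparr>"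
    have H: "multigraph ?H"
      using finite_verts finite_edges ends_subset card_ends by unfold_locales auto
    have "proper_subgraph ?H G" using H f by (auto simp: proper_subgraph_def subgraph_def)
    then obtain c where c: "proper_edge_coloring ?H \<Delta> c" using small[OF H] by blast
    have "inj_on (ends ?H) (edges ?H)" using ends_inj by (auto simp: inj_on_def)
    from mcol_of_coloring[OF H this c] obtain m where "mcol {..<\<Delta>} (ends G ` (edges G - {f})) m" by auto
    moreover have "ends G ` (edges G - {f}) = ?E - {e}" using ends_inj f by (auto simp: inj_on_def)
    ultimately show ?thesis by auto
  qed
  show "nbrs ?E v \<noteq> {}" if v: "v \<in> verts G" for v
  proof
    assume iso: "nbrs ?E v = {}"
    let ?H = "G\<lparr>verts := verts G - {v}\<rparr>"
    have nv: "v \<notin> ends G e" if e: "e \<in> edges G" for e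
    proof
      assume "v \<in> ends G e"
      then obtain w where "ends G e = {v, w}" "v \<noteq> w" using card_2_other[OF card_ends[OF e]] by blast
      then have "w \<in> nbrs ?E v" using e by (auto simp: nbrs_def)
      then show False using iso by simp
    qed
    have H: "multigraph ?H"
      using finite_verts finite_edges ends_subset card_ends nv by unfold_locales auto
    have "proper_subgraph ?H G" using H v by (auto simp: proper_subgraph_def subgraph_def)
    then obtain c where "proper_edge_coloring ?H \<Delta> c" using small[OF H] by blast
    then have "\<exists>c. proper_edge_coloring G \<Delta> c" by (auto simp: proper_edge_coloring_def)
    then have "chromatic_index G \<le> \<Delta>" unfolding chromatic_index_def by (rule Least_le)
    then show False using cr by (simp add: critical_def)
  qed
qed

section \<open>Counting edges and identifying the pair\<close>

lemma degree_sum: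
  assumes "multigraph G"
  shows "(\<Sum>v\<in>verts G. degree G v) = 2 * card (edges G)"
proof -
  interpret multigraph G by (rule assms)
  have "(\<Sum>v\<in>verts G. degree G v) = (\<Sum>v\<in>verts G. \<Sum>e\<in>edges G. if v \<in> ends G e then 1 else 0)"
    unfolding degree_def incident_edges_def using finite_edges
    by (intro sum.cong) (auto simp: sum.If_cases Int_def)
  also have "\<dots> = (\<Sum>e\<in>edges G. \<Sum>v\<in>verts G. if v \<in> ends G e then 1 else 0)" by (rule sum.swap)
  also have "\<dots> = (\<Sum>e\<in>edges G. 2)"
  proof (rule sum.cong)
    fix e assume e: "e \<in> edges G"
    have "verts G \<inter> ends G e = ends G e" using ends_subset[OF e] by blast
    then show "(\<Sum>v\<in>verts G. if v \<in> ends G e then 1 else 0) = (2::nat)"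
      using card_ends[OF e] finite_verts by (simp add: sum.If_cases Collect_mem_eq)
  qed simp
  finally show ?thesis by simp
qed

theorem theorem1p2:
  fixes n \<Delta> :: nat and G :: "('v, 'e) graph"
  assumes "n > 0" and "\<Delta> > 0"
    and "real \<Delta> \<ge> 3 * (real n - 1) / 4"
    and "simple_graph G" and "card (verts G) = n"
    and "critical \<Delta> G"
    and "\<exists>u v. full_deficiency_pair G u v"
  shows "overfull G \<and>
    (\<exists>H :: ('v, 'e) graph. multigraph H \<and> card (verts H) = n - 1 \<and>
       regular \<Delta> H \<and> class1 H \<and> vertex_splitting H G)"
proof -
  interpret simple_graph G by (rule assms)
  have mg: "multigraph G" by unfold_locales
  interpret critical_graph "verts G" "ends G ` edges G" \<Delta> using critical_critical_graph assms by blast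
  let ?E = "ends G ` edges G"
  have "3 * real n \<le> 4 * real \<Delta> + 3" using assms(3) by (simp add: field_simps)
  then have dense: "3 * card (verts G) \<le> 4 * \<Delta> + 3" unfolding assms(5) by linarith
  have md: "max_degree G = \<Delta>" using assms(6) by (simp add: critical_def)
  obtain a b where ab: "a \<in> verts G" "b \<in> verts G" "adjacent G a b" "degree G a + degree G b = \<Delta> + 2"
    using assms(7) md by (auto simp: full_deficiency_pair_def)
  obtain f where f: "f \<in> edges G" "ends G f = {a, b}" using ab(3) by (auto simp: adjacent_def)
  have e: "{a, b} \<in> ?E" using f by (metis imageI)
  have ne: "a \<noteq> b" using edge_ne[OF e] .
  have dd: "deg a + deg b = \<Delta> + 2" using ab(4) degree_eq_nb[OF assms(4)] by simp
  have full: "deg v = \<Delta>" if "v \<in> verts G" "v \<noteq> a" "v \<noteq> b" for v using all_full[OF e dd dense that] .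
  let ?H' = "G\<lparr>edges := edges G - {f}\<rparr>"
  have H': "multigraph ?H'" using finite_verts finite_edges ends_subset card_ends by unfold_locales auto
  have "proper_subgraph ?H' G" using H' f by (auto simp: proper_subgraph_def subgraph_def)
  then have "chromatic_index ?H' \<le> \<Delta>" using assms(6) unfolding critical_def by fastforce
  then obtain c where c: "proper_edge_coloring ?H' \<Delta> c"
    using chromatic_index_coloring[OF H'] coloring_mono by blast
  have injH: "inj_on (ends ?H') (edges ?H')" using ends_inj by (auto simp: inj_on_def)
  have img: "ends G ` (edges G - {f}) = ?E - {{a, b}}"
    using inj_on_image_set_diff[OF ends_inj, of "edges G" "{f}"] f by simp
  obtain m where m: "mcol {..<\<Delta>} (?E - {{a, b}}) m"
    and mc: "\<And>e v. e \<in> edges G \<Longrightarrow> e \<noteq> f \<Longrightarrow> v \<in> ends G e \<Longrightarrow> m (c e) v \<noteq> v"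
    using mcol_of_coloring[OF H' injH c] by (auto simp: img)
  note pw = pairwI[OF e dd]
  \<comment> \<open>Colour 0 exists since \<open>\<Delta> > 0\<close>; every other colour would
    serve as well.\<close>
  have "even (card {v\<in>verts G. m 0 v \<noteq> v})"
  proof (rule even_card_nonfixed[OF finite_verts])
    show "m 0 (m 0 v) = v" for v using mcol_invol[OF m] assms(2) by simp
    show "m 0 v \<in> verts G" if "v \<in> verts G" for v
    proof (cases "m 0 v = v")
      case False
      then have "{v, m 0 v} \<in> ?E" using mcol_edge[OF m, of 0 v] assms(2) by simp
      then show ?thesis using EV by blast
    qed (use that in simp)
  qed
  moreover have "card {v\<in>verts G. m 0 v \<noteq> v} = n - 1"
  proof -
    have "m 0 v \<noteq> v" if v: "v \<in> verts G" "v \<noteq> a" "v \<noteq> b" for v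
    proof
      assume "m 0 v = v"
      then have "{i\<in>K. m i v = v} \<noteq> {}" using assms(2) by blast
      then have "card {i\<in>K. m i v = v} > 0" by (simp add: card_gt_0_iff)
      then show False using card_missing[OF m, of v] full[OF v] unfolding nbrs_Diff_other[OF v(2,3), of ?E] by linarith
    qed
    moreover have "m 0 a = a \<longleftrightarrow> m 0 b \<noteq> b" using compl_pair_iff[OF pw m] assms(2) by simp
    ultimately have "{v\<in>verts G. m 0 v \<noteq> v} = verts G - {if m 0 a = a then a else b}"
      using ab ne by auto
    then show ?thesis using ab assms(5) finite_verts by simp
  qed
  ultimately have "even (n - 1)" by simp
  then obtain k where "n - 1 = 2 * k" by (rule evenE)
  then have k: "n = 2 * k + 1" using assms(1) by simp
  \<comment> \<open>The sum is \<open>(n - 1) * \<Delta> + 2\<close>, so there is exactly one edge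
    more than an overfull graph has to exceed.\<close>
  have "(\<Sum>v\<in>verts G. degree G v) = degree G a + (degree G b + (\<Sum>v\<in>verts G - {a} - {b}. degree G v))"
    using ab ne finite_verts by (simp add: sum.remove)
  also have "(\<Sum>v\<in>verts G - {a} - {b}. degree G v) = (\<Sum>v\<in>verts G - {a} - {b}. \<Delta>)"
    using full degree_eq_nb[OF assms(4)] by (intro sum.cong) auto
  also have "\<dots> = (n - 2) * \<Delta>" using ab ne finite_verts assms(5) by (simp add: numeral_2_eq_2)
  finally have "2 * card (edges G) = \<Delta> + 2 + (n - 2) * \<Delta>" using degree_sum[OF mg] ab(4) by simp
  moreover have "k > 0" using k ab ne assms(5) card_le_Suc0_iff_eq[OF finite_verts] by (cases k) auto
  moreover from this have "(n - 2) * \<Delta> + \<Delta> = 2 * (k * \<Delta>)" using k by (cases k) (auto simp: algebra_simps)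
  ultimately have "card (edges G) = \<Delta> * k + 1" by (simp add: algebra_simps)
  then have over: "overfull G" using k md assms(5) by (simp add: overfull_def)

  \<comment> \<open>\<open>b\<close> is merged into \<open>a\<close>. Labels are kept, so the edges
    to a common neighbour become parallel; leaving out \<open>f\<close> avoids a loop.\<close>
  define H where "H = \<lparr>verts = verts G - {b}, edges = edges G - {f},
     ends = (\<lambda>e. if b \<in> ends G e then insert a (ends G e - {b}) else ends G e)\<rparr>"
  have Hs: "verts H = verts G - {b}" "edges H = edges G - {f}"
    "ends H e = (if b \<in> ends G e then insert a (ends G e - {b}) else ends G e)" for e
    by (auto simp: H_def)
  have notboth: "\<not> (a \<in> ends G e \<and> b \<in> ends G e)" if e: "e \<in> edges G" "e \<noteq> f" for e
  proof
    assume h: "a \<in> ends G e \<and> b \<in> ends G e"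
    obtain x y where "ends G e = {x, y}" using card_ends[OF e(1)] by (auto simp: card_2_iff)
    then have "ends G e = {a, b}" using h ne by auto
    then show False using ends_inj f e by (auto simp: inj_on_def)
  qed
  have mH: "multigraph H"
  proof
    show "finite (verts H)" "finite (edges H)" using finite_verts finite_edges by (auto simp: Hs)
    fix e assume e: "e \<in> edges H"
    then have eG: "e \<in> edges G" "e \<noteq> f" by (auto simp: Hs)
    show "ends H e \<subseteq> verts H" using ends_subset[OF eG(1)] ab ne by (auto simp: Hs)
    have "finite (ends G e)" using card_ends[OF eG(1)] by (intro card_ge_0_finite) simp
    then show "card (ends H e) = 2" using card_ends[OF eG(1)] notboth[OF eG] by (auto simp: Hs)
  qed
  have cardH: "card (verts H) = n - 1" using ab assms(5) finite_verts by (simp add: Hs)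
  let ?A = "incident_edges G a - {f}" and ?B = "incident_edges G b - {f}"
  have AB: "?A \<inter> ?B = {}" using notboth by (auto simp: incident_edges_def)
  have incA: "incident_edges H a = ?A \<union> ?B" using ne by (auto simp: incident_edges_def Hs split: if_splits)
  have fin: "finite (incident_edges G v)" for v using finite_edges by (auto simp: incident_edges_def)
  have fab: "f \<in> incident_edges G a" "f \<in> incident_edges G b" using f by (auto simp: incident_edges_def)
  have cA: "card ?A + 1 = degree G a" "card ?B + 1 = degree G b"
    unfolding degree_def Suc_eq_plus1[symmetric]
    by (rule card_Suc_Diff1[OF fin fab(1)], rule card_Suc_Diff1[OF fin fab(2)])
  have degHa: "degree H a = \<Delta>"
    unfolding degree_def incA using card_Un_disjoint[OF _ _ AB] fin cA ab(4) by simp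
  have reg: "regular \<Delta> H"
    unfolding regular_def
  proof
    fix v assume v: "v \<in> verts H"
    show "degree H v = \<Delta>"
    proof (cases "v = a")
      case False
      have v': "v \<in> verts G" "v \<noteq> b" using v by (auto simp: Hs)
      have "incident_edges H v = incident_edges G v" using False v' f
        by (auto simp: incident_edges_def Hs split: if_splits)
      then show ?thesis using full[OF v'(1) False v'(2)] degree_eq_nb[OF assms(4), of v] by (simp add: degree_def)
    qed (use degHa in simp)
  qed
  have aH: "a \<in> verts H" using ab ne by (simp add: Hs)
  have mdH: "max_degree H = \<Delta>"
  proof -
    have "degree H ` verts H = {\<Delta>}" using reg aH by (auto simp: regular_def)
    then show ?thesis by (simp add: max_degree_def)
  qed
  have colH: "proper_edge_coloring H \<Delta> c"
    unfolding proper_edge_coloring_def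
  proof (intro conjI ballI impI)
    show "c e < \<Delta>" if "e \<in> edges H" for e using that c by (simp add: proper_edge_coloring_def Hs)
    fix e e' assume ee: "e \<in> edges H" "e' \<in> edges H" "e \<noteq> e' \<and> ends H e \<inter> ends H e' \<noteq> {}"
    have eG: "e \<in> edges G" "e \<noteq> f" "e' \<in> edges G" "e' \<noteq> f" using ee by (auto simp: Hs)
    have ck: "c e < \<Delta>" "c e' < \<Delta>" using ee c by (auto simp: proper_edge_coloring_def Hs)
    show "c e \<noteq> c e'"
    proof (cases "ends G e \<inter> ends G e' = {}")
      case False
      then show ?thesis using c ee eG by (simp add: proper_edge_coloring_def)
    next
      case True
      \<comment> \<open>The two edges have become adjacent only through the merging, and no colour
        is present at both \<open>a\<close> and \<open>b\<close>.\<close>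
      have "a \<in> ends G e \<and> b \<in> ends G e' \<or> b \<in> ends G e \<and> a \<in> ends G e'"
        using ee(3) True by (auto simp: Hs split: if_splits)
      then show ?thesis
        using mc[OF eG(1,2)] mc[OF eG(3,4)] compl_pair_iff[OF pw m] ck by (metis lessThan_iff)
    qed
  qed
  have "chromatic_index H = \<Delta>"
    unfolding chromatic_index_def
  proof (rule Least_equality)
    show "\<exists>c. proper_edge_coloring H \<Delta> c" using colH by blast
    fix l assume "\<exists>c. proper_edge_coloring H l c"
    then obtain d where d: "proper_edge_coloring H l d" by blast
    have "inj_on d (incident_edges H a)" "d ` incident_edges H a \<subseteq> {..<l}"
      using d unfolding proper_edge_coloring_def incident_edges_def inj_on_def by blast+
    then have "card (incident_edges H a) \<le> card {..<l}" by (intro card_inj_on_le) auto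
    then show "\<Delta> \<le> l" using degHa by (simp add: degree_def)
  qed
  then have cl: "class1 H" using mdH by (simp add: class1_def)
  \<comment> \<open>Both degrees are at most \<Delta> and their sum is \<open>\<Delta> + 2\<close>;
    thus both parts of the splitting are nonempty.\<close>
  have deg2: "2 \<le> degree G a" "2 \<le> degree G b"
    using ab(4) degree_eq_nb[OF assms(4)] deg_le[of a] deg_le[of b] by simp_all
  have "vertex_splitting H G"
    unfolding vertex_splitting_def
  proof (intro exI conjI)
    show "a \<in> verts H" by (rule aH)
    show "a \<noteq> b" by (rule ne)
    show "a \<notin> verts H - {a}" by simp
    show "b \<notin> verts H - {a}" by (simp add: Hs)
    show "f \<notin> edges H" by (simp add: Hs)
    show "?A \<union> ?B = incident_edges H a" by (rule incA[symmetric])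
    show "?A \<inter> ?B = {}" by (rule AB)
    show "?A \<noteq> {}" "?B \<noteq> {}" using cA deg2 by (metis One_nat_def add_0 card.empty not_less_eq_eq numeral_2_eq_2 order_refl)+
    show "verts G = verts H - {a} \<union> {a, b}" using ab by (auto simp: Hs)
    show "edges G = insert f (edges H)" using f by (auto simp: Hs)
    show "ends G f = {a, b}" by (rule f(2))
    show "\<forall>e\<in>?A. ends G e = insert a (ends H e - {a})" using notboth by (auto simp: incident_edges_def Hs)
    show "\<forall>e\<in>?B. ends G e = insert b (ends H e - {a})"
    proof
      fix e assume "e \<in> ?B"
      then have "e \<in> edges G" "e \<noteq> f" "b \<in> ends G e" by (auto simp: incident_edges_def)
      then show "ends G e = insert b (ends H e - {a})" using notboth[of e] by (auto simp: Hs)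
    qed
    show "\<forall>e\<in>edges H - incident_edges H a. ends G e = ends H e" unfolding incA
      by (auto simp: incident_edges_def Hs)
  qed
  then show ?thesis using over mH cardH reg cl by blast
qed

end
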